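(* Every elementary homogeneous holomorphic vector bundle $E$ over $\mathbb D$ with a reproducing kernel arises from the construction described in the context; that is, there exist $\eta>0$, a block matrix $Y$ (of the subdiagonal block type described in the context) and an invertible block diagonal matrix $N$ such that $E$, with its reproducing kernel and the Hermitian structure this kernel induces, is isomorphic as a homogeneous holomorphic Hermitian vector bundle to $(E^{(\eta,Y)},H_N^{(\eta,Y)})$ with reproducing kernel $K_N^{(\eta,Y)}$.
   Context: **Groups.** $\mathbb D$ is the open unit disc, $G$ is the group of its biholomorphic automorphisms (Möbius group), and $\tilde G$ is the universal covering group of $G$, acting on $\mathbb D$ through $G$. For $g\in\tilde G$, $g'(z)$ is the derivative of $z\mapsto g\cdot z$. For real $s$, $g'(z)^s$ is the branch, continuous on $\tilde G\times\mathbb D$ and holomorphic in $z$, equal to $1$ at $g=e$. $c_g$ is the analytic function on $\tilde G$ which, for $g$ near $e$ acting by $z\mapsto (az+b)(cz+d)^{-1}$ (matrix in $SU(1,1)$ near the identity), equals $c$. **Elementary bundles.** Let $\eta\in\mathbb R$, $m\ge 0$, $d_0,\dots,d_m\ge 1$, $n=\sum_j d_j$, $\mathbb C^n=\bigoplus_{j=0}^m\mathbb C^{d_j}$. Let $Y$ be a block matrix on $\mathbb C^n$ whose only possibly nonzero blocks are the subdiagonal ones $Y_j:\mathbb C^{d_{j-1}}\to\mathbb C^{d_j}$, $1\le j\le m$. "Block diagonal" refers to this decomposition. $E^{(\eta,Y)}$ is the trivial holomorphic bundle $\mathbb D\times\mathbb C^n$ (sections are holomorphic functions $f:\mathbb D\to\mathbb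 C^n$) with $\tilde G$-action $f\mapsto J_{g^{-1}}\,(f\circ g^{-1})$, where $J_g=J_g^{(\eta,Y)}$ has blocks $$(J_g(z))_{p,\ell}=\tfrac{1}{(p-\ell)!}(-c_g)^{p-\ell}\,g'(z)^{\eta+\frac{p+\ell}{2}}\,Y_p\cdots Y_{\ell+1}\ \ (p\ge\ell),\qquad (J_g(z))_{p,\ell}=0\ \ (p<\ell),$$ with the empty product equal to the identity. An elementary homogeneous holomorphic vector bundle (always assumed to admit an invariant Hermitian structure) is one isomorphic, as a $\tilde G$-homogeneous holomorphic vector bundle, to some $E^{(\eta,Y)}$, $\eta\in\mathbb R$. **Hermitian structures.** For a positive definite block diagonal $H$, $(E^{(\eta,Y)},H)$ denotes $E^{(\eta,Y)}$ with the Hermitian structure $\langle\zeta,\xi\rangle_z=\langle H(z)\zeta,\xi\rangle$ such that $H(0)=H$ and $J_g(z)H(g\cdot z)^{-1}J_g(z)^*=H(z)^{-1}$ for all $g\in\tilde G$, $z\in\mathbb D$. **Reproducing kernel.** Such a bundle, trivialized as some $E^{(\eta,Y)}$ with multiplier $J$, has a reproducing kernel $K$ if $K$ is the reproducing kernel of a Hilbert space of holomorphic sections on which the action $f\mapsto J_{g^{-1}}(f\circ g^{-1})$ of $\tilde G$ is unitary. Then $K(z,w)=J_g(z)K(gz,gw)J_g(w)^*$, and $K$ induces a Hermitian structure given by $H(0)=K(0,0)^{-1}$. **The construction.** For $\lambda>0$, $\mathbb A^{(\lambda)}$ is the Hilbert space of holomorphic functions on $\mathbb D$ with reproducing kernel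 $(1-z\bar w)^{-2\lambda}$, on which $\tilde G$ acts unitarily with multiplier $g'(z)^\lambda$. For $\eta>0$ let $\mathbf A^{(\eta)}=\bigoplus_{j=0}^m\mathbb A^{(\eta+j)}\otimes\mathbb C^{d_j}$, and write $f_j$ for the component of $f$ in the $j$-th summand. Define $$(\Gamma^{(\eta,Y)}f)_\ell=\sum_{j=0}^{\ell}\frac{1}{(\ell-j)!}\,\frac{1}{(2\eta+2j)_{\ell-j}}\,Y_\ell\cdots Y_{j+1}f_j^{(\ell-j)},\qquad 0\le\ell\le m,$$ where $(x)_k=x(x+1)\cdots(x+k-1)$ and $f_j^{(k)}$ is the $k$-th derivative. For invertible block diagonal $N$ on $\mathbb C^n$ put $\Gamma_N^{(\eta,Y)}=\Gamma^{(\eta,Y)}\circ N$, a $\tilde G$-equivariant isomorphism of $\mathbf A^{(\eta)}$, as a homogeneous holomorphic vector bundle, onto $E^{(\eta,Y)}$. $K_N^{(\eta,Y)}$ is the image under $\Gamma_N^{(\eta,Y)}$ of the reproducing kernel of $\mathbf A^{(\eta)}$, i.e. the reproducing kernel of the image of $\mathbf A^{(\eta)}$ with the Hilbert space structure making $\Gamma_N^{(\eta,Y)}$ unitary. Finally $H_N^{(\eta,Y)}=K_N^{(\eta,Y)}(0,0)^{-1}$, a block diagonal matrix.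
   Formalization: The Hilbert space of sections with reproducing kernel K is additionally assumed to be closed under multiplication by z; without this the claim fails, e.g. for the constant functions with K=1 on the trivial line bundle with η=0. *)

theory Defs
  imports
    "HOL-Complex_Analysis.Complex_Analysis"
    "HOL-Algebra.Group"
    "HOL-Library.Function_Algebras"
begin

abbreviation disc :: "complex set" where
  "disc \<equiv> ball 0 1"

section \<open>The universal covering group of the Moebius group\<close>

text \<open>
  Every biholomorphic automorphism of the disc is
  \<open>Moebius_function t w z = exp (\<i> * t) * (z - w) / (1 - cnj w * z)\<close> for a unique \<open>w \<in> disc\<close> and a
  \<open>t\<close> that is unique modulo \<open>2 * pi\<close>.  Hence the Moebius group is homeomorphic to circle times disc,
  and its universal covering is \<open>UNIV \<times> disc\<close>, the elements being the pairs \<open>(t, w)\<close>.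
  The term \<open>- 2 * Arg u\<close> in the product is what makes the lifted product continuous;
  \<open>Re u > 0\<close>, so \<open>Arg\<close> is not evaluated near its cut.  The lemmas of this section show
  that this is a group with continuous operations on a simply connected space, acting on the disc
  through a homomorphism onto the automorphism group whose kernel \<open>{(2 * pi * k, 0) |k. k \<in> \<int>}\<close>
  is discrete.
\<close>

type_synonym mob = "real \<times> complex"

definition mob_cover :: "mob monoid" where
  "mob_cover = \<lparr>carrier = UNIV \<times> disc,
     mult = (\<lambda>(t, w) (s, v). let u = 1 + cnj w * cis s * v
               in (t + s - 2 * Arg u, (v + cis (- s) * w) / cnj u)),
     one = (0, 0)\<rparr>"

definition act :: "mob \<Rightarrow> complex \<Rightarrow> complex" where
  "act g z = Moebius_function (fst g) (snd g) z"

text \<open>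
  The branch of \<open>log g'(z)\<close> that is continuous on \<open>mob_cover \<times> disc\<close> and vanishes at \<open>g = e\<close>.
\<close>

definition log_deriv :: "mob \<Rightarrow> complex \<Rightarrow> complex" where
  "log_deriv g z = \<i> * fst g + ln (1 - (cmod (snd g))\<^sup>2) - 2 * Ln (1 - cnj (snd g) * z)"

definition deriv_pow :: "mob \<Rightarrow> real \<Rightarrow> complex \<Rightarrow> complex" where
  "deriv_pow g s z = exp (s * log_deriv g z)"

text \<open>The second row \<open>(c, d)\<close> of the matrix in \<open>SU(1,1)\<close>; see \<open>act_SU11\<close> below.\<close>

definition c_of :: "mob \<Rightarrow> complex" where
  "c_of g = - cnj (snd g) * cis (- fst g / 2) / sqrt (1 - (cmod (snd g))\<^sup>2)"

definition d_of :: "mob \<Rightarrow> complex" where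
  "d_of g = cis (- fst g / 2) / sqrt (1 - (cmod (snd g))\<^sup>2)"

lemma carrier_mob_cover: "carrier mob_cover = UNIV \<times> disc"
  by (simp add: mob_cover_def)

lemma one_mob_cover: "\<one>\<^bsub>mob_cover\<^esub> = (0, 0)"
  by (simp add: mob_cover_def)

lemma mult_mob_cover:
  "(t, w) \<otimes>\<^bsub>mob_cover\<^esub> (s, v) =
     (t + s - 2 * Arg (1 + cnj w * cis s * v),
      (v + cis (- s) * w) / cnj (1 + cnj w * cis s * v))"
  by (simp add: mob_cover_def Let_def)

lemma Re_one_plus_pos: "cmod x < 1 \<Longrightarrow> Re (1 + x) > 0"
  using abs_Re_le_cmod[of x] by simp

lemma Re_one_minus_pos: "cmod x < 1 \<Longrightarrow> Re (1 - x) > 0"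
  using abs_Re_le_cmod[of x] by simp

lemma cmod_mult_lt_1: "cmod a < 1 \<Longrightarrow> cmod b < 1 \<Longrightarrow> cmod (a * b) < 1"
  by (metis norm_mult_less mult_1)

lemma act_in_disc: "g \<in> carrier mob_cover \<Longrightarrow> z \<in> disc \<Longrightarrow> act g z \<in> disc"
  by (auto simp: carrier_mob_cover act_def intro!: Moebius_function_norm_lt_1)

lemma norm_act_lt_1: "g \<in> carrier mob_cover \<Longrightarrow> cmod z < 1 \<Longrightarrow> cmod (act g z) < 1"
  using act_in_disc[of g z] by simp

lemma act_one: "act \<one>\<^bsub>mob_cover\<^esub> z = z"
  by (simp add: one_mob_cover act_def Moebius_function_def)

lemma one_minus_norm_quotient:
  fixes s :: real
  assumes "cmod v < 1" "cmod w < 1"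
  defines "u \<equiv> 1 + cnj w * cis s * v"
  shows "1 - (cmod ((v + cis (- s) * w) / cnj u))\<^sup>2 =
     (1 - (cmod v)\<^sup>2) * (1 - (cmod w)\<^sup>2) / (cmod u)\<^sup>2"
proof -
  have "cmod (cnj w * cis s * v) < 1"
    using assms by (simp add: norm_mult) (metis cmod_mult_lt_1 norm_mult)
  then have u0: "u \<noteq> 0"
    unfolding u_def using Re_one_plus_pos[of "cnj w * cis s * v"] by force
  have cc: "cis s * cis (-s) = 1" by (simp add: cis_mult)
  have "complex_of_real ((cmod u)\<^sup>2 - (cmod (v + cis (- s) * w))\<^sup>2) =
        u * cnj u - (v + cis (- s) * w) * cnj (v + cis (- s) * w)"
    by (simp only: of_real_diff complex_norm_square)
  also have "\<dots> = 1 + (w * cnj w) * (v * cnj v) * (cis s * cis (-s)) - v * cnj v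
      - w * cnj w * (cis s * cis (-s))"
    by (simp add: u_def cis_cnj algebra_simps)
  also have "\<dots> = (1 - v * cnj v) * (1 - w * cnj w)"
    unfolding cc by (simp add: algebra_simps)
  also have "\<dots> = complex_of_real ((1 - (cmod v)\<^sup>2) * (1 - (cmod w)\<^sup>2))"
    by (simp only: of_real_diff of_real_mult complex_norm_square of_real_1)
  finally have "(cmod u)\<^sup>2 - (cmod (v + cis (- s) * w))\<^sup>2 = (1 - (cmod v)\<^sup>2) * (1 - (cmod w)\<^sup>2)"
    using of_real_eq_iff by blast
  then show ?thesis
    using u0 by (simp add: norm_divide power_divide field_simps)
qed

lemma mob_mult_closed:
  assumes "g \<in> carrier mob_cover" "h \<in> carrier mob_cover"
  shows "g \<otimes>\<^bsub>mob_cover\<^esub> h \<in> carrier mob_cover"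
proof -
  obtain t w s v where gh: "g = (t, w)" "h = (s, v)" by (metis surj_pair)
  have wv: "cmod w < 1" "cmod v < 1" using assms gh by (auto simp: carrier_mob_cover)
  define u where "u = 1 + cnj w * cis s * v"
  have "cmod (cnj w * cis s * v) < 1"
    using wv by (simp add: norm_mult) (metis cmod_mult_lt_1 norm_mult)
  then have u0: "u \<noteq> 0"
    unfolding u_def using Re_one_plus_pos[of "cnj w * cis s * v"] by force
  have "0 < (1 - (cmod v)\<^sup>2) * (1 - (cmod w)\<^sup>2) / (cmod u)\<^sup>2"
    using u0 wv by (simp add: power_less_one_iff abs_square_less_1)
  then have "(cmod ((v + cis (- s) * w) / cnj u))\<^sup>2 < 1"
    using one_minus_norm_quotient[OF wv(2,1), of s] unfolding u_def by linarith
  then have "cmod ((v + cis (- s) * w) / cnj u) < 1"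
    by (simp add: abs_square_less_1)
  then show ?thesis
    by (simp add: gh mult_mob_cover carrier_mob_cover u_def)
qed

lemma mob_denominators:
  fixes s :: real
  assumes "cmod w < 1" "cmod v < 1" "cmod z < 1"
  defines "u \<equiv> 1 + cnj w * cis s * v"
  defines "w' \<equiv> (v + cis (- s) * w) / cnj u"
  shows "(1 - cnj w * Moebius_function s v z) * (1 - cnj v * z) = u * (1 - cnj w' * z)"
    and "u \<noteq> 0" and "1 - cnj v * z \<noteq> 0"
    and "u * cnj w' = cnj v + cis s * cnj w"
proof -
  have "cmod (cnj w * cis s * v) < 1"
    using assms by (simp add: norm_mult) (metis cmod_mult_lt_1 norm_mult)
  then show u0: "u \<noteq> 0"
    unfolding u_def using Re_one_plus_pos[of "cnj w * cis s * v"] by force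
  show v0: "1 - cnj v * z \<noteq> 0"
    using Re_one_minus_pos[of "cnj v * z"] cmod_mult_lt_1[of "cnj v" z] assms by force
  show uw: "u * cnj w' = cnj v + cis s * cnj w"
    using u0 by (simp add: w'_def cis_cnj)
  have "(1 - cnj w * Moebius_function s v z) * (1 - cnj v * z)
      = (1 - cnj v * z) - cnj w * (cis s * (z - v))"
    using v0 by (simp add: Moebius_function_def cis_conv_exp field_simps)
  also have "\<dots> = u - (u * cnj w') * z"
    unfolding uw by (simp add: u_def algebra_simps)
  finally show "(1 - cnj w * Moebius_function s v z) * (1 - cnj v * z) = u * (1 - cnj w' * z)"
    by (simp add: algebra_simps)
qed

lemma cis_Arg_quotient:
  assumes "u \<noteq> 0" shows "cis (- 2 * Arg u) = cnj u / u"
proof -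
  have u: "u = cmod u * cis (Arg u)" using assms by (metis Arg_eq cis_conv_exp mult.commute)
  have "cnj u = cmod u * cis (- Arg u)" by (subst u) (simp add: cis_cnj)
  then have "cnj u / u = cis (- Arg u) / cis (Arg u)"
    using assms by (subst (2) u) (simp add: field_simps)
  also have "\<dots> = cis (- 2 * Arg u)" by (simp add: cis_divide)
  finally show ?thesis by simp
qed

lemma act_mult:
  assumes "g \<in> carrier mob_cover" "h \<in> carrier mob_cover" "z \<in> disc"
  shows "act (g \<otimes>\<^bsub>mob_cover\<^esub> h) z = act g (act h z)"
proof -
  obtain t w s v where gh: "g = (t, w)" "h = (s, v)" by (metis surj_pair)
  have wvz: "cmod w < 1" "cmod v < 1" "cmod z < 1" using assms gh by (auto simp: carrier_mob_cover)
  define u where "u = 1 + cnj w * cis s * v"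
  define w' where "w' = (v + cis (- s) * w) / cnj u"
  note D = mob_denominators(1)[OF wvz, of s, folded u_def, folded w'_def]
    mob_denominators(2)[OF wvz, of s, folded u_def] mob_denominators(3)[OF wvz]
  have cc: "cis s * cis (-s) = 1" by (simp add: cis_mult)
  have "w' \<in> disc"
    using mob_mult_closed[OF assms(1,2)]
    by (simp add: gh mult_mob_cover carrier_mob_cover u_def w'_def)
  then have n1: "1 - cnj w' * z \<noteq> 0"
    using Re_one_minus_pos[of "cnj w' * z"] cmod_mult_lt_1[of "cnj w'" z] wvz by force
  have "Moebius_function s v z - w = (cis s * (z - v) - w * (1 - cnj v * z)) / (1 - cnj v * z)"
    using D(3) by (simp add: Moebius_function_def cis_conv_exp divide_diff_eq_iff)
  also have "cis s * (z - v) - w * (1 - cnj v * z) = cis s * (cnj u * (z - w'))"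
  proof -
    have cu: "cnj u = 1 + w * cis (- s) * cnj v" by (simp add: u_def cis_cnj)
    have "cnj u * w' = v + cis (- s) * w" using D(2) by (simp add: w'_def)
    then have "cis s * (cnj u * (z - w')) = cis s * (cnj u * z - (v + cis (- s) * w))"
      by (simp only: right_diff_distrib)
    also have "\<dots> = cis s * z + (cis s * cis (- s)) * (w * cnj v * z) - cis s * v
        - (cis s * cis (- s)) * w"
      unfolding cu by (simp add: algebra_simps)
    also have "\<dots> = cis s * (z - v) - w * (1 - cnj v * z)"
      unfolding cc by (simp add: algebra_simps)
    finally show ?thesis by (rule sym)
  qed
  finally have num: "Moebius_function s v z - w = cis s * cnj u * (z - w') / (1 - cnj v * z)"
    by (simp add: mult.assoc)
  have den: "1 - cnj w * Moebius_function s v z = u * (1 - cnj w' * z) / (1 - cnj v * z)"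
    using D(1,3) by (simp add: eq_divide_eq)
  have "act g (act h z) = cis t * (Moebius_function s v z - w) / (1 - cnj w * Moebius_function s v z)"
  proof -
    have "act g q = cis t * (q - w) / (1 - cnj w * q)" for q
      by (simp add: gh act_def Moebius_function_def cis_conv_exp)
    moreover have "act h z = Moebius_function s v z" by (simp add: gh act_def)
    ultimately show ?thesis by simp
  qed
  also have "\<dots> = cis t * cis s * (cnj u / u) * (z - w') / (1 - cnj w' * z)"
    unfolding num den using D(3) by simp
  also have "\<dots> = cis (t + s - 2 * Arg u) * (z - w') / (1 - cnj w' * z)"
    unfolding cis_Arg_quotient[OF D(2), symmetric] cis_mult by (simp add: algebra_simps)
  also have "\<dots> = act (g \<otimes>\<^bsub>mob_cover\<^esub> h) z"
    by (simp add: gh mult_mob_cover act_def Moebius_function_def cis_conv_exp u_def w'_def)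
  finally show ?thesis by simp
qed

lemma log_deriv_mult:
  assumes "g \<in> carrier mob_cover" "h \<in> carrier mob_cover" "z \<in> disc"
  shows "log_deriv (g \<otimes>\<^bsub>mob_cover\<^esub> h) z = log_deriv g (act h z) + log_deriv h z"
proof -
  obtain t w s v where gh: "g = (t, w)" "h = (s, v)" by (metis surj_pair)
  have wvz: "cmod w < 1" "cmod v < 1" "cmod z < 1" using assms gh by (auto simp: carrier_mob_cover)
  define u where "u = 1 + cnj w * cis s * v"
  define w' where "w' = (v + cis (- s) * w) / cnj u"
  note D = mob_denominators(1)[OF wvz, of s, folded u_def, folded w'_def]
    mob_denominators(2)[OF wvz, of s, folded u_def] mob_denominators(3)[OF wvz]
  define q where "q = Moebius_function s v z"
  have q: "cmod q < 1" unfolding q_def using Moebius_function_norm_lt_1 wvz by blast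
  have w': "cmod w' < 1"
    using mob_mult_closed[OF assms(1,2)]
    by (simp add: gh mult_mob_cover carrier_mob_cover u_def w'_def)
  have "cmod (cnj w * cis s * v) < 1"
    using wvz by (simp add: norm_mult) (metis cmod_mult_lt_1 norm_mult)
  then have Re: "Re u > 0" "Re (1 - cnj w' * z) > 0" "Re (1 - cnj w * q) > 0" "Re (1 - cnj v * z) > 0"
    using w' q wvz cmod_mult_lt_1
    by (auto intro!: Re_one_minus_pos Re_one_plus_pos simp: u_def simp del: minus_complex.sel plus_complex.sel)
  have L: "Ln (1 - cnj w * q) + Ln (1 - cnj v * z) = Ln u + Ln (1 - cnj w' * z)"
  proof -
    have nz: "u \<noteq> 0" "1 - cnj w' * z \<noteq> 0" "1 - cnj w * q \<noteq> 0" "1 - cnj v * z \<noteq> 0"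
      using Re by force+
    have b: "\<bar>Im (Ln x)\<bar> < pi / 2" if "Re x > 0" for x
      using that Re_Ln_pos_lt[of x] by force
    have "Ln ((1 - cnj w * q) * (1 - cnj v * z)) = Ln (1 - cnj w * q) + Ln (1 - cnj v * z)"
      using b[OF Re(3)] b[OF Re(4)] by (intro Ln_times_simple nz) auto
    moreover have "Ln (u * (1 - cnj w' * z)) = Ln u + Ln (1 - cnj w' * z)"
      using b[OF Re(1)] b[OF Re(2)] by (intro Ln_times_simple nz) auto
    ultimately show ?thesis using D(1) by (simp add: q_def)
  qed
  have Lu: "Ln u = complex_of_real (ln (cmod u)) + \<i> * Arg u"
    using D(2) by (simp add: complex_eq_iff Arg_eq_Im_Ln)
  have pos: "0 < 1 - (cmod v)\<^sup>2" "0 < 1 - (cmod w)\<^sup>2"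
    using wvz by (simp_all add: abs_square_less_1)
  have N: "ln (1 - (cmod w')\<^sup>2) = ln (1 - (cmod v)\<^sup>2) + ln (1 - (cmod w)\<^sup>2) - 2 * ln (cmod u)"
    unfolding w'_def u_def one_minus_norm_quotient[OF wvz(2,1), of s]
    using pos D(2) by (simp add: ln_mult ln_div ln_realpow u_def)
  have "log_deriv (g \<otimes>\<^bsub>mob_cover\<^esub> h) z
     = \<i> * (t + s - 2 * Arg u) + ln (1 - (cmod w')\<^sup>2) - 2 * Ln (1 - cnj w' * z)"
    by (simp add: gh mult_mob_cover log_deriv_def u_def w'_def)
  also have "\<dots> = \<i> * (t + s) + ln (1 - (cmod v)\<^sup>2) + ln (1 - (cmod w)\<^sup>2)
       - 2 * (Ln u + Ln (1 - cnj w' * z))"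
    unfolding N Lu by (simp add: algebra_simps)
  also have "\<dots> = log_deriv g (act h z) + log_deriv h z"
    unfolding L[symmetric] by (simp add: gh log_deriv_def act_def q_def algebra_simps)
  finally show ?thesis .
qed

lemma mob_eqI:
  assumes "g \<in> carrier mob_cover" "h \<in> carrier mob_cover"
    and "\<And>z. z \<in> disc \<Longrightarrow> act g z = act h z" "log_deriv g 0 = log_deriv h 0"
  shows "g = h"
proof -
  obtain t w s v where gh: "g = (t, w)" "h = (s, v)" by (metis surj_pair)
  have wv: "cmod w < 1" "cmod v < 1" using assms gh by (auto simp: carrier_mob_cover)
  have "t = Im (log_deriv g 0)" "s = Im (log_deriv h 0)"
    by (simp_all add: gh log_deriv_def)
  then have "t = s" using assms(4) by simp
  moreover have "act h w = 0"
    using assms(3)[of w] wv by (simp add: gh act_def Moebius_function_eq_zero)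
  then have "w = v"
    using mob_denominators(3)[OF wv(2,2,1)] by (simp add: gh act_def Moebius_function_def)
  ultimately show ?thesis by (simp add: gh)
qed

lemma log_deriv_one: "log_deriv \<one>\<^bsub>mob_cover\<^esub> z = 0"
  by (simp add: one_mob_cover log_deriv_def)

lemma mob_inv_closed: "(t, w) \<in> carrier mob_cover \<Longrightarrow> (- t, - cis t * w) \<in> carrier mob_cover"
  by (simp add: carrier_mob_cover norm_mult)

lemma mob_inv_mult:
  assumes "(t, w) \<in> carrier mob_cover"
  shows "(- t, - cis t * w) \<otimes>\<^bsub>mob_cover\<^esub> (t, w) = \<one>\<^bsub>mob_cover\<^esub>"
proof -
  have w: "cmod w < 1" using assms by (simp add: carrier_mob_cover)
  have cc: "cis t * cis (-t) = 1" by (simp add: cis_mult)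
  have u: "1 + cnj (- cis t * w) * cis t * w = complex_of_real (1 - (cmod w)\<^sup>2)"
  proof -
    have "1 + cnj (- cis t * w) * cis t * w = 1 - (w * cnj w) * (cis t * cis (- t))"
      by (simp add: cis_cnj algebra_simps)
    also have "\<dots> = 1 - complex_of_real ((cmod w)\<^sup>2)"
      unfolding cc complex_norm_square by simp
    finally show ?thesis by simp
  qed
  have "Arg (complex_of_real (1 - (cmod w)\<^sup>2)) = 0"
    using w by (intro Arg_of_real[THEN trans]) (simp add: abs_square_less_1 not_less less_imp_le)
  moreover have "w + cis (- t) * (- cis t * w) = 0"
  proof -
    have "cis (- t) * (- cis t * w) = - ((cis t * cis (- t)) * w)" by simp
    then show ?thesis unfolding cc by simp
  qed
  ultimately show ?thesis
    unfolding mult_mob_cover u one_mob_cover by simp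
qed

lemma group_mob_cover: "group mob_cover"
proof (rule groupI)
  fix x y z
  assume x: "x \<in> carrier mob_cover" and y: "y \<in> carrier mob_cover" and z: "z \<in> carrier mob_cover"
  note cl = x y z mob_mult_closed norm_act_lt_1
  show "x \<otimes>\<^bsub>mob_cover\<^esub> y \<otimes>\<^bsub>mob_cover\<^esub> z = x \<otimes>\<^bsub>mob_cover\<^esub> (y \<otimes>\<^bsub>mob_cover\<^esub> z)"
    by (rule mob_eqI) (simp_all add: cl act_mult log_deriv_mult)
next
  fix x assume x: "x \<in> carrier mob_cover"
  have one: "\<one>\<^bsub>mob_cover\<^esub> \<in> carrier mob_cover" by (simp add: one_mob_cover carrier_mob_cover)
  show "\<one>\<^bsub>mob_cover\<^esub> \<otimes>\<^bsub>mob_cover\<^esub> x = x"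
    by (rule mob_eqI)
      (simp_all add: x one mob_mult_closed norm_act_lt_1 act_mult log_deriv_mult act_one log_deriv_one)
  show "\<exists>y\<in>carrier mob_cover. y \<otimes>\<^bsub>mob_cover\<^esub> x = \<one>\<^bsub>mob_cover\<^esub>"
    using x mob_inv_mult mob_inv_closed by (metis surj_pair)
qed (erule (1) mob_mult_closed, simp add: one_mob_cover carrier_mob_cover)

lemma inv_mob_cover:
  assumes "(t, w) \<in> carrier mob_cover"
  shows "inv\<^bsub>mob_cover\<^esub> (t, w) = (- t, - cis t * w)"
  using assms by (intro group.inv_equality group_mob_cover mob_inv_mult mob_inv_closed)

lemma simply_connected_mob_cover: "simply_connected (carrier mob_cover)"
  unfolding carrier_mob_cover
  by (intro convex_imp_simply_connected convex_Times convex_UNIV convex_ball)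

lemma continuous_on_mob_mult:
  "continuous_on (carrier mob_cover \<times> carrier mob_cover) (\<lambda>(g, h). g \<otimes>\<^bsub>mob_cover\<^esub> h)"
proof -
  let ?u = "\<lambda>x::mob \<times> mob. 1 + cnj (snd (fst x)) * cis (fst (snd x)) * snd (snd x)"
  have R: "Re (?u x) > 0" if "x \<in> carrier mob_cover \<times> carrier mob_cover" for x
  proof -
    have "cmod (snd (fst x)) < 1" "cmod (snd (snd x)) < 1"
      using that by (auto simp: carrier_mob_cover)
    then have "cmod (cnj (snd (fst x)) * cis (fst (snd x)) * snd (snd x)) < 1"
      by (simp add: norm_mult) (metis cmod_mult_lt_1 norm_mult)
    then show ?thesis by (rule Re_one_plus_pos)
  qed
  have nz: "?u x \<noteq> 0" "?u x \<notin> \<real>\<^sub>\<le>\<^sub>0" if "x \<in> carrier mob_cover \<times> carrier mob_cover" for x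
    using R[OF that] by (force simp: complex_nonpos_Reals_iff)+
  have cu: "continuous_on (carrier mob_cover \<times> carrier mob_cover) ?u"
    unfolding cis_conv_exp by (intro continuous_intros)
  have "continuous_on (carrier mob_cover \<times> carrier mob_cover) (\<lambda>x. Im (Ln (?u x)))"
    using cu nz(2) by (intro continuous_intros) auto
  then have cA: "continuous_on (carrier mob_cover \<times> carrier mob_cover) (\<lambda>x. Arg (?u x))"
    by (rule continuous_on_eq) (metis Arg_eq_Im_Ln nz(1))
  have cs: "continuous_on (carrier mob_cover \<times> carrier mob_cover) (\<lambda>x. cis (- fst (snd x)))"
    unfolding cis_conv_exp by (intro continuous_intros)
  have "continuous_on (carrier mob_cover \<times> carrier mob_cover)
     (\<lambda>x. (fst (fst x) + fst (snd x) - 2 * Arg (?u x),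
           (snd (snd x) + cis (- fst (snd x)) * snd (fst x)) / cnj (?u x)))"
    by (intro continuous_on_Pair continuous_on_diff continuous_on_add continuous_on_mult
          continuous_on_divide continuous_on_cnj continuous_on_fst continuous_on_snd
          continuous_on_id continuous_on_const cA cu cs ballI)
      (use nz(1) in \<open>simp only: complex_cnj_zero_iff not_False_eq_True\<close>)
  then show ?thesis
    by (rule continuous_on_eq) (auto simp: mult_mob_cover split: prod.split)
qed

lemma continuous_on_mob_inv:
  "continuous_on (carrier mob_cover) (\<lambda>g. inv\<^bsub>mob_cover\<^esub> g)"
proof -
  have "continuous_on (carrier mob_cover) (\<lambda>g. (- fst g, - cis (fst g) * snd g))"
    unfolding cis_conv_exp by (intro continuous_intros)
  then show ?thesis
    by (rule continuous_on_eq) (metis inv_mob_cover prod.collapse)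
qed

lemma act_automorphism:
  assumes "g \<in> carrier mob_cover"
  shows "act g holomorphic_on disc" "bij_betw (act g) disc disc"
proof -
  interpret group mob_cover by (rule group_mob_cover)
  show "act g holomorphic_on disc"
    using assms Moebius_function_holomorphic
    by (auto simp: act_def[abs_def] carrier_mob_cover)
  show "bij_betw (act g) disc disc"
    by (rule bij_betwI[where g = "act (inv\<^bsub>mob_cover\<^esub> g)"])
      (use assms in \<open>auto simp: norm_act_lt_1 act_mult[symmetric] act_one\<close>)
qed

lemma automorphism_is_act:
  assumes f: "f holomorphic_on disc" "bij_betw f disc disc"
  shows "\<exists>g\<in>carrier mob_cover. \<forall>z\<in>disc. f z = act g z"
proof -
  define k where "k = the_inv_into disc f"
  have k: "k ` disc \<subseteq> disc" "\<And>z. z \<in> disc \<Longrightarrow> f (k z) = z" "\<And>z. z \<in> disc \<Longrightarrow> k (f z) = z"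
    unfolding k_def using f(2) bij_betw_the_inv_into[OF f(2)]
    by (auto simp: bij_betw_def f_the_inv_into_f the_inv_into_f_f simp del: mem_ball_0)
  have fd: "f ` disc = disc" "inj_on f disc" using f(2) by (auto simp: bij_betw_def)
  have holk: "k holomorphic_on disc"
  proof -
    obtain k' where k': "k' holomorphic_on (f ` disc)" "\<And>z. z \<in> disc \<Longrightarrow> k' (f z) = z"
      using holomorphic_has_inverse[OF f(1) open_ball fd(2)] by metis
    have "k' z = k z" if "z \<in> disc" for z
      using k' k that fd(1) by (metis imageE)
    then show ?thesis using k'(1) fd(1) by (metis holomorphic_cong)
  qed
  define w where "w = k 0"
  have w: "cmod w < 1" using k(1) unfolding w_def by force
  define M where "M = Moebius_function 0 w"
  define M' where "M' = Moebius_function 0 (- w)"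
  have MM: "M' ` disc \<subseteq> disc" "M ` disc \<subseteq> disc" "M holomorphic_on disc" "M' holomorphic_on disc"
    using w by (auto simp: M_def M'_def intro!: Moebius_function_norm_lt_1 Moebius_function_holomorphic)
  have inv1: "M (M' z) = z" "M' (M z) = z" if "z \<in> disc" for z
    using Moebius_function_compose[of w "- w" z] Moebius_function_compose[of "- w" w z] w that
    by (auto simp: M_def M'_def)
  define F where "F = f \<circ> M'"
  define K where "K = M \<circ> k"
  have F: "F holomorphic_on disc" "F 0 = 0" "\<And>z. cmod z < 1 \<Longrightarrow> cmod (F z) < 1"
  proof -
    show "F holomorphic_on disc"
      unfolding F_def by (intro holomorphic_on_compose_gen[OF MM(4) f(1) MM(1)])
    have "M' 0 = w" by (simp add: M'_def Moebius_function_of_zero)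
    then show "F 0 = 0" unfolding F_def o_def w_def using k(2)[of 0] by simp
    show "cmod (F z) < 1" if "cmod z < 1" for z
    proof -
      have "M' z \<in> disc" using MM(1) that by (metis image_subset_iff mem_ball_0)
      then have "f (M' z) \<in> disc" using fd(1) by blast
      then show ?thesis by (simp add: F_def)
    qed
  qed
  have K: "K holomorphic_on disc" "K 0 = 0" "\<And>z. cmod z < 1 \<Longrightarrow> cmod (K z) < 1"
  proof -
    show "K holomorphic_on disc"
      unfolding K_def by (intro holomorphic_on_compose_gen[OF holk MM(3) k(1)])
    show "K 0 = 0" by (simp add: K_def w_def[symmetric] M_def Moebius_function_eq_zero)
    show "cmod (K z) < 1" if "cmod z < 1" for z
      using MM(2) k(1) that unfolding K_def by force
  qed
  have KF: "K (F z) = z" if "z \<in> disc" for z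
  proof -
    have "M' z \<in> disc" using MM(1) that by blast
    then show ?thesis using k(3) inv1(1) that by (simp add: K_def F_def del: mem_ball_0)
  qed
  have half: "cmod (1/2) < 1" by (simp add: norm_divide)
  have "cmod (F (1/2)) \<le> cmod (1/2)" by (rule Schwarz_Lemma(1)[OF F(1,2,3) half])
  moreover have "cmod (K (F (1/2))) \<le> cmod (F (1/2))"
    by (rule Schwarz_Lemma(1)[OF K(1,2,3) F(3)[OF half]])
  ultimately have "cmod (F (1/2)) = cmod (1/2)" using KF[of "1/2"] half by simp
  then have "\<exists>z. cmod z < 1 \<and> z \<noteq> 0 \<and> cmod (F z) = cmod z"
    using half by (intro exI[of _ "1/2"]) auto
  then obtain \<alpha> where \<alpha>: "\<And>z. cmod z < 1 \<Longrightarrow> F z = \<alpha> * z" "cmod \<alpha> = 1"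
    using Schwarz_Lemma(3)[OF F(1,2,3) half] by blast
  define t where "t = Arg \<alpha>"
  have t: "\<alpha> = cis t"
    using \<alpha>(2) unfolding t_def by (metis Arg_eq cis_conv_exp mult_1 norm_zero of_real_1 zero_neq_one)
  have "f z = act (t, w) z" if "z \<in> disc" for z
  proof -
    have "M z \<in> disc" using MM(2) that by blast
    then have "f z = \<alpha> * M z"
      using \<alpha>(1)[of "M z"] inv1(2)[OF that] by (simp add: F_def)
    then show ?thesis by (simp add: t act_def M_def Moebius_function_def cis_conv_exp)
  qed
  then show ?thesis using w by (intro bexI[of _ "(t, w)"]) (auto simp: carrier_mob_cover)
qed

lemma act_trivial_iff:
  assumes "g \<in> carrier mob_cover"
  shows "(\<forall>z\<in>disc. act g z = z) \<longleftrightarrow> (\<exists>k::int. g = (2 * pi * k, 0))"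
proof
  obtain t w where g: "g = (t, w)" by (metis surj_pair)
  assume L: "\<forall>z\<in>disc. act g z = z"
  have w: "w = 0"
    using bspec[OF L, of w] assms by (simp add: g act_def Moebius_function_eq_zero carrier_mob_cover)
  have "exp (\<i> * t) = 1"
    using bspec[OF L, of "1/2"] by (simp add: g w act_def Moebius_function_def norm_divide)
  then have "\<exists>k::int. t = 2 * pi * k"
    by (auto simp: exp_eq_1 mult_ac)
  then show "\<exists>k::int. g = (2 * pi * k, 0)" by (auto simp: g w)
next
  assume "\<exists>k::int. g = (2 * pi * k, 0)"
  then obtain k :: int where k: "g = (2 * pi * k, 0)" by blast
  have "exp (\<i> * complex_of_real (2 * pi * k)) = 1" by (auto simp: exp_eq_1)
  then show "\<forall>z\<in>disc. act g z = z" by (simp add: k act_def Moebius_function_def)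
qed

lemma exp_log_deriv:
  assumes "g \<in> carrier mob_cover" "z \<in> disc"
  shows "exp (log_deriv g z) = deriv (act g) z"
proof -
  obtain t w where g: "g = (t, w)" by (metis surj_pair)
  have wz: "cmod w < 1" "cmod z < 1" using assms g by (auto simp: carrier_mob_cover)
  then have nz: "1 - cnj w * z \<noteq> 0" and p: "0 < 1 - (cmod w)\<^sup>2"
    using mob_denominators(3)[of w w z] by (auto simp: abs_square_less_1)
  have "(act g has_field_derivative
      (exp (\<i> * t) * (1 - cnj w * z) + exp (\<i> * t) * (z - w) * cnj w) / (1 - cnj w * z)\<^sup>2) (at z)"
    unfolding act_def[abs_def] Moebius_function_def g
    by (rule derivative_eq_intros refl | use nz in \<open>simp add: power2_eq_square\<close>)+
  then have "deriv (act g) z =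
     (exp (\<i> * t) * (1 - cnj w * z) + exp (\<i> * t) * (z - w) * cnj w) / (1 - cnj w * z)\<^sup>2"
    by (rule DERIV_imp_deriv)
  also have "\<dots> = exp (\<i> * t) * (1 - (cmod w)\<^sup>2) / (1 - cnj w * z)\<^sup>2"
    by (simp only: of_real_diff complex_norm_square of_real_1) (simp add: algebra_simps)
  also have "\<dots> = exp (\<i> * t) * exp (complex_of_real (ln (1 - (cmod w)\<^sup>2)))
      / (exp (Ln (1 - cnj w * z)))\<^sup>2"
    using nz p by (simp add: exp_of_real)
  also have "\<dots> = exp (log_deriv g z)"
    by (simp add: g log_deriv_def exp_diff exp_add exp_double[symmetric] del: exp_Ln)
  finally show ?thesis by simp
qed

lemma continuous_on_log_deriv:
  "continuous_on (carrier mob_cover \<times> disc) (\<lambda>(g, z). log_deriv g z)"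
proof -
  have "Re (1 - cnj (snd (fst x)) * snd x) > 0" if "x \<in> carrier mob_cover \<times> disc" for x
    using that by (intro Re_one_minus_pos cmod_mult_lt_1) (auto simp: carrier_mob_cover)
  then have R: "1 - cnj (snd (fst x)) * snd x \<notin> \<real>\<^sub>\<le>\<^sub>0" if "x \<in> carrier mob_cover \<times> disc" for x
    using that by (force simp: complex_nonpos_Reals_iff)
  have P: "1 - (cmod (snd (fst x)))\<^sup>2 \<noteq> 0" if "x \<in> carrier mob_cover \<times> disc" for x
    using that by (auto simp: carrier_mob_cover abs_square_eq_1)
  show ?thesis
    unfolding case_prod_unfold log_deriv_def
    by (intro continuous_intros ballI) (use R P in auto)
qed

text \<open>
  The matrix with rows \<open>(cnj d, cnj c)\<close> and \<open>(c, d)\<close> is in \<open>SU(1,1)\<close>, depends continuously on the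
  group element, is the identity at \<open>g = e\<close>, and acts as \<open>g\<close>.
\<close>

lemma act_SU11:
  assumes "g \<in> carrier mob_cover" "z \<in> disc"
  shows "act g z = (cnj (d_of g) * z + cnj (c_of g)) / (c_of g * z + d_of g)"
    and "d_of g * cnj (d_of g) - c_of g * cnj (c_of g) = 1"
proof -
  obtain t w where g: "g = (t, w)" by (metis surj_pair)
  have wz: "cmod w < 1" "cmod z < 1" using assms g by (auto simp: carrier_mob_cover)
  then have nz: "1 - cnj w * z \<noteq> 0" and p: "0 < 1 - (cmod w)\<^sup>2"
    using mob_denominators(3)[of w w z] by (auto simp: abs_square_less_1)
  define r where "r = complex_of_real (sqrt (1 - (cmod w)\<^sup>2))"
  have r: "r \<noteq> 0" "r * r = 1 - w * cnj w" "cnj r = r"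
  proof -
    show "r \<noteq> 0" "cnj r = r" using p by (simp_all add: r_def)
    have "r * r = complex_of_real (1 - (cmod w)\<^sup>2)"
      using p unfolding r_def by (metis less_imp_le of_real_mult real_sqrt_mult_self abs_of_pos)
    then show "r * r = 1 - w * cnj w" by (simp only: of_real_diff complex_norm_square of_real_1)
  qed
  have cd: "c_of g = - cnj w * cis (- t / 2) / r" "d_of g = cis (- t / 2) / r"
    by (simp_all add: c_of_def d_of_def g r_def)
  have cj: "cnj (c_of g) = - w * cis (t / 2) / r" "cnj (d_of g) = cis (t / 2) / r"
    unfolding cd using r(3) by (simp_all add: cis_cnj)
  have one: "cis (- t / 2) * cis (t / 2) = 1" by (simp add: cis_mult)
  have cancel: "(a / r * x) / (b / r * y) = a / b * x / y" for a b x y :: complex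
    using r(1) by simp
  have "(cnj (d_of g) * z + cnj (c_of g)) / (c_of g * z + d_of g)
      = (cis (t / 2) / r * (z - w)) / (cis (- t / 2) / r * (1 - cnj w * z))"
  proof -
    have "cnj (d_of g) * z + cnj (c_of g) = cis (t / 2) / r * (z - w)"
      unfolding cj by (simp add: algebra_simps diff_divide_distrib)
    moreover have "c_of g * z + d_of g = cis (- t / 2) / r * (1 - cnj w * z)"
      unfolding cd by (simp add: algebra_simps diff_divide_distrib)
    ultimately show ?thesis by (simp only:)
  qed
  also have "\<dots> = (cis (t / 2) / cis (- t / 2)) * (z - w) / (1 - cnj w * z)"
    by (rule cancel)
  also have "\<dots> = act g z"
  proof -
    have "cis (t / 2) / cis (- t / 2) = cis t" by (simp add: cis_divide)
    then show ?thesis by (simp add: g act_def Moebius_function_def cis_conv_exp)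
  qed
  finally show "act g z = (cnj (d_of g) * z + cnj (c_of g)) / (c_of g * z + d_of g)" by simp
  have "d_of g * cnj (d_of g) - c_of g * cnj (c_of g)
      = (cis (- t / 2) * cis (t / 2)) * (1 - w * cnj w) / (r * r)"
    unfolding cj unfolding cd using r(1) by (simp add: field_simps)
  then show "d_of g * cnj (d_of g) - c_of g * cnj (c_of g) = 1"
    unfolding one r(2)[symmetric] using r(1) by simp
qed

lemma c_of_one: "c_of \<one>\<^bsub>mob_cover\<^esub> = 0" and d_of_one: "d_of \<one>\<^bsub>mob_cover\<^esub> = 1"
  by (simp_all add: c_of_def d_of_def one_mob_cover)

lemma continuous_on_c_of: "continuous_on (carrier mob_cover) c_of"
  and continuous_on_d_of: "continuous_on (carrier mob_cover) d_of"
proof -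
  have P: "1 - (cmod (snd g))\<^sup>2 \<noteq> 0" if "g \<in> carrier mob_cover" for g :: mob
    using that by (auto simp: carrier_mob_cover abs_square_eq_1)
  show "continuous_on (carrier mob_cover) c_of" "continuous_on (carrier mob_cover) d_of"
    unfolding c_of_def[abs_def] d_of_def[abs_def] cis_conv_exp
    by (intro continuous_intros ballI; use P in \<open>simp\<close>)+
qed

section \<open>Matrices, sections, Hilbert spaces of functions\<close>

definition madj :: "complex^'n^'n \<Rightarrow> complex^'n^'n" where
  "madj A = (\<chi> i k. cnj (A $ k $ i))"

definition cdot :: "complex^'n \<Rightarrow> complex^'n \<Rightarrow> complex" where
  "cdot x y = (\<Sum>i\<in>UNIV. x $ i * cnj (y $ i))"

definition pos_def :: "complex^'n^'n \<Rightarrow> bool" where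
  "pos_def A \<longleftrightarrow> madj A = A \<and> (\<forall>x. x \<noteq> 0 \<longrightarrow> 0 < Re (cdot (A *v x) x))"

text \<open>
  Functions on the disc are represented by total functions that vanish off the disc, so that
  equality of functions on the disc is equality.
\<close>

definition hol_functions :: "(complex \<Rightarrow> complex) set" where
  "hol_functions = {f. f holomorphic_on disc \<and> (\<forall>z. z \<notin> disc \<longrightarrow> f z = 0)}"

definition hol_sections :: "(complex \<Rightarrow> complex^'n) set" where
  "hol_sections = {f. \<forall>i. (\<lambda>z. f z $ i) \<in> hol_functions}"

text \<open>
  A complex Hilbert space given by its carrier \<open>H\<close>, its scalar multiplication \<open>scl\<close> and its inner
  product \<open>ip\<close>, linear in the first argument; only the values of \<open>ip\<close> on \<open>H \<times> H\<close> matter.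
\<close>

definition hilbert_space ::
  "(complex \<Rightarrow> 's \<Rightarrow> 's) \<Rightarrow> 's::ab_group_add set \<Rightarrow> ('s \<Rightarrow> 's \<Rightarrow> complex) \<Rightarrow> bool"
where
  "hilbert_space scl H ip \<longleftrightarrow>
     0 \<in> H \<and> (\<forall>f\<in>H. \<forall>g\<in>H. f + g \<in> H) \<and> (\<forall>c. \<forall>f\<in>H. scl c f \<in> H) \<and>
     (\<forall>f\<in>H. \<forall>g\<in>H. \<forall>h\<in>H. ip (f + g) h = ip f h + ip g h) \<and>
     (\<forall>c. \<forall>f\<in>H. \<forall>g\<in>H. ip (scl c f) g = c * ip f g) \<and>
     (\<forall>f\<in>H. \<forall>g\<in>H. ip g f = cnj (ip f g)) \<and>
     (\<forall>f\<in>H. f \<noteq> 0 \<longrightarrow> 0 < Re (ip f f)) \<and>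
     (\<forall>X. (\<forall>n. X n \<in> H) \<and>
          (\<forall>e>0. \<exists>M. \<forall>m\<ge>M. \<forall>n\<ge>M. Re (ip (X m - X n) (X m - X n)) < e) \<longrightarrow>
          (\<exists>f\<in>H. (\<lambda>n. Re (ip (X n - f) (X n - f))) \<longlonglongrightarrow> 0))"

definition hilbert_sections ::
  "(complex \<Rightarrow> complex^'n) set \<Rightarrow> ((complex \<Rightarrow> complex^'n) \<Rightarrow> (complex \<Rightarrow> complex^'n) \<Rightarrow> complex) \<Rightarrow> bool"
where
  "hilbert_sections H ip \<longleftrightarrow> hilbert_space (\<lambda>c f z. c *s f z) H ip \<and> H \<subseteq> hol_sections"

definition reproducing_kernel ::
  "(complex \<Rightarrow> complex^'n) set \<Rightarrow> ((complex \<Rightarrow> complex^'n) \<Rightarrow> (complex \<Rightarrow> complex^'n) \<Rightarrow> complex) \<Rightarrow>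
   (complex \<Rightarrow> complex \<Rightarrow> complex^'n^'n) \<Rightarrow> bool"
where
  "reproducing_kernel H ip K \<longleftrightarrow> (\<forall>w\<in>disc. \<forall>x.
     (\<lambda>z. if z \<in> disc then K z w *v x else 0) \<in> H \<and>
     (\<forall>f\<in>H. ip f (\<lambda>z. if z \<in> disc then K z w *v x else 0) = cdot (f w) x))"

section \<open>Homogeneous holomorphic vector bundles\<close>

text \<open>
  A holomorphic vector bundle over the disc is trivial, so a homogeneous one of rank
  \<open>CARD('n)\<close> is the trivial bundle with a multiplier \<open>J\<close>, the group acting on sections by
  \<open>section_action\<close>.  An isomorphism is a holomorphic map \<open>F\<close> into the invertible matrices, taking
  the section \<open>f\<close> to \<open>z \<mapsto> F z *v f z\<close>.
\<close>

definition section_action ::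
  "(mob \<Rightarrow> complex \<Rightarrow> complex^'n^'n) \<Rightarrow> mob \<Rightarrow> (complex \<Rightarrow> complex^'n) \<Rightarrow> complex \<Rightarrow> complex^'n"
where
  "section_action J g f = (\<lambda>z. if z \<in> disc
     then J (inv\<^bsub>mob_cover\<^esub> g) z *v f (act (inv\<^bsub>mob_cover\<^esub> g) z) else 0)"

definition homogeneous_bundle :: "(mob \<Rightarrow> complex \<Rightarrow> complex^'n^'n) \<Rightarrow> bool" where
  "homogeneous_bundle J \<longleftrightarrow>
     continuous_on (carrier mob_cover \<times> disc) (\<lambda>(g, z). J g z) \<and>
     (\<forall>g\<in>carrier mob_cover. \<forall>i k. (\<lambda>z. J g z $ i $ k) holomorphic_on disc) \<and>
     (\<forall>z\<in>disc. J \<one>\<^bsub>mob_cover\<^esub> z = mat 1) \<and>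
     (\<forall>g\<in>carrier mob_cover. \<forall>h\<in>carrier mob_cover. \<forall>z\<in>disc.
        J (g \<otimes>\<^bsub>mob_cover\<^esub> h) z = J h z ** J g (act h z))"

definition bundle_iso ::
  "(mob \<Rightarrow> complex \<Rightarrow> complex^'n^'n) \<Rightarrow> (mob \<Rightarrow> complex \<Rightarrow> complex^'n^'n) \<Rightarrow>
   (complex \<Rightarrow> complex^'n^'n) \<Rightarrow> bool"
where
  "bundle_iso J J' F \<longleftrightarrow>
     (\<forall>i k. (\<lambda>z. F z $ i $ k) holomorphic_on disc) \<and> (\<forall>z\<in>disc. invertible (F z)) \<and>
     (\<forall>g\<in>carrier mob_cover. \<forall>z\<in>disc. F z ** J g z = J' g z ** F (act g z))"

definition invariant_hermitian ::
  "(mob \<Rightarrow> complex \<Rightarrow> complex^'n^'n) \<Rightarrow> (complex \<Rightarrow> complex^'n^'n) \<Rightarrow> bool"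
where
  "invariant_hermitian J h \<longleftrightarrow> (\<forall>z\<in>disc. pos_def (h z)) \<and>
     (\<forall>g\<in>carrier mob_cover. \<forall>z\<in>disc.
        J g z ** matrix_inv (h (act g z)) ** madj (J g z) = matrix_inv (h z))"

section \<open>Elementary bundles\<close>

text \<open>
  The decomposition \<open>\<complex>^n = \<Oplus>j\<le>m. \<complex>^(d j)\<close> is given by the function \<open>b\<close> taking a coordinate to the
  number of its block, so \<open>d j = card (b -` {j})\<close>, which is at least 1.
\<close>

definition grading :: "nat \<Rightarrow> ('n \<Rightarrow> nat) \<Rightarrow> bool" where
  "grading m b \<longleftrightarrow> range b = {..m}"

definition subdiagonal :: "('n \<Rightarrow> nat) \<Rightarrow> complex^'n^'n \<Rightarrow> bool" where
  "subdiagonal b Y \<longleftrightarrow> (\<forall>i k. Y $ i $ k \<noteq> 0 \<longrightarrow> b i = b k + 1)"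

definition block_diagonal :: "('n \<Rightarrow> nat) \<Rightarrow> complex^'n^'n \<Rightarrow> bool" where
  "block_diagonal b A \<longleftrightarrow> (\<forall>i k. A $ i $ k \<noteq> 0 \<longrightarrow> b i = b k)"

text \<open>
  \<open>block b p q Y\<close> is the matrix \<open>Y\<close> with all blocks other than the one in block row \<open>p\<close> and block
  column \<open>q\<close> replaced by 0.  In block row \<open>l + k\<close> and block column \<open>l\<close>, \<open>block_prod b Y l k\<close>
  is the product of the subdiagonal blocks \<open>Y\<^sub>j\<close>, \<open>j = l + k, \<dots>, l + 1\<close>.
\<close>

definition block :: "('n \<Rightarrow> nat) \<Rightarrow> nat \<Rightarrow> nat \<Rightarrow> complex^'n^'n \<Rightarrow> complex^'n^'n" where
  "block b p q Y = (\<chi> i k. if b i = p \<and> b k = q then Y $ i $ k else 0)"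

primrec block_prod :: "('n \<Rightarrow> nat) \<Rightarrow> complex^'n^'n \<Rightarrow> nat \<Rightarrow> nat \<Rightarrow> complex^'n^'n" where
  "block_prod b Y l 0 = mat 1"
| "block_prod b Y l (Suc k) = block b (l + k + 1) (l + k) Y ** block_prod b Y l k"

definition elementary_mult ::
  "('n \<Rightarrow> nat) \<Rightarrow> real \<Rightarrow> complex^'n^'n \<Rightarrow> mob \<Rightarrow> complex \<Rightarrow> complex^'n^'n"
where
  "elementary_mult b \<eta> Y g z = (\<chi> i k. if b i \<ge> b k
     then 1 / fact (b i - b k) * (- c_of g) ^ (b i - b k)
          * deriv_pow g (\<eta> + real (b i + b k) / 2) z * block_prod b Y (b k) (b i - b k) $ i $ k
     else 0)"

definition elementary_bundle :: "(mob \<Rightarrow> complex \<Rightarrow> complex^'n^'n) \<Rightarrow> bool" where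
  "elementary_bundle J \<longleftrightarrow> homogeneous_bundle J \<and> (\<exists>h. invariant_hermitian J h) \<and>
     (\<exists>m b \<eta> Y F. grading m b \<and> subdiagonal b Y \<and> bundle_iso J (elementary_mult b \<eta> Y) F)"

text \<open>
  \<open>h\<close> is the Hermitian structure of the Hermitian bundle denoted by the pair of \<open>(b, \<eta>, Y)\<close>
  and \<open>H\<close>.
\<close>

definition elementary_hermitian ::
  "('n \<Rightarrow> nat) \<Rightarrow> real \<Rightarrow> complex^'n^'n \<Rightarrow> complex^'n^'n \<Rightarrow> (complex \<Rightarrow> complex^'n^'n) \<Rightarrow> bool"
where
  "elementary_hermitian b \<eta> Y H h \<longleftrightarrow>
     block_diagonal b H \<and> invariant_hermitian (elementary_mult b \<eta> Y) h \<and> h 0 = H"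

definition unitary_action ::
  "(mob \<Rightarrow> complex \<Rightarrow> complex^'n^'n) \<Rightarrow> (complex \<Rightarrow> complex^'n) set \<Rightarrow>
   ((complex \<Rightarrow> complex^'n) \<Rightarrow> (complex \<Rightarrow> complex^'n) \<Rightarrow> complex) \<Rightarrow> bool"
where
  "unitary_action J H ip \<longleftrightarrow> (\<forall>g\<in>carrier mob_cover.
     section_action J g ` H = H \<and>
     (\<forall>f1\<in>H. \<forall>f2\<in>H. ip (section_action J g f1) (section_action J g f2) = ip f1 f2))"

text \<open>
  That \<open>K\<close> induces a Hermitian structure means that \<open>K 0 0\<close>, hence every \<open>K z z\<close>, is invertible.
  In addition the Hilbert space is required to be invariant under multiplication by the coordinate
  function, as are the spaces on which Cowen-Douglas operators are realized.  This is not
  automatic, and without it there are bundles that do not come from the construction below: with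
  one block, \<open>\<eta> = 0\<close> and \<open>n = 1\<close>, the constant functions, with kernel 1; and with blocks of
  sizes 1 and 1, \<open>\<eta> > 0\<close> and \<open>Y\<^sub>1 = 1\<close>, the space of all pairs \<open>(f, f' / (2 * \<eta>))\<close>,
  \<open>f\<close> in the weighted Bergman space of parameter \<open>\<eta>\<close>, on which the group acts irreducibly.
\<close>

definition bundle_kernel ::
  "(mob \<Rightarrow> complex \<Rightarrow> complex^'n^'n) \<Rightarrow> (complex \<Rightarrow> complex^'n) set \<Rightarrow>
   ((complex \<Rightarrow> complex^'n) \<Rightarrow> (complex \<Rightarrow> complex^'n) \<Rightarrow> complex) \<Rightarrow>
   (complex \<Rightarrow> complex \<Rightarrow> complex^'n^'n) \<Rightarrow> bool"
where
  "bundle_kernel J H ip K \<longleftrightarrow> hilbert_sections H ip \<and> unitary_action J H ip \<and>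
     reproducing_kernel H ip K \<and> invertible (K 0 0)"

definition shift_invariant :: "(complex \<Rightarrow> complex^'n) set \<Rightarrow> bool" where
  "shift_invariant H \<longleftrightarrow> (\<forall>f\<in>H. (\<lambda>z. z *s f z) \<in> H)"

section \<open>The construction\<close>

definition is_bergman ::
  "real \<Rightarrow> (complex \<Rightarrow> complex) set \<Rightarrow> ((complex \<Rightarrow> complex) \<Rightarrow> (complex \<Rightarrow> complex) \<Rightarrow> complex) \<Rightarrow> bool"
where
  "is_bergman r A ip \<longleftrightarrow> hilbert_space (\<lambda>c f z. c * f z) A ip \<and> A \<subseteq> hol_functions \<and>
     (\<forall>w\<in>disc. let k = (\<lambda>z. if z \<in> disc then (1 - z * cnj w) powr of_real (- 2 * r) else 0)
        in k \<in> A \<and> (\<forall>f\<in>A. ip f k = f w))"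

text \<open>
  Carrier and inner product are unique: a space is determined by its reproducing kernel.
\<close>

definition bergman ::
  "real \<Rightarrow> (complex \<Rightarrow> complex) set \<times> ((complex \<Rightarrow> complex) \<Rightarrow> (complex \<Rightarrow> complex) \<Rightarrow> complex)"
where
  "bergman r = (SOME p. is_bergman r (fst p) (snd p))"

definition sum_bergman :: "('n \<Rightarrow> nat) \<Rightarrow> real \<Rightarrow> (complex \<Rightarrow> complex^'n) set" where
  "sum_bergman b \<eta> = {f. \<forall>i. (\<lambda>z. f z $ i) \<in> fst (bergman (\<eta> + real (b i)))}"

definition sum_bergman_ip ::
  "('n \<Rightarrow> nat) \<Rightarrow> real \<Rightarrow> (complex \<Rightarrow> complex^'n) \<Rightarrow> (complex \<Rightarrow> complex^'n) \<Rightarrow> complex"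
where
  "sum_bergman_ip b \<eta> f g =
     (\<Sum>i\<in>UNIV. snd (bergman (\<eta> + real (b i))) (\<lambda>z. f z $ i) (\<lambda>z. g z $ i))"

definition Gamma ::
  "('n \<Rightarrow> nat) \<Rightarrow> real \<Rightarrow> complex^'n^'n \<Rightarrow> (complex \<Rightarrow> complex^'n) \<Rightarrow> complex \<Rightarrow> complex^'n"
where
  "Gamma b \<eta> Y f = (\<lambda>z. if z \<in> disc then (\<chi> i. \<Sum>k | b k \<le> b i.
       1 / fact (b i - b k) * (1 / of_real (pochhammer (2 * \<eta> + 2 * real (b k)) (b i - b k)))
       * block_prod b Y (b k) (b i - b k) $ i $ k * (deriv ^^ (b i - b k)) (\<lambda>u. f u $ k) z)
     else 0)"

definition Gamma_N ::
  "('n \<Rightarrow> nat) \<Rightarrow> real \<Rightarrow> complex^'n^'n \<Rightarrow> complex^'n^'n \<Rightarrow> (complex \<Rightarrow> complex^'n) \<Rightarrow> complex \<Rightarrow> complex^'n"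
where
  "Gamma_N b \<eta> Y N f = Gamma b \<eta> Y (\<lambda>z. N *v f z)"

definition image_ip ::
  "('n \<Rightarrow> nat) \<Rightarrow> real \<Rightarrow> complex^'n^'n \<Rightarrow> complex^'n^'n \<Rightarrow>
   (complex \<Rightarrow> complex^'n) \<Rightarrow> (complex \<Rightarrow> complex^'n) \<Rightarrow> complex"
where
  "image_ip b \<eta> Y N f g = sum_bergman_ip b \<eta>
     (inv_into (sum_bergman b \<eta>) (Gamma_N b \<eta> Y N) f)
     (inv_into (sum_bergman b \<eta>) (Gamma_N b \<eta> Y N) g)"

text \<open>Only the values on \<open>disc \<times> disc\<close>, where the kernel is unique, matter.\<close>

definition kernel_N ::
  "('n \<Rightarrow> nat) \<Rightarrow> real \<Rightarrow> complex^'n^'n \<Rightarrow> complex^'n^'n \<Rightarrow> complex \<Rightarrow> complex \<Rightarrow> complex^'n^'n"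
where
  "kernel_N b \<eta> Y N = (SOME K.
     reproducing_kernel (Gamma_N b \<eta> Y N ` sum_bergman b \<eta>) (image_ip b \<eta> Y N) K)"

definition herm_N ::
  "('n \<Rightarrow> nat) \<Rightarrow> real \<Rightarrow> complex^'n^'n \<Rightarrow> complex^'n^'n \<Rightarrow> complex^'n^'n"
where
  "herm_N b \<eta> Y N = matrix_inv (kernel_N b \<eta> Y N 0 0)"

end

theory Submission
  imports Defs
begin

text \<open>
  Identify the bundle with the one given by \<open>elementary_mult b \<eta> Y\<close>.  The operator \<open>Gamma\<close> is a
  matrix of constant coefficient differential operators that is unitriangular with respect to the
  blocks, so it is invertible on all holomorphic sections, and it intertwines the diagonal
  multiplier with entries \<open>g'(z)^(\<eta> + j)\<close> and the elementary one.  Hence its inverse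
  carries the given Hilbert space to one that is invariant under the diagonal multiplier.  The
  kernel of that space is determined by its value \<open>B\<close> at the origin: it is block diagonal with
  blocks \<open>(1 - z * cnj w) powr (- 2 * (\<eta> + j)) * B\<^sub>j\<close>.  Invariance under multiplication by the
  coordinate gives sections with prescribed jets at the origin, which makes \<open>\<eta>\<close> positive and \<open>B\<close>
  positive definite.  A block diagonal \<open>N\<close> with \<open>N ** madj N = B\<close> then turns the sum of
  weighted Bergman spaces into this space.  The same space shows that the Bergman spaces exist.
\<close>

text \<open>\<open>Gamma\<close> is usable only once \<open>\<eta>\<close> is known to be positive,
  since its coefficients divide by Pochhammer symbols that could vanish otherwise. Positivity
  therefore has to be found in the given space itself; on the lowest block the elementary multiplier
  is scalar, so a scalar kernel can be computed there without \<open>Gamma\<close>. A differential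
  operator carries a reproducing kernel along only if evaluations of derivatives are bounded
  functionals; the Riesz theorem then yields a kernel for the image. The Cauchy estimates behind
  this need the kernel to be bounded on the diagonal over smaller discs. Joint continuity of the
  kernel is not at hand, so the bound is read off from the invariance formula at the group element
  \<open>(0, z)\<close>, which carries \<open>z\<close> to 0. \<open>bergman\<close> and
  \<open>kernel_N\<close> are choices, about which nothing is known before existence is proved. The
  final comparison does not identify two Hilbert spaces: the kernel of an image is a function of the
  source kernel and the map alone, and the source kernels agree.\<close>

no_notation fps_nth (infixl "$" 75)

section \<open>Hilbert spaces\<close>

lemma tendsto_zero_if_norm_power2:
  fixes X :: "'b \<Rightarrow> 'a::real_normed_vector"
  assumes "((\<lambda>n. (norm (X n))\<^sup>2) \<longlongrightarrow> 0) F"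
  shows "(X \<longlongrightarrow> 0) F"
  using tendsto_real_sqrt[OF assms] by (simp add: tendsto_norm_zero_iff)

text \<open>\<open>hilbert_space\<close> only relates \<open>scl\<close> to \<open>H\<close> and
  \<open>ip\<close>; the laws of scalar multiplication on the ambient type, such as
  \<open>- f = scl (- 1) f\<close>, come from \<open>vector_space\<close> and give closure under
  differences.\<close>

locale hilbert = vector_space scl for scl :: "complex \<Rightarrow> 's \<Rightarrow> 's::ab_group_add" +
  fixes H :: "'s set" and ip :: "'s \<Rightarrow> 's \<Rightarrow> complex"
  assumes hilbert_space: "hilbert_space scl H ip"
begin

lemmas hilbert_space_conjuncts = hilbert_space[unfolded hilbert_space_def]
lemmas zero_mem = hilbert_space_conjuncts[THEN conjunct1]
lemmas add_mem = hilbert_space_conjuncts[THEN conjunct2, THEN conjunct1, rule_format]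
lemmas scl_mem = hilbert_space_conjuncts[THEN conjunct2, THEN conjunct2, THEN conjunct1, rule_format]
lemmas ip_add_left = hilbert_space_conjuncts[THEN conjunct2, THEN conjunct2, THEN conjunct2, THEN conjunct1, rule_format]
lemmas ip_scl_left = hilbert_space_conjuncts[THEN conjunct2, THEN conjunct2, THEN conjunct2, THEN conjunct2, THEN conjunct1, rule_format]
lemmas ip_commute = hilbert_space_conjuncts[THEN conjunct2, THEN conjunct2, THEN conjunct2, THEN conjunct2, THEN conjunct2, THEN conjunct1, rule_format]
lemmas ip_pos = hilbert_space_conjuncts[THEN conjunct2, THEN conjunct2, THEN conjunct2, THEN conjunct2, THEN conjunct2, THEN conjunct2, THEN conjunct1, rule_format]

lemma complete:
  assumes "\<And>n. X n \<in> H"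
    and "\<And>e. e > 0 \<Longrightarrow> \<exists>M. \<forall>m\<ge>M. \<forall>n\<ge>M. Re (ip (X m - X n) (X m - X n)) < e"
  shows "\<exists>f\<in>H. (\<lambda>n. Re (ip (X n - f) (X n - f))) \<longlonglongrightarrow> 0"
  using assms by (intro hilbert_space_conjuncts[THEN conjunct2, THEN conjunct2, THEN conjunct2, THEN conjunct2, THEN conjunct2, THEN conjunct2, THEN conjunct2, THEN spec, THEN mp] conjI allI impI)

lemma uminus_eq_scl: "- f = scl (- 1) f"
  by simp

lemma uminus_mem: "f \<in> H \<Longrightarrow> - f \<in> H"
  unfolding uminus_eq_scl by (rule scl_mem)

lemma diff_mem: "f \<in> H \<Longrightarrow> g \<in> H \<Longrightarrow> f - g \<in> H"
  using add_mem[OF _ uminus_mem] by force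

lemma ip_uminus_left: "f \<in> H \<Longrightarrow> h \<in> H \<Longrightarrow> ip (- f) h = - ip f h"
  unfolding uminus_eq_scl by (subst ip_scl_left) auto

lemma ip_diff_left: "f \<in> H \<Longrightarrow> g \<in> H \<Longrightarrow> h \<in> H \<Longrightarrow> ip (f - g) h = ip f h - ip g h"
  using ip_add_left[OF _ uminus_mem] ip_uminus_left by force

lemma ip_add_right: "f \<in> H \<Longrightarrow> g \<in> H \<Longrightarrow> h \<in> H \<Longrightarrow> ip h (f + g) = ip h f + ip h g"
  by (metis add_mem complex_cnj_add ip_add_left ip_commute)

lemma ip_diff_right: "f \<in> H \<Longrightarrow> g \<in> H \<Longrightarrow> h \<in> H \<Longrightarrow> ip h (f - g) = ip h f - ip h g"
  by (metis complex_cnj_diff diff_mem ip_commute ip_diff_left)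

lemma ip_scl_right: "f \<in> H \<Longrightarrow> g \<in> H \<Longrightarrow> ip f (scl c g) = cnj c * ip f g"
  by (metis complex_cnj_mult ip_commute ip_scl_left scl_mem)

lemma ip_zero_left: "f \<in> H \<Longrightarrow> ip 0 f = 0"
  using ip_diff_left[of f f f] by simp

lemma ip_self_nonneg: "f \<in> H \<Longrightarrow> 0 \<le> Re (ip f f)"
  using ip_pos[of f] ip_zero_left[of f] by (cases "f = 0") auto

lemma ip_self_real: "f \<in> H \<Longrightarrow> ip f f = of_real (Re (ip f f))"
  using ip_commute[of f f] by (simp add: complex_eq_iff)

lemma ip_ext:
  assumes "e \<in> H" "e' \<in> H" "\<And>f. f \<in> H \<Longrightarrow> ip f e = ip f e'"
  shows "e = e'"
proof -
  have "ip (e - e') (e - e') = 0"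
    using assms diff_mem by (simp add: ip_diff_right)
  then show ?thesis using ip_pos[of "e - e'"] diff_mem assms by fastforce
qed

lemma Cauchy_Schwarz:
  assumes f: "f \<in> H" and g: "g \<in> H"
  shows "(cmod (ip f g))\<^sup>2 \<le> Re (ip f f) * Re (ip g g)"
proof (cases "g = 0")
  case True
  then show ?thesis using f ip_zero_left[of f] ip_zero_left[OF zero_mem] ip_commute[of f 0] zero_mem by simp
next
  case False
  define q where "q = Re (ip g g)"
  have q: "q > 0" "ip g g = of_real q" using ip_pos[OF g False] ip_self_real[OF g] by (auto simp: q_def)
  \<comment> \<open>\<open>scl c g\<close> is the orthogonal projection of \<open>f\<close> on the
    line of \<open>g\<close>; the inequality is nonnegativity of the squared norm of the
    remainder.\<close>
  define c where "c = ip f g / q"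
  have cg: "scl c g \<in> H" using g by (rule scl_mem)
  have "ip (f - scl c g) (f - scl c g)
      = ip f f - cnj c * ip f g - c * ip g f + c * cnj c * ip g g"
    using f g cg diff_mem
    by (simp add: ip_diff_left ip_diff_right ip_scl_left ip_scl_right algebra_simps)
  also have "\<dots> = ip f f - of_real ((cmod (ip f g))\<^sup>2 / q)"
    unfolding ip_commute[OF f g] q(2) c_def of_real_divide complex_norm_square
    using q(1) by (simp add: field_simps)
  finally have "Re (ip (f - scl c g) (f - scl c g)) = Re (ip f f) - (cmod (ip f g))\<^sup>2 / q"
    by simp
  then have "(cmod (ip f g))\<^sup>2 / q \<le> Re (ip f f)"
    using ip_self_nonneg[OF diff_mem[OF f cg]] by simp
  then show ?thesis using q(1) by (simp add: q_def field_simps)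
qed

section \<open>Bounded functionals and the Riesz representation\<close>

text \<open>Functionals are total functions, so linearity is demanded on \<open>H\<close> only.
  Bounding squares avoids a norm and its square root.\<close>

definition bounded_functional :: "('s \<Rightarrow> complex) \<Rightarrow> bool" where
  "bounded_functional \<phi> \<longleftrightarrow>
     (\<forall>f\<in>H. \<forall>g\<in>H. \<phi> (f + g) = \<phi> f + \<phi> g) \<and> (\<forall>c. \<forall>f\<in>H. \<phi> (scl c f) = c * \<phi> f) \<and>
     (\<exists>C\<ge>0. \<forall>f\<in>H. (cmod (\<phi> f))\<^sup>2 \<le> C * Re (ip f f))"

lemma bounded_functional_zero: "bounded_functional (\<lambda>f. 0)"
  unfolding bounded_functional_def by auto

lemma bounded_functional_cmult:
  assumes "bounded_functional \<phi>" shows "bounded_functional (\<lambda>f. a * \<phi> f)"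
proof -
  obtain C where C: "C \<ge> 0" "\<forall>f\<in>H. (cmod (\<phi> f))\<^sup>2 \<le> C * Re (ip f f)"
    using assms unfolding bounded_functional_def by blast
  then have "\<forall>f\<in>H. (cmod (a * \<phi> f))\<^sup>2 \<le> ((cmod a)\<^sup>2 * C) * Re (ip f f)"
    by (simp add: norm_mult power_mult_distrib mult.assoc mult_left_mono)
  then show ?thesis
    using assms C(1) unfolding bounded_functional_def
    by (auto simp: algebra_simps intro!: exI[of _ "(cmod a)\<^sup>2 * C"])
qed

lemma bounded_functional_add:
  assumes "bounded_functional \<phi>" "bounded_functional \<psi>"
  shows "bounded_functional (\<lambda>f. \<phi> f + \<psi> f)"
proof -
  obtain C where C: "C \<ge> 0" "\<forall>f\<in>H. (cmod (\<phi> f))\<^sup>2 \<le> C * Re (ip f f)"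
    using assms unfolding bounded_functional_def by blast
  obtain D where D: "D \<ge> 0" "\<forall>f\<in>H. (cmod (\<psi> f))\<^sup>2 \<le> D * Re (ip f f)"
    using assms unfolding bounded_functional_def by blast
  \<comment> \<open>The constant comes from (x + y)^2 <= 2 x^2 + 2 y^2.\<close>
  have "(cmod (\<phi> f + \<psi> f))\<^sup>2 \<le> (2 * C + 2 * D) * Re (ip f f)" if f: "f \<in> H" for f
  proof -
    have "(cmod (\<phi> f + \<psi> f))\<^sup>2 \<le> (cmod (\<phi> f) + cmod (\<psi> f))\<^sup>2"
      by (intro power_mono norm_triangle_ineq) auto
    also have "\<dots> \<le> 2 * (cmod (\<phi> f))\<^sup>2 + 2 * (cmod (\<psi> f))\<^sup>2"
      using sum_squares_bound[of "cmod (\<phi> f)" "cmod (\<psi> f)"] by (simp add: power2_sum)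
    also have "\<dots> \<le> 2 * (C * Re (ip f f)) + 2 * (D * Re (ip f f))"
      using C D f by (intro add_mono mult_left_mono) auto
    finally show ?thesis by (simp add: algebra_simps)
  qed
  moreover have "0 \<le> 2 * C + 2 * D" using C D by simp
  ultimately show ?thesis
    using assms unfolding bounded_functional_def by (auto simp: algebra_simps)
qed

lemma bounded_functional_sum:
  "(\<And>i. i \<in> I \<Longrightarrow> bounded_functional (\<phi> i)) \<Longrightarrow> bounded_functional (\<lambda>f. \<Sum>i\<in>I. \<phi> i f)"
  by (induction I rule: infinite_finite_induct)
    (simp_all add: bounded_functional_zero bounded_functional_add)

lemma ip_self_add_scl:
  assumes "f \<in> H" "h \<in> H"
  shows "Re (ip (f + scl c h) (f + scl c h))
    = Re (ip f f) + 2 * Re (c * ip h f) + (cmod c)\<^sup>2 * Re (ip h h)"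
proof -
  have "c * cnj c * ip h h = of_real ((cmod c)\<^sup>2) * ip h h"
    by (simp only: complex_norm_square)
  then have "Re (c * cnj c * ip h h) = (cmod c)\<^sup>2 * Re (ip h h)"
    by (simp only: Re_complex_of_real Im_complex_of_real times_complex.sel)
  moreover have "ip (f + scl c h) (f + scl c h)
      = ip f f + cnj (c * ip h f) + c * ip h f + c * cnj c * ip h h"
    using assms scl_mem add_mem ip_commute[of h f]
    by (simp add: ip_add_left ip_add_right ip_scl_left ip_scl_right algebra_simps)
  ultimately show ?thesis by simp
qed

text \<open>
  The representing vector minimizes \<open>Re (ip f f) - 2 * Re (\<phi> f)\<close>; by the parallelogram law a
  minimizing sequence is Cauchy.
\<close>

theorem Riesz:
  assumes "bounded_functional \<phi>"
  shows "\<exists>e\<in>H. \<forall>f\<in>H. \<phi> f = ip f e"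
proof -
  have add: "\<phi> (f + g) = \<phi> f + \<phi> g" if "f \<in> H" "g \<in> H" for f g
    using assms that unfolding bounded_functional_def by blast
  have scl: "\<phi> (scl c f) = c * \<phi> f" if "f \<in> H" for c f
    using assms that unfolding bounded_functional_def by blast
  obtain C where C: "C \<ge> 0" "\<And>f. f \<in> H \<Longrightarrow> (cmod (\<phi> f))\<^sup>2 \<le> C * Re (ip f f)"
    using assms unfolding bounded_functional_def by blast
  define \<Phi> where "\<Phi> f = Re (ip f f) - 2 * Re (\<phi> f)" for f
  \<comment> \<open>If q is the squared norm of \<open>f\<close>, boundedness gives Re (\<phi> f) <=
    sqrt (C q), and 2 sqrt (C q) <= C + q.\<close>
  have low: "\<Phi> f \<ge> - C" if f: "f \<in> H" for f
  proof -
    define q where "q = Re (ip f f)"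
    have q: "q \<ge> 0" using ip_self_nonneg[OF f] by (simp add: q_def)
    have "Re (\<phi> f) \<le> cmod (\<phi> f)" by (rule complex_Re_le_cmod)
    also have "\<dots> \<le> sqrt (C * q)" using C(2)[OF f] by (simp add: real_le_rsqrt q_def)
    also have "2 * (sqrt (C * q)) = 2 * (sqrt C * sqrt q)" by (simp add: real_sqrt_mult)
    then have "2 * sqrt (C * q) \<le> C + q"
      using sum_squares_bound[of "sqrt C" "sqrt q"] C(1) q by (simp add: mult.assoc)
    finally show ?thesis by (simp add: \<Phi>_def q_def)
  qed
  define m where "m = Inf (\<Phi> ` H)"
  have bdd: "bdd_below (\<Phi> ` H)" using low by (auto intro!: bdd_belowI)
  have m_le: "m \<le> \<Phi> f" if "f \<in> H" for f
    unfolding m_def using that bdd by (auto intro: cINF_lower)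
  have "\<exists>f\<in>H. \<Phi> f < m + 1 / Suc n" for n
  proof -
    have "Inf (\<Phi> ` H) < m + 1 / Suc n" by (simp add: m_def)
    then show ?thesis
      using cInf_less_iff[of "\<Phi> ` H"] zero_mem bdd by auto
  qed
  then obtain X where X: "\<And>n. X n \<in> H" "\<And>n. \<Phi> (X n) < m + 1 / Suc n" by metis
  \<comment> \<open>The midpoint \<open>h\<close> also satisfies \<open>\<Phi> h \<ge> m\<close>, so
    two vectors that nearly minimize \<open>\<Phi>\<close> are close to each other.\<close>
  have par: "Re (ip (f - g) (f - g)) \<le> 2 * \<Phi> f + 2 * \<Phi> g - 4 * m" if fg: "f \<in> H" "g \<in> H" for f g
  proof -
    define h where "h = scl (1/2) (f + g)"
    have h: "h \<in> H" using fg by (simp add: h_def add_mem scl_mem)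
    have ph: "\<phi> h = (\<phi> f + \<phi> g) / 2" unfolding h_def using fg by (simp add: scl add add_mem)
    have hh: "ip h h = (ip f f + ip f g + ip g f + ip g g) / 4" unfolding h_def
      using fg add_mem scl_mem
      by (simp add: ip_scl_left ip_scl_right ip_add_left ip_add_right algebra_simps)
    have "ip (f - g) (f - g) = ip f f - ip f g - ip g f + ip g g"
      using fg diff_mem by (simp add: ip_diff_left ip_diff_right)
    then have "Re (ip (f - g) (f - g)) = Re (ip f f) - Re (ip f g) - Re (ip g f) + Re (ip g g)"
      by simp
    then have "Re (ip (f - g) (f - g)) = 2 * (\<Phi> f + \<Phi> g - 2 * \<Phi> h)"
      unfolding \<Phi>_def hh ph by (simp add: field_simps)
    then show ?thesis using m_le[OF h] by (simp add: algebra_simps)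
  qed
  have "\<exists>e\<in>H. (\<lambda>n. Re (ip (X n - e) (X n - e))) \<longlonglongrightarrow> 0"
  proof (rule complete[OF X(1)])
    fix e :: real assume "e > 0"
    then obtain M where M: "1 / Suc M < e / 4"
      using reals_Archimedean[of "e/4"] by (auto simp: inverse_eq_divide)
    show "\<exists>M. \<forall>m\<ge>M. \<forall>n\<ge>M. Re (ip (X m - X n) (X m - X n)) < e"
    proof (intro exI allI impI)
      fix i j assume ij: "i \<ge> M" "j \<ge> M"
      have "1 / real (Suc i) \<le> 1 / Suc M" "1 / real (Suc j) \<le> 1 / Suc M"
        using ij by (auto intro!: divide_left_mono)
      moreover have "d < e" if "d \<le> 2 * a + 2 * b - 4 * m" "a < m + x" "b < m + y" "x \<le> z" "y \<le> z" "z < e / 4"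
        for d a b x y z :: real
        using that by linarith
      ultimately show "Re (ip (X i - X j) (X i - X j)) < e"
        using par[OF X(1)[of i] X(1)[of j]] X(2)[of i] X(2)[of j] M by blast
    qed
  qed
  then obtain e where e: "e \<in> H" "(\<lambda>n. Re (ip (X n - e) (X n - e))) \<longlonglongrightarrow> 0" by blast
  have "\<phi> h = ip h e" if h: "h \<in> H" for h
  proof -
    have lim: "(\<lambda>n. ip h (X n)) \<longlonglongrightarrow> ip h e"
    proof (rule LIM_zero_cancel, rule tendsto_zero_if_norm_power2)
      have "(cmod (ip h (X n) - ip h e))\<^sup>2 \<le> Re (ip h h) * Re (ip (X n - e) (X n - e))" for n
        using Cauchy_Schwarz[OF h diff_mem[OF X(1)[of n] e(1)]] ip_diff_right[OF X(1) e(1) h] by simp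
      note bd = this
      have lm: "(\<lambda>n. Re (ip h h) * Re (ip (X n - e) (X n - e))) \<longlonglongrightarrow> 0"
        using tendsto_mult_left[OF e(2), of "Re (ip h h)"] by simp
      show "(\<lambda>n. (cmod (ip h (X n) - ip h e))\<^sup>2) \<longlonglongrightarrow> 0"
        by (rule tendsto_sandwich[OF _ _ tendsto_const lm]) (use bd in simp_all)
    qed
    \<comment> \<open>First variation: \<open>m\<close> is a lower bound for \<open>\<Phi>\<close>
      at \<open>X n + scl c h\<close>, while \<open>\<Phi> (X n)\<close> exceeds \<open>m\<close> by
      less than \<open>1 / Suc n\<close>. In the limit only a nonnegative quadratic expression in
      \<open>c\<close> is left.\<close>
    have var: "0 \<le> 2 * Re (c * (ip h e - \<phi> h)) + (cmod c)\<^sup>2 * Re (ip h h)" for c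
    proof (rule LIMSEQ_le[OF tendsto_const[of 0]])
      have "0 \<le> 1 / Suc n + (2 * Re (c * (ip h (X n) - \<phi> h)) + (cmod c)\<^sup>2 * Re (ip h h))" for n
      proof -
        have *: "\<Phi> (X n + scl c h)
            = \<Phi> (X n) + 2 * Re (c * (ip h (X n) - \<phi> h)) + (cmod c)\<^sup>2 * Re (ip h h)"
          unfolding \<Phi>_def ip_self_add_scl[OF X(1) h] add[OF X(1) scl_mem[OF h]] scl[OF h]
          by (simp add: algebra_simps)
        have "m \<le> \<Phi> (X n + scl c h)" using X(1) h by (intro m_le add_mem scl_mem)
        moreover have "0 \<le> x + (a + b)" if "m \<le> y + a + b" "y < m + x" for x y a b :: real
          using that by linarith
        ultimately show ?thesis unfolding * using X(2)[of n] by blast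
      qed
      then show "\<exists>N. \<forall>n\<ge>N. 0 \<le> 1 / Suc n + (2 * Re (c * (ip h (X n) - \<phi> h)) + (cmod c)\<^sup>2 * Re (ip h h))"
        by blast
      have "(\<lambda>n. 1 / real (Suc n)) \<longlonglongrightarrow> 0" using LIMSEQ_inverse_real_of_nat by (simp add: inverse_eq_divide)
      then have "(\<lambda>n. 1 / real (Suc n) + (2 * Re (c * (ip h (X n) - \<phi> h)) + (cmod c)\<^sup>2 * Re (ip h h)))
          \<longlonglongrightarrow> 0 + (2 * Re (c * (ip h e - \<phi> h)) + (cmod c)\<^sup>2 * Re (ip h h))"
        using lim by (intro tendsto_intros)
      then show "(\<lambda>n. 1 / real (Suc n) + (2 * Re (c * (ip h (X n) - \<phi> h)) + (cmod c)\<^sup>2 * Re (ip h h)))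
          \<longlonglongrightarrow> 2 * Re (c * (ip h e - \<phi> h)) + (cmod c)\<^sup>2 * Re (ip h h)" by simp
    qed
    define a where "a = ip h e - \<phi> h"
    define q where "q = Re (ip h h)"
    have q: "q \<ge> 0" unfolding q_def by (rule ip_self_nonneg[OF h])
    \<comment> \<open>At \<open>c = - t * cnj a\<close> the linear term is - 2 t |a|^2 and the
      quadratic one t^2 q |a|^2. As t q < 1, their sum is negative unless
      \<open>a = 0\<close>.\<close>
    define t where "t = 1 / (q + 1)"
    have t: "t > 0" "t * q < 1" using q by (auto simp: t_def field_simps)
    have "Re (- (t * cnj a) * a) = - t * (cmod a)\<^sup>2"
      by (simp add: cmod_def power2_eq_square algebra_simps)
    then have "0 \<le> - 2 * t * (cmod a)\<^sup>2 + t\<^sup>2 * (cmod a)\<^sup>2 * q"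
      using var[of "- (t * cnj a)"] t(1) unfolding a_def[symmetric] q_def[symmetric]
      by (simp add: norm_mult power_mult_distrib)
    also have "\<dots> = (t * (cmod a)\<^sup>2) * (t * q - 2)" by (simp add: power2_eq_square algebra_simps)
    finally have "0 \<le> (t * (cmod a)\<^sup>2) * (t * q - 2)" .
    then have "t * (cmod a)\<^sup>2 \<le> 0" using t by (simp add: zero_le_mult_iff)
    then have "a = 0" using t(1) by (simp add: mult_le_0_iff)
    then show ?thesis by (simp add: a_def)
  qed
  then show ?thesis using e(1) by blast
qed

text \<open>\<open>T\<close> respects differences, so Cauchy sequences and their limits are carried
  over from \<open>H\<close>. \<open>ip'\<close> is constrained on the image only.\<close>

lemma hilbert_space_image:
  fixes T :: "'s \<Rightarrow> 't::ab_group_add"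
  assumes T: "inj_on T H" "\<And>f g. f \<in> H \<Longrightarrow> g \<in> H \<Longrightarrow> T (f + g) = T f + T g"
    "\<And>c f. f \<in> H \<Longrightarrow> T (scl c f) = scl' c (T f)"
    and ip': "\<And>f g. f \<in> H \<Longrightarrow> g \<in> H \<Longrightarrow> ip' (T f) (T g) = ip f g"
  shows "hilbert_space scl' (T ` H) ip'"
proof -
  have T0: "T 0 = 0" using T(2)[OF zero_mem zero_mem] by simp
  have Td: "T f - T g = T (f - g)" if "f \<in> H" "g \<in> H" for f g
    using T(2)[OF diff_mem[OF that] that(2)] by simp
  have comp: "\<exists>f\<in>T ` H. (\<lambda>n. Re (ip' (X n - f) (X n - f))) \<longlonglongrightarrow> 0"
    if X: "\<forall>n. X n \<in> T ` H" and C: "\<forall>e>0. \<exists>M. \<forall>m\<ge>M. \<forall>n\<ge>M. Re (ip' (X m - X n) (X m - X n)) < e" for X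
  proof -
    have "\<forall>n. \<exists>y. y \<in> H \<and> X n = T y" using X by blast
    then obtain Y where Y: "\<And>n. Y n \<in> H" "\<And>n. X n = T (Y n)" by (metis choice_iff)
    have eq: "ip' (T f - T g) (T f - T g) = ip (f - g) (f - g)" if "f \<in> H" "g \<in> H" for f g
      unfolding Td[OF that] by (rule ip'[OF diff_mem[OF that] diff_mem[OF that]])
    obtain f where f: "f \<in> H" "(\<lambda>n. Re (ip (Y n - f) (Y n - f))) \<longlonglongrightarrow> 0"
      using C complete[of Y] unfolding Y(2) eq[OF Y(1) Y(1)] using Y(1) by blast
    show ?thesis
      using f(2) unfolding Y(2) eq[OF Y(1) f(1), symmetric] using f(1) by blast
  qed
  show ?thesis
    unfolding hilbert_space_def
  proof (intro conjI ballI allI impI)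
    show "0 \<in> T ` H" using T0 zero_mem by force
    fix f g h assume "f \<in> T ` H" "g \<in> T ` H" "h \<in> T ` H"
    then obtain f' g' h' where "f' \<in> H" "g' \<in> H" "h' \<in> H" "f = T f'" "g = T g'" "h = T h'"
      by blast
    note this [simp]
    show "f + g \<in> T ` H" by (simp add: T(2)[symmetric] add_mem)
    show "scl' c f \<in> T ` H" for c by (simp add: T(3)[symmetric] scl_mem)
    show "ip' (f + g) h = ip' f h + ip' g h"
      by (simp add: T(2)[symmetric] add_mem ip' ip_add_left)
    show "ip' (scl' c f) g = c * ip' f g" for c
      by (simp add: T(3)[symmetric] scl_mem ip' ip_scl_left)
    show "ip' g f = cnj (ip' f g)"
      using ip_commute[of f' g'] by (simp add: ip')
    show "0 < Re (ip' f f)" if "f \<noteq> 0"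
      using ip_pos[of f'] that T0 by (auto simp: ip')
  next
    fix X :: "nat \<Rightarrow> 't"
    assume "(\<forall>n. X n \<in> T ` H) \<and>
      (\<forall>e>0. \<exists>M. \<forall>m\<ge>M. \<forall>n\<ge>M. Re (ip' (X m - X n) (X m - X n)) < e)"
    then show "\<exists>f\<in>T ` H. (\<lambda>n. Re (ip' (X n - f) (X n - f))) \<longlonglongrightarrow> 0"
      using comp by blast
  qed
qed

end

section \<open>Spaces of sections with a reproducing kernel\<close>

lemma cdot_add_left: "cdot (x + y) z = cdot x z + cdot y z"
  and cdot_scale_left: "cdot (c *s x) z = c * cdot x z"
  and cdot_zero_left: "cdot 0 z = 0"
  and cdot_commute: "cdot y x = cnj (cdot x y)"
  and cdot_axis_right: "cdot x (axis i 1) = x $ i"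
  by (simp_all add: cdot_def sum.distrib sum_distrib_left algebra_simps axis_def if_distrib cong: if_cong)

lemma cdot_matrix_left: "cdot (A *v x) y = cdot x (madj A *v y)"
proof -
  have "cdot (A *v x) y = (\<Sum>i\<in>UNIV. \<Sum>k\<in>UNIV. A $ i $ k * x $ k * cnj (y $ i))"
    by (simp add: cdot_def matrix_vector_mult_def sum_distrib_right)
  also have "\<dots> = (\<Sum>k\<in>UNIV. \<Sum>i\<in>UNIV. A $ i $ k * x $ k * cnj (y $ i))"
    by (rule sum.swap)
  also have "\<dots> = cdot x (madj A *v y)"
    by (simp add: cdot_def matrix_vector_mult_def madj_def sum_distrib_left algebra_simps)
  finally show ?thesis .
qed

lemma cdot_self_nonzero: "x \<noteq> 0 \<Longrightarrow> 0 < Re (cdot x x)"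
proof -
  assume "x \<noteq> 0"
  then obtain i where i: "x $ i \<noteq> 0" by (metis vec_eq_iff zero_index)
  have "Re (cdot x x) = (\<Sum>i\<in>UNIV. (cmod (x $ i))\<^sup>2)"
    unfolding cdot_def complex_norm_square[symmetric] by simp
  also have "\<dots> > 0" using i by (intro sum_pos2[of _ i]) auto
  finally show ?thesis .
qed

lemma madj_madj: "madj (madj A) = A"
  and madj_mat_1: "madj (mat 1) = mat 1"
  by (auto simp: madj_def mat_def vec_eq_iff)

lemma madj_mult: "madj (A ** B) = madj B ** madj A"
  by (simp add: madj_def matrix_matrix_mult_def vec_eq_iff mult.commute)

lemma matrix_vector_axis: "(A *v axis k 1) $ i = (A::complex^'n^'n) $ i $ k"
  by (simp add: matrix_vector_mult_def axis_def if_distrib cong: if_cong)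

lemma invertible_I:
  fixes A :: "complex^'n^'n"
  shows "A ** B = mat 1 \<Longrightarrow> invertible A" and "B ** A = mat 1 \<Longrightarrow> invertible A"
  by (metis invertible_def matrix_left_right_inverse)+

lemma matrix_inv_right': "invertible (A::complex^'n^'n) \<Longrightarrow> A ** matrix_inv A = mat 1"
  and matrix_inv_left': "invertible (A::complex^'n^'n) \<Longrightarrow> matrix_inv A ** A = mat 1"
  unfolding invertible_def matrix_inv_def by (metis (mono_tags, lifting) someI_ex)+

lemma matrix_inv_eq:
  fixes A :: "complex^'n^'n"
  assumes "A ** B = mat 1" shows "matrix_inv A = B"
  by (metis assms invertible_I(1) matrix_inv_left' matrix_mul_assoc matrix_mul_lid matrix_mul_rid)

lemma invertible_madj: "invertible A \<Longrightarrow> invertible (madj A)"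
  by (metis invertible_I(2) madj_mat_1 madj_mult matrix_inv_right')

lemma hol_sectionsD:
  assumes "f \<in> hol_sections"
  shows "(\<lambda>z. f z $ i) holomorphic_on disc" "z \<notin> disc \<Longrightarrow> f z = 0"
  using assms by (auto simp: hol_sections_def hol_functions_def vec_eq_iff simp del: mem_ball_0)

lemma hol_sectionsI:
  assumes "\<And>i. (\<lambda>z. f z $ i) holomorphic_on disc" "\<And>z. z \<notin> disc \<Longrightarrow> f z = 0"
  shows "f \<in> hol_sections"
  using assms by (auto simp: hol_sections_def hol_functions_def simp del: mem_ball_0)

lemma vector_space_sections: "vector_space (\<lambda>c f z. c *s (f z :: complex^'n))"
  by unfold_locales (auto simp: fun_eq_iff vec_eq_iff algebra_simps)

locale rkhs =
  fixes H :: "(complex \<Rightarrow> complex^'n) set"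
    and ip :: "(complex \<Rightarrow> complex^'n) \<Rightarrow> (complex \<Rightarrow> complex^'n) \<Rightarrow> complex"
    and K :: "complex \<Rightarrow> complex \<Rightarrow> complex^'n^'n"
  assumes hilbert_sections: "hilbert_sections H ip"
    and reproducing: "reproducing_kernel H ip K"
begin

sublocale hilbert "\<lambda>c f z. c *s f z" H ip
  using hilbert_sections unfolding hilbert_sections_def hilbert_def hilbert_axioms_def
  by (simp add: vector_space_sections)

text \<open>The vector representing the functional that takes \<open>f\<close> to
  \<open>cdot (f w) x\<close>; it is 0 off the disc, as every member of \<open>H\<close> is.\<close>

definition ksec :: "complex \<Rightarrow> complex^'n \<Rightarrow> complex \<Rightarrow> complex^'n" where
  "ksec w x = (\<lambda>z. if z \<in> disc then K z w *v x else 0)"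

lemma hol: "f \<in> H \<Longrightarrow> f \<in> hol_sections"
  using hilbert_sections unfolding hilbert_sections_def by blast

lemma ksec_mem: "w \<in> disc \<Longrightarrow> ksec w x \<in> H"
  and ip_ksec: "w \<in> disc \<Longrightarrow> f \<in> H \<Longrightarrow> ip f (ksec w x) = cdot (f w) x"
  using reproducing unfolding reproducing_kernel_def ksec_def by blast+

lemma ip_ksec_ksec:
  "w \<in> disc \<Longrightarrow> z \<in> disc \<Longrightarrow> ip (ksec w x) (ksec z y) = cdot (K z w *v x) y"
  using ip_ksec[OF _ ksec_mem] by (simp add: ksec_def del: mem_ball_0)

text \<open>Hermitian symmetry of \<open>ip\<close>, tested on the kernel sections of unit
  vectors.\<close>

lemma kernel_adjoint:
  assumes "z \<in> disc" "w \<in> disc" shows "madj (K z w) = K w z"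
proof -
  have "K w z $ i $ k = cnj (K z w $ k $ i)" for i k
    using ip_commute[OF ksec_mem[of w "axis i 1"] ksec_mem[of z "axis k 1"]] assms
    by (simp add: ip_ksec_ksec cdot_axis_right matrix_vector_axis del: mem_ball_0)
  then show ?thesis by (simp add: madj_def vec_eq_iff)
qed

lemma kernel_entry_cnj: "z \<in> disc \<Longrightarrow> w \<in> disc \<Longrightarrow> cnj (K z w $ k $ i) = K w z $ i $ k"
  using kernel_adjoint[of z w] by (auto simp: madj_def vec_eq_iff simp del: mem_ball_0)

lemma kernel_holomorphic:
  assumes "w \<in> disc" shows "(\<lambda>z. K z w $ i $ k) holomorphic_on disc"
  using hol_sectionsD(1)[OF hol[OF ksec_mem[OF assms, of "axis k 1"]], of i]
  by (rule holomorphic_transform) (simp add: ksec_def matrix_vector_axis del: mem_ball_0)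

lemma kernel_antiholomorphic:
  assumes "z \<in> disc" shows "(\<lambda>w. cnj (K z w $ i $ k)) holomorphic_on disc"
  using kernel_holomorphic[OF assms, of k i]
  by (rule holomorphic_transform) (use kernel_entry_cnj assms in simp)

lemma kernel_nonneg: "z \<in> disc \<Longrightarrow> 0 \<le> Re (cdot (K z z *v x) x)"
  using ip_self_nonneg[OF ksec_mem[of z x]] by (simp add: ip_ksec_ksec)

text \<open>\<open>cdot (K z z *v x) x\<close> is the squared norm of \<open>ksec z x\<close>, and
  this vector is nonzero as soon as it pairs nontrivially with some \<open>f\<close>.\<close>

lemma kernel_pos:
  assumes z: "z \<in> disc" and x: "\<not> (\<forall>f\<in>H. cdot (f z) x = 0)"
  shows "0 < Re (cdot (K z z *v x) x)"
proof -
  obtain f where f: "f \<in> H" "cdot (f z) x \<noteq> 0" using x by blast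
  then have "ksec z x \<noteq> 0"
    using ip_ksec[OF z f(1), of x] ip_commute[OF zero_mem f(1)] ip_zero_left[OF f(1)] by auto
  then show ?thesis using ip_pos[OF ksec_mem[OF z]] z by (simp add: ip_ksec_ksec)
qed

text \<open>Invertibility makes evaluation at \<open>z\<close> surjective, already on kernel
  sections, so every \<open>x\<close> is detected by some member of \<open>H\<close>.\<close>

lemma pos_def_kernel:
  assumes z: "z \<in> disc" and inv: "invertible (K z z)"
  shows "pos_def (K z z)"
  unfolding pos_def_def
proof (intro conjI allI impI)
  show "madj (K z z) = K z z" using kernel_adjoint z by blast
  fix x :: "complex^'n" assume x: "x \<noteq> 0"
  define y where "y = matrix_inv (K z z) *v x"
  have y: "K z z *v y = x" by (simp add: y_def matrix_vector_mul_assoc matrix_inv_right'[OF inv])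
  have "ksec z y z = x" using y z by (simp add: ksec_def)
  then have "cdot (ksec z y z) x \<noteq> 0" using cdot_self_nonzero[OF x] by auto
  then show "0 < Re (cdot (K z z *v x) x)"
    using ksec_mem[OF z] by (intro kernel_pos[OF z]) blast
qed

lemma norm_eval_le:
  assumes f: "f \<in> H" and z: "z \<in> disc"
  shows "(cmod (f z $ i))\<^sup>2 \<le> Re (K z z $ i $ i) * Re (ip f f)"
  using Cauchy_Schwarz[OF f ksec_mem[OF z, of "axis i 1"]] f z
  by (simp add: ip_ksec ip_ksec_ksec cdot_axis_right matrix_vector_axis mult.commute)

text \<open>Only the diagonal is involved: there the invariance formula shows continuity, and
  \<open>norm_eval_le\<close> turns a bound into a uniform bound for all members of
  \<open>H\<close>.\<close>

definition locally_bounded :: bool where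
  "locally_bounded \<longleftrightarrow> (\<forall>r<1. \<exists>C. \<forall>z i. cmod z \<le> r \<longrightarrow> Re (K z z $ i $ i) \<le> C)"

text \<open>Cauchy's inequality on a circle about \<open>w\<close>; on the circle \<open>f\<close>
  is bounded by its Hilbert space norm.\<close>

lemma bounded_functional_deriv:
  assumes lb: "locally_bounded" and w: "w \<in> disc"
  shows "bounded_functional (\<lambda>f. (deriv ^^ n) (\<lambda>z. f z $ i) w)"
proof -
  \<comment> \<open>Half the distance to the unit circle, so that the closed disc about
    \<open>w\<close> lies in a compact part of the unit disc.\<close>
  define r where "r = (1 - cmod w) / 2"
  have r: "r > 0" "cmod w + r < 1" using w by (auto simp: r_def field_simps)
  have sub: "cball w r \<subseteq> disc"
  proof
    fix z assume "z \<in> cball w r"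
    then have "cmod (z - w) \<le> r" by (simp add: dist_norm norm_minus_commute)
    then show "z \<in> disc" using norm_triangle_ineq2[of z w] r(2) by simp
  qed
  obtain C where C: "\<And>z i. cmod z \<le> cmod w + r \<Longrightarrow> Re (K z z $ i $ i) \<le> C"
    using lb r(2) unfolding locally_bounded_def by blast
  have C0: "C \<ge> 0"
  proof -
    have "0 \<le> Re (K w w $ i $ i)"
      using kernel_nonneg[OF w, of "axis i 1"] by (simp add: cdot_axis_right matrix_vector_axis)
    also have "\<dots> \<le> C" using C[of w i] r by simp
    finally show ?thesis .
  qed
  have bd: "(cmod ((deriv ^^ n) (\<lambda>z. f z $ i) w))\<^sup>2 \<le> ((fact n / r ^ n)\<^sup>2 * C) * Re (ip f f)"
    if f: "f \<in> H" for f
  proof -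
    define q where "q = Re (ip f f)"
    have q: "q \<ge> 0" unfolding q_def by (rule ip_self_nonneg[OF f])
    have ho: "(\<lambda>z. f z $ i) holomorphic_on disc" by (rule hol_sectionsD(1)[OF hol[OF f]])
    have "cmod ((deriv ^^ n) (\<lambda>z. f z $ i) w) \<le> fact n * sqrt (C * q) / r ^ n"
    proof (rule Cauchy_inequality)
      show "(\<lambda>z. f z $ i) holomorphic_on ball w r"
        by (rule holomorphic_on_subset[OF ho]) (use sub in \<open>auto simp: subset_iff\<close>)
      show "continuous_on (cball w r) (\<lambda>z. f z $ i)"
        using holomorphic_on_imp_continuous_on[OF holomorphic_on_subset[OF ho sub]] .
      show "0 < r" by (rule r(1))
      show "norm (f x $ i) \<le> sqrt (C * q)" if x: "norm (w - x) = r" for x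
      proof -
        have xd: "x \<in> disc" using sub x by (auto simp: dist_norm subset_iff)
        have "cmod x \<le> cmod w + r"
          using norm_triangle_ineq2[of x w] x by (simp add: norm_minus_commute)
        then have "(cmod (f x $ i))\<^sup>2 \<le> C * q"
          using norm_eval_le[OF f xd, of i] C[of x i] mult_right_mono[OF _ q] unfolding q_def
          by fastforce
        then show ?thesis by (rule real_le_rsqrt)
      qed
    qed
    then have "(cmod ((deriv ^^ n) (\<lambda>z. f z $ i) w))\<^sup>2 \<le> (fact n * sqrt (C * q) / r ^ n)\<^sup>2"
      by (rule power_mono) simp
    also have "\<dots> = ((fact n / r ^ n)\<^sup>2 * C) * q"
      using C0 q by (simp add: power_mult_distrib power_divide)
    finally show ?thesis by (simp add: q_def)
  qed
  have hd: "(\<lambda>z. f z $ i) holomorphic_on disc" if "f \<in> H" for f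
    by (rule hol_sectionsD(1)[OF hol[OF that]])
  have "(deriv ^^ n) (\<lambda>z. (f + g) z $ i) w
      = (deriv ^^ n) (\<lambda>z. f z $ i) w + (deriv ^^ n) (\<lambda>z. g z $ i) w" if "f \<in> H" "g \<in> H" for f g
    using higher_deriv_add[OF hd[OF that(1)] hd[OF that(2)] open_ball w] by simp
  moreover have "(deriv ^^ n) (\<lambda>z. (c *s f z) $ i) w = c * (deriv ^^ n) (\<lambda>z. f z $ i) w"
    if "f \<in> H" for c f
    using higher_deriv_cmult[OF hd[OF that] w open_ball] by simp
  moreover have "0 \<le> (fact n / r ^ n)\<^sup>2 * C" using C0 by simp
  ultimately show ?thesis unfolding bounded_functional_def using bd by blast
qed

text \<open>Evaluation after \<open>T\<close> is a bounded functional on \<open>H\<close>. The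
  images under \<open>T\<close> of its Riesz vectors are the kernel sections of the image
  space.\<close>

lemma rkhs_image:
  fixes T :: "(complex \<Rightarrow> complex^'n) \<Rightarrow> complex \<Rightarrow> complex^'n"
  assumes T: "inj_on T H" "\<And>f g. f \<in> H \<Longrightarrow> g \<in> H \<Longrightarrow> T (f + g) = T f + T g"
    "\<And>c f. f \<in> H \<Longrightarrow> T (\<lambda>z. c *s f z) = (\<lambda>z. c *s T f z)"
    and ip': "\<And>f g. f \<in> H \<Longrightarrow> g \<in> H \<Longrightarrow> ip' (T f) (T g) = ip f g"
    and hT: "\<And>f. f \<in> H \<Longrightarrow> T f \<in> hol_sections"
    and bT: "\<And>w i. w \<in> disc \<Longrightarrow> bounded_functional (\<lambda>f. T f w $ i)"
  shows "\<exists>K'. rkhs (T ` H) ip' K'"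
proof -
  have "bounded_functional (\<lambda>f. cdot (T f w) x)" if "w \<in> disc" for w x
  proof -
    have "bounded_functional (\<lambda>f. \<Sum>i\<in>UNIV. cnj (x $ i) * T f w $ i)"
      by (intro bounded_functional_sum bounded_functional_cmult bT that)
    then show ?thesis by (simp add: cdot_def mult.commute)
  qed
  then have "\<exists>e. w \<in> disc \<longrightarrow> e \<in> H \<and> (\<forall>f\<in>H. cdot (T f w) x = ip f e)" for w x
    using Riesz by blast
  then obtain e where e: "\<And>w x. w \<in> disc \<Longrightarrow> e w x \<in> H"
    "\<And>w x f. w \<in> disc \<Longrightarrow> f \<in> H \<Longrightarrow> cdot (T f w) x = ip f (e w x)"
    by metis
  \<comment> \<open>The vectors \<open>e w x\<close> are chosen separately for each
    \<open>x\<close>, so a matrix cannot be read off from them directly. Hermitian symmetry allows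
    it to be built from the vectors \<open>e z (axis i 1)\<close>, one for each row.\<close>
  define K' where "K' z w = (\<chi> i k. cnj (T (e z (axis i 1)) w $ k))" for z w
  have K': "K' z w *v x = T (e w x) z" if zw: "z \<in> disc" "w \<in> disc" for z w x
  proof -
    have "T (e w x) z $ i = (K' z w *v x) $ i" for i
    proof -
      have "T (e w x) z $ i = ip (e w x) (e z (axis i 1))"
        using e(2)[OF zw(1) e(1)[OF zw(2), of x], of "axis i 1"] by (simp add: cdot_axis_right)
      also have "\<dots> = cnj (ip (e z (axis i 1)) (e w x))"
        using ip_commute e(1) zw by blast
      also have "\<dots> = cnj (cdot (T (e z (axis i 1)) w) x)"
        using e(2)[OF zw(2) e(1)[OF zw(1)]] by simp
      also have "\<dots> = (K' z w *v x) $ i"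
        by (simp add: K'_def cdot_def matrix_vector_mult_def)
      finally show ?thesis .
    qed
    then show ?thesis by (simp add: vec_eq_iff)
  qed
  have sec: "(\<lambda>z. if z \<in> disc then K' z w *v x else 0) = T (e w x)" if w: "w \<in> disc" for w x
    using K'[OF _ w] hol_sectionsD(2)[OF hT[OF e(1)[OF w]]] by (auto simp: fun_eq_iff simp del: mem_ball_0)
  have "reproducing_kernel (T ` H) ip' K'"
    unfolding reproducing_kernel_def
    using sec e ip' by auto
  moreover have "hilbert_sections (T ` H) ip'"
    unfolding hilbert_sections_def
    by (intro conjI hilbert_space_image T ip') (auto intro: hT)
  ultimately show ?thesis by (auto simp: rkhs_def)
qed

text \<open>The right-hand side mentions only \<open>T\<close> and the kernel sections of the
  source. Hence two spaces with the same kernel have images with the same kernel under the same map,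
  even if the spaces are not known to coincide.\<close>

lemma kernel_image:
  fixes T :: "(complex \<Rightarrow> complex^'n) \<Rightarrow> complex \<Rightarrow> complex^'n"
  assumes ip': "\<And>f g. f \<in> H \<Longrightarrow> g \<in> H \<Longrightarrow> ip' (T f) (T g) = ip f g"
    and K': "reproducing_kernel (T ` H) ip' K'"
    and zw: "z \<in> disc" "w \<in> disc"
  shows "K' z w *v x =
    T (\<lambda>u. if u \<in> disc then \<chi> i. cnj (cdot (T (ksec u (axis i 1)) w) x) else 0) z"
proof -
  define k where "k = (\<lambda>z. if z \<in> disc then K' z w *v x else 0)"
  have k: "k \<in> T ` H" "\<And>f. f \<in> H \<Longrightarrow> ip' (T f) k = cdot (T f w) x"
    using K' zw(2) unfolding reproducing_kernel_def k_def by blast+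
  then obtain e where e: "e \<in> H" "k = T e" by blast
  \<comment> \<open>The preimage \<open>e\<close> of the kernel section is recovered by pairing it
    with the kernel sections of \<open>H\<close>; through \<open>ip'\<close> these pairings become
    evaluations at \<open>w\<close>.\<close>
  have "e u = (if u \<in> disc then \<chi> i. cnj (cdot (T (ksec u (axis i 1)) w) x) else 0)" for u
  proof (cases "u \<in> disc")
    case True
    have "e u $ i = cnj (cdot (T (ksec u (axis i 1)) w) x)" for i
    proof -
      have "e u $ i = ip e (ksec u (axis i 1))"
        using ip_ksec[OF True e(1)] by (simp add: cdot_axis_right)
      also have "\<dots> = cnj (ip (ksec u (axis i 1)) e)"
        using ip_commute e(1) ksec_mem[OF True] by blast
      also have "ip (ksec u (axis i 1)) e = cdot (T (ksec u (axis i 1)) w) x"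
        using k(2)[OF ksec_mem[OF True]] ip'[OF ksec_mem[OF True] e(1)] e(2) by simp
      finally show ?thesis .
    qed
    then show ?thesis using True by (simp add: vec_eq_iff)
  next
    case False
    then show ?thesis using hol_sectionsD(2)[OF hol[OF e(1)]] by auto
  qed
  then have "k z = T (\<lambda>u. if u \<in> disc then \<chi> i. cnj (cdot (T (ksec u (axis i 1)) w) x) else 0) z"
    using e(2) by presburger
  then show ?thesis using zw by (simp add: k_def del: mem_ball_0)
qed

text \<open>A unitary operator of the form \<open>f \<mapsto> J g (f o g)\<close> takes kernel
  sections to kernel sections, because both represent the same evaluation functional.\<close>

lemma kernel_invariant:
  assumes J: "unitary_action J H ip" and g: "g \<in> carrier mob_cover"
    and zw: "z \<in> disc" "w \<in> disc"
  shows "K z w = J g z ** K (act g z) (act g w) ** madj (J g w)"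
proof -
  interpret G: group mob_cover by (rule group_mob_cover)
  \<comment> \<open>\<open>section_action\<close> already contains an inverse; a second one leaves
    \<open>J g\<close> and \<open>act g\<close> themselves.\<close>
  define U where "U = section_action J (inv\<^bsub>mob_cover\<^esub> g)"
  have gi: "inv\<^bsub>mob_cover\<^esub> g \<in> carrier mob_cover" using g by simp
  have U: "U ` H = H" "\<And>f h. f \<in> H \<Longrightarrow> h \<in> H \<Longrightarrow> ip (U f) (U h) = ip f h"
    using J gi unfolding unitary_action_def U_def by blast+
  have Uev: "U f v = J g v *v f (act g v)" if "v \<in> disc" for f v
    using that g by (simp add: U_def section_action_def del: mem_ball_0)
  have gd: "act g z \<in> disc" "act g w \<in> disc" using act_in_disc g zw by blast+
  have "ksec w x = U (ksec (act g w) (madj (J g w) *v x))" for x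
  proof (rule ip_ext)
    show "ksec w x \<in> H" "U (ksec (act g w) (madj (J g w) *v x)) \<in> H"
      using ksec_mem zw gd U(1) by blast+
    fix f assume "f \<in> H"
    then obtain h where h: "h \<in> H" "f = U h" using U(1) by blast
    have "ip f (ksec w x) = cdot (U h w) x"
      using ip_ksec[OF zw(2) \<open>f \<in> H\<close>] h by simp
    also have "\<dots> = cdot (h (act g w)) (madj (J g w) *v x)"
      using Uev[OF zw(2)] by (simp add: cdot_matrix_left)
    also have "\<dots> = ip h (ksec (act g w) (madj (J g w) *v x))"
      using ip_ksec[OF gd(2) h(1)] by simp
    also have "\<dots> = ip f (U (ksec (act g w) (madj (J g w) *v x)))"
      using U(2) h ksec_mem[OF gd(2)] by simp
    finally show "ip f (ksec w x) = \<dots>" .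
  qed
  then have "ksec w x z = J g z *v ksec (act g w) (madj (J g w) *v x) (act g z)" for x
    using Uev[OF zw(1)] by metis
  then have "K z w *v x = (J g z ** K (act g z) (act g w) ** madj (J g w)) *v x" for x
    unfolding ksec_def if_P[OF zw(1)] if_P[OF gd(1)]
    by (simp add: matrix_vector_mul_assoc matrix_mul_assoc)
  then show ?thesis by (simp add: matrix_eq)
qed

end

section \<open>Quasi-invariant scalar kernels\<close>

lemma rotation_mem: "(t, 0) \<in> carrier mob_cover"
  and translation_mem: "cmod w < 1 \<Longrightarrow> (t, w) \<in> carrier mob_cover"
  by (simp_all add: carrier_mob_cover)

lemma act_rotation: "act (t, 0) z = cis t * z"
  by (simp add: act_def Moebius_function_def cis_conv_exp)

lemma deriv_pow_rotation: "deriv_pow (t, 0) s z = cis (t * s)"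
  by (simp add: deriv_pow_def log_deriv_def cis_conv_exp mult_ac)

lemma act_to_zero: "act (0, z) z = 0"
  by (simp add: act_def Moebius_function_eq_zero)

text \<open>The derivative of the element \<open>(0, z)\<close> at \<open>z\<close> is 1 / (1 -
  |z|^2), which is positive, and its logarithm in \<open>log_deriv\<close> is real; so the branch is
  the real power.\<close>

lemma deriv_pow_to_zero:
  assumes "cmod z < 1"
  shows "deriv_pow (0, z) s z = of_real ((1 - (cmod z)\<^sup>2) powr (- s))"
proof -
  have p: "1 - (cmod z)\<^sup>2 > 0" using assms by (simp add: abs_square_less_1)
  have "1 - cnj z * z = of_real (1 - (cmod z)\<^sup>2)"
    by (simp only: of_real_diff complex_norm_square of_real_1) (simp add: mult.commute)
  then have "Ln (1 - cnj z * z) = of_real (ln (1 - (cmod z)\<^sup>2))"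
    using p by (simp only: Ln_of_real)
  then have "log_deriv (0, z) z = of_real (- ln (1 - (cmod z)\<^sup>2))"
    by (simp add: log_deriv_def)
  then have "deriv_pow (0, z) s z = exp (of_real (s * - ln (1 - (cmod z)\<^sup>2)))"
    by (simp add: deriv_pow_def)
  also have "\<dots> = of_real ((1 - (cmod z)\<^sup>2) powr (- s))"
    unfolding exp_of_real using p by (simp add: powr_def)
  finally show ?thesis .
qed

lemma deriv_pow_add: "deriv_pow g (s + t) z = deriv_pow g s z * deriv_pow g t z"
  by (simp add: deriv_pow_def exp_add[symmetric] algebra_simps)

lemma one_islimpt_sphere: "(1::complex) islimpt sphere 0 1"
proof (rule connected_imp_perfect)
  show "connected (sphere (0::complex) 1)" by (rule connected_sphere) simp
  show "(1::complex) \<in> sphere 0 1" by simp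
  show "sphere (0::complex) 1 \<noteq> {x}" for x
  proof
    assume x: "sphere (0::complex) 1 = {x}"
    have "(1::complex) \<in> sphere 0 1" "(-1::complex) \<in> sphere 0 1" by simp_all
    then show False unfolding x by force
  qed
qed

lemma holomorphic_on_compose_mult:
  assumes "f holomorphic_on A" "\<And>x. x \<in> S \<Longrightarrow> x * a \<in> A"
  shows "(\<lambda>x. f (x * a)) holomorphic_on S"
proof -
  have "(f \<circ> (\<lambda>x. x * a)) holomorphic_on S"
    by (rule holomorphic_on_compose_gen[OF _ assms(1)])
      (auto intro!: holomorphic_intros assms(2))
  then show ?thesis by (simp add: o_def)
qed

text \<open>
  A sesquiholomorphic function vanishes if it vanishes on the diagonal.  Homogeneity under
  rotations replaces the joint analyticity on which the usual proof is based: moving a factor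
  \<open>\<zeta>\<close> from one argument to the other is possible first on the unit circle, then in the disc.
\<close>

lemma polarization:
  fixes d :: "complex \<Rightarrow> complex \<Rightarrow> complex" and p q :: nat
  assumes hol1: "\<And>w. w \<in> disc \<Longrightarrow> (\<lambda>z. d z w) holomorphic_on disc"
    and hol2: "\<And>z. z \<in> disc \<Longrightarrow> (\<lambda>w. cnj (d z w)) holomorphic_on disc"
    and rot: "\<And>t z w. z \<in> disc \<Longrightarrow> w \<in> disc \<Longrightarrow>
      cis t ^ p * d (cis t * z) (cis t * w) = cis t ^ q * d z w"
    and diag: "\<And>z. z \<in> disc \<Longrightarrow> d z z = 0"
    and zw: "z \<in> disc" "w \<in> disc"
  shows "d z w = 0"
proof -
  have shift: "\<zeta> ^ p * d (\<zeta> * z) w = \<zeta> ^ q * d z (cnj \<zeta> * w)"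
    if z: "z \<in> disc" and w: "w \<in> disc" and \<zeta>: "\<zeta> \<in> disc" for z w \<zeta>
  proof -
    \<comment> \<open>For |\<xi>| < R both \<open>\<xi> * z\<close> and \<open>cnj \<xi> * w\<close>
      are in the disc. At a zero argument any number above 1 would serve in place of 2;
      \<open>R > 1\<close> puts the unit circle inside the domain of \<open>h\<close>.\<close>
    define R where "R = min (if z = 0 then 2 else 1 / cmod z) (if w = 0 then 2 else 1 / cmod w)"
    have R: "R > 1" using z w by (auto simp: R_def)
    have mem: "\<xi> * z \<in> disc" "cnj \<xi> * w \<in> disc" "\<xi> * cnj w \<in> disc" if "\<xi> \<in> ball 0 R" for \<xi>
    proof -
      have "cmod \<xi> < (if z = 0 then 2 else 1 / cmod z)" "cmod \<xi> < (if w = 0 then 2 else 1 / cmod w)"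
        using that by (auto simp: R_def)
      then show "\<xi> * z \<in> disc" "cnj \<xi> * w \<in> disc" "\<xi> * cnj w \<in> disc"
        by (auto simp: norm_mult field_simps split: if_splits)
    qed
    define h where "h \<xi> = \<xi> ^ p * d (\<xi> * z) w - \<xi> ^ q * d z (cnj \<xi> * w)" for \<xi>
    have "(\<lambda>\<xi>. d (\<xi> * z) w) holomorphic_on ball 0 R"
      by (rule holomorphic_on_compose_mult[OF hol1[OF w] mem(1)])
    moreover have "(\<lambda>\<xi>. d z (cnj \<xi> * w)) holomorphic_on ball 0 R"
    proof -
      have "cnj ` disc = disc"
      proof (intro equalityI subsetI)
        fix x :: complex assume "x \<in> disc"
        then show "x \<in> cnj ` disc" by (intro image_eqI[of _ _ "cnj x"]) simp_all
      qed auto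
      then have "(cnj \<circ> (\<lambda>v. cnj (d z v)) \<circ> cnj) holomorphic_on disc"
        using holomorphic_on_compose_cnj_cnj[of "\<lambda>v. cnj (d z v)" disc] hol2[OF z] by simp
      then have "(\<lambda>v. d z (cnj v)) holomorphic_on disc" by (simp add: o_def)
      from holomorphic_on_compose_mult[OF this, of "ball 0 R" "cnj w"] mem(3)
      show ?thesis by simp
    qed
    ultimately have hh: "h holomorphic_on ball 0 R"
      unfolding h_def by (intro holomorphic_intros)
    have h0: "h \<xi> = 0" if "\<xi> \<in> sphere 0 1" for \<xi>
    proof -
      have n: "cmod \<xi> = 1" using that by simp
      then obtain t where t: "\<xi> = cis t"
        by (metis Arg_eq cis_conv_exp mult_1 norm_zero of_real_1 zero_neq_one)
      have "\<xi> \<in> ball 0 R" using n R by simp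
      \<comment> \<open>\<open>rot\<close> is applied at the pair \<open>(z, cnj \<xi> * w)\<close>;
        on the circle the rotation brings the second argument back to \<open>w\<close>.\<close>
      have "\<xi> * (cnj \<xi> * w) = w"
        by (simp add: t cis_cnj cis_mult mult.assoc[symmetric])
      moreover have "\<xi> ^ p * d (\<xi> * z) (\<xi> * (cnj \<xi> * w)) = \<xi> ^ q * d z (cnj \<xi> * w)"
        using rot[OF z mem(2)[OF \<open>\<xi> \<in> ball 0 R\<close>], of t] unfolding t .
      ultimately show ?thesis by (simp only: h_def) simp
    qed
    have "h \<zeta> = 0"
      by (rule analytic_continuation[OF hh open_ball convex_connected[OF convex_ball] _ _ one_islimpt_sphere h0])
        (use R \<zeta> in auto)
    then show ?thesis by (simp add: h_def)
  qed
  \<comment> \<open>\<open>shift\<close> with \<open>\<zeta> = sqrt r\<close> at the pair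
    \<open>(z, sqrt r * z)\<close>: one side is a value on the diagonal, the other is the value at
    \<open>(z, r * z)\<close>.\<close>
  have ray: "d z (of_real r * z) = 0" if z: "z \<in> disc" and r: "0 < r" "r < 1" for z r
  proof -
    define s where "s = sqrt r"
    have s: "0 < s" "s < 1" "s * s = r" using r by (auto simp: s_def)
    have sz: "of_real s * z \<in> disc"
    proof -
      have "s * cmod z \<le> 1 * cmod z" using s by (intro mult_right_mono) auto
      then show ?thesis using z s by (simp add: norm_mult)
    qed
    have "of_real s \<in> disc" using s by simp
    from shift[OF z sz this] diag[OF sz] have "of_real s ^ q * d z (of_real s * (of_real s * z)) = 0"
      by simp
    then show ?thesis using s by (simp add: mult.assoc[symmetric] of_real_mult[symmetric] del: of_real_mult)
  qed
  \<comment> \<open>In the second argument the conjugate is holomorphic and vanishes on the segment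
    from 0 to \<open>z\<close>. The segment degenerates at \<open>z = 0\<close>, which is left to
    the identity theorem in the first argument.\<close>
  have nz: "d z w = 0" if z: "z \<in> disc" "z \<noteq> 0" and w: "w \<in> disc" for z w
  proof -
    define h where "h \<xi> = cnj (d z (\<xi> * z))" for \<xi>
    have mem: "\<xi> * z \<in> disc" if "\<xi> \<in> ball 0 (1 / cmod z)" for \<xi>
      using that z by (simp add: norm_mult field_simps)
    have hh: "h holomorphic_on ball 0 (1 / cmod z)"
      unfolding h_def by (rule holomorphic_on_compose_mult[OF hol2[OF z(1)] mem])
    have z1: "1 / cmod z > 1" using z by simp
    have "h (w / z) = 0"
    proof (rule analytic_continuation[OF hh open_ball convex_connected[OF convex_ball],
          where U = "complex_of_real ` {0<..<1}" and \<xi> = "1/2"])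
      show "complex_of_real ` {0<..<1} \<subseteq> ball 0 (1 / cmod z)"
        using z1 by auto
      show "(1 / 2::complex) \<in> ball 0 (1 / cmod z)" using z1 by (simp add: norm_divide)
      have "(1/2::real) islimpt {0<..<1}" by (intro interior_limit_point) (simp add: interior_open)
      then have "complex_of_real (1/2) islimpt complex_of_real ` {0<..<1}"
        by (rule islimpt_isCont_image) (simp_all only: of_real_eq_iff eventually_neq_at_within continuous_of_real continuous_ident)
      then show "(1/2::complex) islimpt complex_of_real ` {0<..<1}" by simp
      show "\<And>x. x \<in> complex_of_real ` {0<..<1} \<Longrightarrow> h x = 0"
        using ray[OF z(1)] by (auto simp: h_def)
      show "w / z \<in> ball 0 (1 / cmod z)"
        using w z by (simp add: norm_divide divide_strict_right_mono)
    qed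
    then show ?thesis using z by (simp add: h_def)
  qed
  show ?thesis
  proof (rule analytic_continuation[OF hol1[OF zw(2)] open_ball convex_connected[OF convex_ball],
        where U = "disc - {0}" and \<xi> = 0])
    have "0 \<in> disc" by simp
    then show "0 islimpt disc - {0::complex}"
      using interior_limit_point[of 0 disc] islimpt_insert[of 0 0 "disc - {0}"]
      by (simp add: insert_absorb)
  qed (use nz zw in auto)
qed

lemma one_minus_mult_cnj_not_nonpos:
  assumes "z \<in> disc" "w \<in> disc" shows "1 - z * cnj w \<notin> \<real>\<^sub>\<le>\<^sub>0" "1 - z * cnj w \<noteq> 0"
  using Re_one_minus_pos[of "z * cnj w"] cmod_mult_lt_1[of z "cnj w"] assms
  by (auto simp: complex_nonpos_Reals_iff)

lemma power_kernel_holomorphic: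
  assumes "w \<in> disc" shows "(\<lambda>z. (1 - z * cnj w) powr of_real s) holomorphic_on disc"
  using one_minus_mult_cnj_not_nonpos[OF _ assms]
  by (intro holomorphic_intros) (auto simp del: mem_ball_0)

lemma cnj_power_kernel:
  assumes "z \<in> disc" "w \<in> disc"
  shows "cnj ((1 - z * cnj w) powr of_real s) = (1 - w * cnj z) powr of_real s"
  using one_minus_mult_cnj_not_nonpos[OF assms]
  by (subst cnj_powr) (auto simp: complex_nonpos_Reals_iff mult.commute)

text \<open>Two kinds of group elements suffice. Rotations give the homogeneity needed in
  \<open>polarization\<close> and force \<open>f 0 0 = 0\<close> for \<open>p \<noteq> q\<close>;
  the elements \<open>(0, z)\<close> determine the diagonal from \<open>f 0 0\<close>.\<close>

theorem quasi_invariant_kernel: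
  fixes f :: "complex \<Rightarrow> complex \<Rightarrow> complex" and p q :: nat and s :: real
  assumes hol1: "\<And>w. w \<in> disc \<Longrightarrow> (\<lambda>z. f z w) holomorphic_on disc"
    and hol2: "\<And>z. z \<in> disc \<Longrightarrow> (\<lambda>w. cnj (f z w)) holomorphic_on disc"
    and inv: "\<And>g z w. g \<in> carrier mob_cover \<Longrightarrow> z \<in> disc \<Longrightarrow> w \<in> disc \<Longrightarrow>
      f z w = deriv_pow g (s + real p) z * f (act g z) (act g w) * cnj (deriv_pow g (s + real q) w)"
    and zw: "z \<in> disc" "w \<in> disc"
  shows "f z w = (if p = q then f 0 0 * (1 - z * cnj w) powr of_real (- 2 * (s + real p)) else 0)"
proof -
  \<comment> \<open>The real parameter \<open>s\<close> cancels between the two factors, which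
    leaves integer powers.\<close>
  have rot: "cis t ^ p * f (cis t * z) (cis t * w) = cis t ^ q * f z w"
    if "z \<in> disc" "w \<in> disc" for t z w
  proof -
    have "f z w = cis (t * (s + p)) * f (cis t * z) (cis t * w) * cis (- (t * (s + q)))"
      using inv[OF rotation_mem[of t] that] by (simp add: deriv_pow_rotation act_rotation cis_cnj)
    then have "cis t ^ q * f z w
        = (cis t ^ q * cis (t * (s + p)) * cis (- (t * (s + q)))) * f (cis t * z) (cis t * w)"
      by (simp only: mult_ac)
    moreover have "cis t ^ q * cis (t * (s + p)) * cis (- (t * (s + q))) = cis t ^ p"
    proof -
      have "real q * t + t * (s + real p) + - (t * (s + real q)) = real p * t"
        by (simp add: algebra_simps)
      then show ?thesis by (simp only: Complex.DeMoivre cis_mult)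
    qed
    ultimately show ?thesis by simp
  qed
  have f0: "f 0 0 = 0" if "p \<noteq> q"
  proof -
    \<comment> \<open>The angle at which the phases of \<open>p\<close> and \<open>q\<close> are
      opposite, so that invariance at the fixed point 0 reads
      \<open>- f 0 0 = f 0 0\<close>.\<close>
    define t where "t = pi / (real p - real q)"
    have "real p * t = real q * t + pi"
      using that unfolding t_def by (simp add: field_simps)
    then have "cis t ^ p = - (cis t ^ q)"
      by (simp add: Complex.DeMoivre cis_mult[symmetric])
    then show ?thesis using rot[of 0 0 t] by (simp add: power_eq_0_iff)
  qed
  define G where "G z w = (if p = q then f 0 0 * (1 - z * cnj w) powr of_real (- 2 * (s + real p)) else 0)"
    for z w
  have "f z w - G z w = 0"
  proof (rule polarization[where d = "\<lambda>z w. f z w - G z w" and p = p and q = q])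
    fix w :: complex assume w: "w \<in> disc"
    have "(\<lambda>z. G z w) holomorphic_on disc"
      using holomorphic_on_mult[OF holomorphic_on_const power_kernel_holomorphic[OF w]]
      by (cases "p = q") (simp_all only: G_def if_True if_False holomorphic_on_const refl)
    then show "(\<lambda>z. f z w - G z w) holomorphic_on disc"
      using hol1[OF w] by (simp add: holomorphic_on_diff)
  next
    fix z :: complex assume z: "z \<in> disc"
    have "(\<lambda>w. cnj (G z w)) holomorphic_on disc"
    proof (cases "p = q")
      case True
      have "(\<lambda>w. cnj (f 0 0) * (1 - w * cnj z) powr of_real (- 2 * (s + real p))) holomorphic_on disc"
        by (intro holomorphic_intros power_kernel_holomorphic[OF z])
      then show ?thesis
        by (rule holomorphic_transform)
          (simp only: G_def True refl if_True complex_cnj_mult cnj_power_kernel[OF z])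
    qed (simp add: G_def)
    then show "(\<lambda>w. cnj (f z w - G z w)) holomorphic_on disc"
      using hol2[OF z] by (simp add: holomorphic_on_diff)
  next
    fix t and z w :: complex assume zw: "z \<in> disc" "w \<in> disc"
    have "cis t * z * cnj (cis t * w) = z * cnj w * (cis t * cis (- t))"
      by (simp add: cis_cnj mult_ac)
    then have "cis t * z * cnj (cis t * w) = z * cnj w"
      by (simp add: cis_mult)
    then have "cis t ^ p * G (cis t * z) (cis t * w) = cis t ^ q * G z w"
      unfolding G_def by (cases "p = q") (simp_all only: if_True if_False refl mult_zero_right)
    then show "cis t ^ p * (f (cis t * z) (cis t * w) - G (cis t * z) (cis t * w))
        = cis t ^ q * (f z w - G z w)"
      using rot[OF zw, of t] by (simp add: right_diff_distrib)
  next
    fix z :: complex assume z: "z \<in> disc"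
    then have z1: "cmod z < 1" by simp
    have pos: "1 - (cmod z)\<^sup>2 > 0" using z1 by (simp add: abs_square_less_1)
    have fz: "f z z = of_real ((1 - (cmod z)\<^sup>2) powr (- (s + p))) * f 0 0
        * of_real ((1 - (cmod z)\<^sup>2) powr (- (s + q)))"
      using inv[OF translation_mem[OF z1, of 0] z z]
      by (simp add: act_to_zero deriv_pow_to_zero z1)
    have "G z z = f 0 0 * of_real ((1 - (cmod z)\<^sup>2) powr (- 2 * (s + real p)))" if "p = q"
    proof -
      have "1 - z * cnj z = of_real (1 - (cmod z)\<^sup>2)"
        by (simp only: of_real_diff complex_norm_square of_real_1)
      then show ?thesis
        using pos that unfolding G_def by (simp only: powr_of_real) (simp add: powr_of_real)
    qed
    note Gz = this
    have pw: "(1 - (cmod z)\<^sup>2) powr (- 2 * (s + real p))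
        = (1 - (cmod z)\<^sup>2) powr (- (s + p)) * (1 - (cmod z)\<^sup>2) powr (- (s + p))"
      by (simp add: powr_add[symmetric])
    show "f z z - G z z = 0"
    proof (cases "p = q")
      case True
      show ?thesis unfolding fz Gz[OF True] pw of_real_mult unfolding True by (simp only: mult_ac diff_self)
    next
      case False
      then show ?thesis using fz f0 by (simp add: G_def)
    qed
  qed (use zw in auto)
  then show ?thesis by (simp add: G_def)
qed

section \<open>The differential operators\<close>

definition lower :: "('n \<Rightarrow> nat) \<Rightarrow> complex^'n^'n \<Rightarrow> bool" where
  "lower b A \<longleftrightarrow> (\<forall>i k. A $ i $ k \<noteq> 0 \<longrightarrow> b k \<le> b i)"

text \<open>The entry at \<open>(i, k)\<close> is the coefficient of the derivative of order
  \<open>b i - b k\<close>. These orders add up along a chain of blocks, so the operators of lower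
  matrices compose as the matrices do, and a lower matrix inverse yields an operator
  inverse.\<close>

definition dop :: "('n \<Rightarrow> nat) \<Rightarrow> complex^'n^'n \<Rightarrow> (complex \<Rightarrow> complex^'n) \<Rightarrow> complex \<Rightarrow> complex^'n" where
  "dop b A f = (\<lambda>z. if z \<in> disc then (\<chi> i. \<Sum>k | b k \<le> b i.
       A $ i $ k * (deriv ^^ (b i - b k)) (\<lambda>u. f u $ k) z) else 0)"

definition gamma_matrix :: "('n \<Rightarrow> nat) \<Rightarrow> real \<Rightarrow> complex^'n^'n \<Rightarrow> complex^'n^'n" where
  "gamma_matrix b \<eta> Y = (\<chi> i k. if b k \<le> b i then
       1 / fact (b i - b k) * (1 / of_real (pochhammer (2 * \<eta> + 2 * real (b k)) (b i - b k)))
       * block_prod b Y (b k) (b i - b k) $ i $ k else 0)"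

lemma Gamma_eq_dop: "Gamma b \<eta> Y = dop b (gamma_matrix b \<eta> Y)"
  by (auto simp: Gamma_def dop_def gamma_matrix_def fun_eq_iff vec_eq_iff intro!: sum.cong)

lemma lower_gamma_matrix: "lower b (gamma_matrix b \<eta> Y)"
  by (auto simp: lower_def gamma_matrix_def split: if_splits)

lemma gamma_matrix_diag: "b i = b k \<Longrightarrow> gamma_matrix b \<eta> Y $ i $ k = (if i = k then 1 else 0)"
  by (simp add: gamma_matrix_def mat_def)

text \<open>The sum may run over all \<open>k\<close>: where the truncated difference
  \<open>b i - b k\<close> would be wrong, the coefficient is 0.\<close>

lemma dop_nth:
  assumes "lower b A" "z \<in> disc"
  shows "dop b A f z $ i = (\<Sum>k\<in>UNIV. A $ i $ k * (deriv ^^ (b i - b k)) (\<lambda>u. f u $ k) z)"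
  using assms unfolding dop_def lower_def
  by (simp del: mem_ball_0) (intro sum.mono_neutral_left, auto)

lemma higher_deriv_lincomb:
  assumes "\<And>k. k \<in> I \<Longrightarrow> h k holomorphic_on S" "open S" "z \<in> S"
  shows "(deriv ^^ n) (\<lambda>u. \<Sum>k\<in>I. a k * h k u) z = (\<Sum>k\<in>I. a k * (deriv ^^ n) (h k) z)"
  using assms(1)
proof (induction I rule: infinite_finite_induct)
  case (insert x I)
  have "(deriv ^^ n) (\<lambda>u. a x * h x u + (\<Sum>k\<in>I. a k * h k u)) z
      = (deriv ^^ n) (\<lambda>u. a x * h x u) z + (deriv ^^ n) (\<lambda>u. \<Sum>k\<in>I. a k * h k u) z"
    using insert.prems assms(2,3) by (intro higher_deriv_add holomorphic_intros) auto
  then show ?case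
    using insert assms(2,3) by (simp add: higher_deriv_cmult[of _ S])
qed (simp_all add: higher_deriv_const)

lemma dop_hol_sections:
  assumes "f \<in> hol_sections" shows "dop b A f \<in> hol_sections"
proof (rule hol_sectionsI)
  fix i
  have "(\<lambda>z. \<Sum>k | b k \<le> b i. A $ i $ k * (deriv ^^ (b i - b k)) (\<lambda>u. f u $ k) z) holomorphic_on disc"
    by (intro holomorphic_intros holomorphic_higher_deriv hol_sectionsD(1)[OF assms] open_ball)
  then show "(\<lambda>z. dop b A f z $ i) holomorphic_on disc"
    by (rule holomorphic_transform) (simp add: dop_def)
qed (simp add: dop_def)

lemma dop_add:
  assumes "f \<in> hol_sections" "g \<in> hol_sections" shows "dop b A (f + g) = dop b A f + dop b A g"
  using hol_sectionsD(1)[OF assms(1)] hol_sectionsD(1)[OF assms(2)]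
  by (auto simp: dop_def fun_eq_iff vec_eq_iff sum.distrib[symmetric] distrib_left
      higher_deriv_add[where S = disc] intro!: sum.cong)

lemma dop_cmult:
  assumes "f \<in> hol_sections" shows "dop b A (\<lambda>z. c *s f z) = (\<lambda>z. c *s dop b A f z)"
  using hol_sectionsD(1)[OF assms]
  by (auto simp: dop_def fun_eq_iff vec_eq_iff sum_distrib_left
      higher_deriv_cmult[where A = disc] mult_ac intro!: sum.cong)

lemma lower_mult: "lower b A \<Longrightarrow> lower b B \<Longrightarrow> lower b (A ** B)"
proof (unfold lower_def matrix_matrix_mult_def, intro allI impI)
  fix i k
  assume A: "\<forall>i k. A $ i $ k \<noteq> 0 \<longrightarrow> b k \<le> b i" and B: "\<forall>i k. B $ i $ k \<noteq> 0 \<longrightarrow> b k \<le> b i"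
    and nz: "(\<chi> i j. \<Sum>k\<in>UNIV. A $ i $ k * B $ k $ j) $ i $ k \<noteq> 0"
  then obtain l where "A $ i $ l * B $ l $ k \<noteq> 0"
    by (metis (mono_tags, lifting) sum.neutral vec_lambda_beta)
  then show "b k \<le> b i" using A B by (metis le_trans mult_eq_0_iff)
qed

lemma dop_dop:
  assumes A: "lower b A" and B: "lower b B" and f: "f \<in> hol_sections"
  shows "dop b A (dop b B f) = dop b (A ** B) f"
proof
  fix z
  show "dop b A (dop b B f) z = dop b (A ** B) f z"
  proof (cases "z \<in> disc")
    case z: True
    have "dop b A (dop b B f) z $ i = dop b (A ** B) f z $ i" for i
    proof -
      have 1: "(deriv ^^ n) (\<lambda>u. dop b B f u $ k) z
          = (\<Sum>l\<in>UNIV. B $ k $ l * (deriv ^^ (n + (b k - b l))) (\<lambda>u. f u $ l) z)" for k n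
      proof -
        have hl: "(deriv ^^ (b k - b l)) (\<lambda>u. f u $ l) holomorphic_on disc" for l
          by (intro holomorphic_higher_deriv hol_sectionsD(1)[OF f] open_ball)
        have "(deriv ^^ n) (\<lambda>u. dop b B f u $ k) z
          = (deriv ^^ n) (\<lambda>u. \<Sum>l\<in>UNIV. B $ k $ l * (deriv ^^ (b k - b l)) (\<lambda>u. f u $ l) u) z"
          by (rule higher_deriv_transform_within_open[OF _ _ open_ball z])
            (use hol_sectionsD(1)[OF dop_hol_sections[OF f]] dop_nth[OF B] in
              \<open>auto intro!: holomorphic_intros hl simp del: mem_ball_0\<close>)
        also have "\<dots> = (\<Sum>l\<in>UNIV. B $ k $ l * (deriv ^^ n) ((deriv ^^ (b k - b l)) (\<lambda>u. f u $ l)) z)"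
          by (rule higher_deriv_lincomb[OF hl open_ball z])
        finally show ?thesis by (simp add: funpow_add)
      qed
      have "dop b A (dop b B f) z $ i
        = (\<Sum>k\<in>UNIV. \<Sum>l\<in>UNIV. A $ i $ k * (B $ k $ l * (deriv ^^ (b i - b k + (b k - b l))) (\<lambda>u. f u $ l) z))"
        unfolding dop_nth[OF A z] 1 by (simp add: sum_distrib_left)
      \<comment> \<open>Subtraction is truncated, so the orders add up only for b l <= b k <= b i;
        otherwise one of the two coefficients is 0.\<close>
      also have "\<dots> = (\<Sum>k\<in>UNIV. \<Sum>l\<in>UNIV. A $ i $ k * B $ k $ l * (deriv ^^ (b i - b l)) (\<lambda>u. f u $ l) z)"
      proof (intro sum.cong refl)
        fix k l
        show "A $ i $ k * (B $ k $ l * (deriv ^^ (b i - b k + (b k - b l))) (\<lambda>u. f u $ l) z)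
          = A $ i $ k * B $ k $ l * (deriv ^^ (b i - b l)) (\<lambda>u. f u $ l) z"
          using A B unfolding lower_def
          by (cases "A $ i $ k = 0 \<or> B $ k $ l = 0") auto
      qed
      also have "\<dots> = (\<Sum>l\<in>UNIV. \<Sum>k\<in>UNIV. A $ i $ k * B $ k $ l * (deriv ^^ (b i - b l)) (\<lambda>u. f u $ l) z)"
        by (rule sum.swap)
      also have "\<dots> = dop b (A ** B) f z $ i"
        unfolding dop_nth[OF lower_mult[OF A B] z]
        by (simp add: matrix_matrix_mult_def sum_distrib_right)
      finally show ?thesis .
    qed
    then show ?thesis by (simp add: vec_eq_iff)
  qed (simp add: dop_def)
qed

lemma dop_mat_1:
  assumes "f \<in> hol_sections" shows "dop b (mat 1) f = f"
proof
  fix z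
  have l: "lower b (mat 1)" by (auto simp: lower_def mat_def)
  show "dop b (mat 1) f z = f z"
  proof (cases "z \<in> disc")
    case True
    have "(\<Sum>k\<in>UNIV. mat 1 $ i $ k * (deriv ^^ (b i - b k)) (\<lambda>u. f u $ k) z) = f z $ i" for i
      by (subst sum.mono_neutral_right[of UNIV "{i}"]) (auto simp: mat_def)
    then show ?thesis using dop_nth[OF l True] by (simp add: vec_eq_iff)
  next
    case False
    then show ?thesis using hol_sectionsD(2)[OF assms False] by (simp add: dop_def)
  qed
qed

section \<open>Inversion of block unitriangular matrices\<close>

text \<open>Forward substitution, stopped at block \<open>n\<close>. With \<open>n\<close> beyond
  the block of \<open>i\<close> it shows injectivity; applied to the columns of the inverse it shows
  that these vanish above their own block.\<close>

lemma lower_unitriangular_solve: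
  fixes A :: "complex^'n^'n"
  assumes A: "lower b A" "\<And>i k. b i = b k \<Longrightarrow> A $ i $ k = (if i = k then 1 else 0)"
    and y: "\<And>j. b j < n \<Longrightarrow> (A *v x) $ j = 0"
  shows "b i < n \<Longrightarrow> x $ i = 0"
proof (induction "b i" arbitrary: i rule: less_induct)
  case less
  have "(A *v x) $ i = (\<Sum>k\<in>UNIV. A $ i $ k * x $ k)" by (simp add: matrix_vector_mult_def)
  also have "\<dots> = (\<Sum>k\<in>{i}. A $ i $ k * x $ k)"
  proof (rule sum.mono_neutral_right)
    show "\<forall>k\<in>UNIV - {i}. A $ i $ k * x $ k = 0"
    proof
      fix k assume "k \<in> UNIV - {i}"
      consider "b k < b i" | "b k = b i" | "b k > b i" by linarith
      then show "A $ i $ k * x $ k = 0"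
      proof cases
        case 1
        then have "x $ k = 0" using less by simp
        then show ?thesis by simp
      next
        case 2
        then show ?thesis using A(2)[of i k] \<open>k \<in> UNIV - {i}\<close> by auto
      next
        case 3
        then show ?thesis using A(1) unfolding lower_def by fastforce
      qed
    qed
  qed auto
  also have "\<dots> = x $ i" using A(2)[of i i] by simp
  finally show ?case using y[OF less.prems] by simp
qed

lemma lower_unitriangular_inverse:
  fixes A :: "complex^'n^'n"
  assumes A: "lower b A" "\<And>i k. b i = b k \<Longrightarrow> A $ i $ k = (if i = k then 1 else 0)"
  obtains B where "lower b B" "A ** B = mat 1" "B ** A = mat 1"
    "\<And>i k. b i = b k \<Longrightarrow> B $ i $ k = (if i = k then 1 else 0)"
proof -
  have "x = 0" if "A *v x = 0" for x
  proof -
    have "x $ i = 0" for i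
      by (rule lower_unitriangular_solve[OF A, where n = "Suc (b i)"]) (use that in auto)
    then show ?thesis by (simp add: vec_eq_iff)
  qed
  then obtain B where BA: "B ** A = mat 1" using matrix_left_invertible_ker[of A] by blast
  then have AB: "A ** B = mat 1" by (simp add: matrix_left_right_inverse)
  have col: "A *v (B *v axis k 1) = axis k 1" for k
    by (simp add: matrix_vector_mul_assoc AB)
  have col0: "(A *v (B *v axis k 1)) $ j = 0" if "j \<noteq> k" for j k
    unfolding col using that by (simp add: axis_def)
  have lB: "lower b B"
    unfolding lower_def
  proof (intro allI impI)
    fix i k assume nz: "B $ i $ k \<noteq> 0"
    show "b k \<le> b i"
    proof (rule ccontr)
      assume nk: "\<not> b k \<le> b i"
      \<comment> \<open>Column \<open>k\<close> of \<open>B\<close> solves the system with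
        right-hand side the unit vector at \<open>k\<close>, which is zero in all blocks before
        \<open>b k\<close>.\<close>
      have "(B *v axis k 1) $ i = 0"
        by (rule lower_unitriangular_solve[OF A, where n = "b k"])
          (use nk in \<open>auto intro!: col0\<close>)
      then show False using nz by (simp add: matrix_vector_axis)
    qed
  qed
  have "B $ i $ k = (if i = k then 1 else 0)" if "b i = b k" for i k
  proof -
    have "(A ** B) $ i $ k = (\<Sum>l\<in>UNIV. A $ i $ l * B $ l $ k)"
      by (simp add: matrix_matrix_mult_def)
    also have "\<dots> = (\<Sum>l\<in>{i}. A $ i $ l * B $ l $ k)"
    proof (rule sum.mono_neutral_right)
      show "\<forall>l\<in>UNIV - {i}. A $ i $ l * B $ l $ k = 0"
      proof
        fix l assume l: "l \<in> UNIV - {i}"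
        show "A $ i $ l * B $ l $ k = 0"
        proof (cases "b l = b i")
          case True
          then show ?thesis using A(2)[of i l] l by auto
        next
          case False
          then show ?thesis using A(1) lB that unfolding lower_def by (metis mult_eq_0_iff order_antisym)
        qed
      qed
    qed auto
    finally show ?thesis using A(2)[of i i] by (simp add: AB mat_def)
  qed
  then show ?thesis using that lB AB BA by blast
qed

section \<open>Equivariance\<close>

text \<open>The square root of g'(z) is 1 / (c z + d), and differentiating (c z + d)^(- 2 s) brings
  down the factor - 2 s c and one more power. This is the source of the half-integer exponents and
  of the powers of \<open>- c_of g\<close> in \<open>elementary_mult\<close>.\<close>

lemma has_field_derivative_deriv_pow:
  assumes g: "g \<in> carrier mob_cover" and z: "z \<in> disc"
  shows "(deriv_pow g s has_field_derivative - (2 * s * c_of g * deriv_pow g (s + 1/2) z)) (at z)"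
proof -
  obtain t w where tw: "g = (t, w)" by (metis surj_pair)
  have w: "cmod w < 1" using g by (simp add: tw carrier_mob_cover)
  have p: "1 - (cmod w)\<^sup>2 > 0" using w by (simp add: abs_square_less_1)
  define r where "r = complex_of_real (sqrt (1 - (cmod w)\<^sup>2))"
  have r: "r \<noteq> 0" using p by (simp add: r_def)
  have np: "1 - z * cnj w \<notin> \<real>\<^sub>\<le>\<^sub>0" "1 - z * cnj w \<noteq> 0"
    using one_minus_mult_cnj_not_nonpos[OF z, of w] w by auto
  then have np': "1 - cnj w * z \<notin> \<real>\<^sub>\<le>\<^sub>0" "1 - cnj w * z \<noteq> 0" by (simp_all add: mult.commute)
  have half: "deriv_pow g (1/2) z = cis (t / 2) * r / (1 - cnj w * z)"
  proof -
    have "deriv_pow g (1/2) z = exp (\<i> * (t / 2) + of_real (ln (1 - (cmod w)\<^sup>2) / 2) - Ln (1 - cnj w * z))"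
      by (simp add: deriv_pow_def log_deriv_def tw diff_divide_distrib add_divide_distrib)
    also have "\<dots> = exp (\<i> * (t / 2)) * exp (of_real (ln (1 - (cmod w)\<^sup>2) / 2)) / (1 - cnj w * z)"
      using np' by (simp add: exp_diff exp_add)
    also have "exp (complex_of_real (ln (1 - (cmod w)\<^sup>2) / 2)) = r"
      unfolding exp_of_real r_def using p by (simp add: ln_sqrt[symmetric])
    finally show ?thesis by (simp add: cis_conv_exp)
  qed
  have "cis (- t / 2) * cis (t / 2) = 1" by (simp add: cis_mult)
  then have c: "c_of g * deriv_pow g (1/2) z = - (cnj w / (1 - cnj w * z))"
    unfolding half using r np' by (simp add: c_of_def tw r_def[symmetric] field_simps)
  have "((\<lambda>z. exp (s * (\<i> * t + ln (1 - (cmod w)\<^sup>2) - 2 * Ln (1 - cnj w * z))))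
      has_field_derivative exp (s * (\<i> * t + ln (1 - (cmod w)\<^sup>2) - 2 * Ln (1 - cnj w * z)))
        * (s * (2 * (cnj w / (1 - cnj w * z))))) (at z)"
    using np' by (auto intro!: derivative_eq_intros simp: field_simps)
  then have "(deriv_pow g s has_field_derivative
      deriv_pow g s z * (s * (2 * (- (c_of g * deriv_pow g (1/2) z))))) (at z)"
    unfolding c by (simp add: deriv_pow_def[abs_def] log_deriv_def tw)
  then show ?thesis
    unfolding deriv_pow_add by (simp add: mult_ac)
qed

lemma has_field_derivative_act:
  assumes g: "g \<in> carrier mob_cover" and z: "z \<in> disc"
  shows "(act g has_field_derivative deriv_pow g 1 z) (at z)"
proof -
  have "act g field_differentiable at z"
    using act_automorphism(1)[OF g] z holomorphic_on_imp_differentiable_at open_ball by blast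
  then show ?thesis
    using exp_log_deriv[OF g z] by (simp add: deriv_pow_def field_differentiable_derivI)
qed

lemma deriv_pow_holomorphic:
  assumes "g \<in> carrier mob_cover" shows "deriv_pow g s holomorphic_on disc"
  using has_field_derivative_deriv_pow[OF assms]
  by (meson field_differentiable_at_within field_differentiable_def holomorphic_on_def)

text \<open>
  Both sides are divided by a Pochhammer symbol; in this form the coefficients are those that
  occur in \<open>Gamma\<close> and in \<open>elementary_mult\<close>.
\<close>

lemma higher_deriv_act:
  assumes r: "r > 0" and f: "f holomorphic_on disc" and g: "g \<in> carrier mob_cover" and z: "z \<in> disc"
  shows "(deriv ^^ n) (\<lambda>z. deriv_pow g r z * f (act g z)) z / of_real (pochhammer (2 * r) n) =
    (\<Sum>i\<le>n. of_nat (n choose i) * (- c_of g) ^ (n - i) * deriv_pow g (r + real (n + i) / 2) z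
       * (deriv ^^ i) f (act g z) / of_real (pochhammer (2 * r) i))"
  using z
proof (induction n arbitrary: z)
  case 0
  then show ?case by simp
next
  case (Suc n)
  define c where "c = - c_of g"
  define P where "P i = complex_of_real (pochhammer (2 * r) i)" for i
  have P: "P i \<noteq> 0" for i using pochhammer_pos[of "2 * r" i] r by (simp add: P_def)
  have PS: "P (Suc i) = P i * (2 * r + i)" for i by (simp add: P_def pochhammer_Suc)
  have rn: "2 * complex_of_real r + of_nat i \<noteq> 0" for i
  proof -
    have "2 * r + real i > 0" using r by simp
    then have "complex_of_real (2 * r + real i) \<noteq> 0" by (simp only: of_real_eq_0_iff)
    then show ?thesis by simp
  qed
  define D where "D i = deriv_pow g (r + real (n + i) / 2)" for i
  define F where "F i = (deriv ^^ i) f" for i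
  define L where "L = (deriv ^^ n) (\<lambda>z. deriv_pow g r z * f (act g z))"
  define R where "R z = (\<Sum>i\<le>n. (of_nat (n choose i) * c ^ (n - i) / P i) * (D i z * F i (act g z)))" for z
  \<comment> \<open>The summand of index \<open>i\<close> in the claim for \<open>Suc n\<close>,
    without its binomial coefficient.\<close>
  define T where "T i = c ^ (Suc n - i) * deriv_pow g (r + real (Suc n + i) / 2) z * F i (act g z) / P i" for i
  have IH: "L z = P n * R z" if "z \<in> disc" for z
  proof -
    have "L z / P n = R z"
      using Suc.IH[OF that] by (simp add: L_def R_def P_def c_def D_def F_def mult_ac)
    then show ?thesis using P[of n] by (simp add: field_simps)
  qed
  have az: "act g z \<in> disc" by (rule act_in_disc[OF g Suc.prems])
  have F: "(F i has_field_derivative F (Suc i) u) (at u)" if "u \<in> disc" for i u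
    unfolding F_def using holomorphic_derivI[OF holomorphic_higher_deriv[OF f open_ball] open_ball that]
    by simp
  have term_deriv: "((\<lambda>z. D i z * F i (act g z)) has_field_derivative
      of_real (2 * r + n + i) * c * deriv_pow g (r + real (Suc n + i) / 2) z * F i (act g z)
      + deriv_pow g (r + real (Suc n + Suc i) / 2) z * F (Suc i) (act g z)) (at z)" for i
  proof -
    have 1: "(D i has_field_derivative of_real (2 * r + n + i) * c * deriv_pow g (r + real (Suc n + i) / 2) z) (at z)"
    proof -
      have e: "r + real (n + i) / 2 + 1 / 2 = r + real (Suc n + i) / 2" by (simp add: field_simps)
      have "- (2 * complex_of_real (r + real (n + i) / 2) * c_of g * x) = of_real (2 * r + n + i) * c * x" for x
        by (simp add: c_def field_simps)
      then show ?thesis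
        using has_field_derivative_deriv_pow[OF g Suc.prems, of "r + real (n + i) / 2"]
        unfolding D_def e by metis
    qed
    have 2: "((\<lambda>z. F i (act g z)) has_field_derivative F (Suc i) (act g z) * deriv_pow g 1 z) (at z)"
      by (rule DERIV_chain2[OF F[OF az] has_field_derivative_act[OF g Suc.prems]])
    have e2: "D i z * deriv_pow g 1 z = deriv_pow g (r + real (Suc n + Suc i) / 2) z"
    proof -
      have "r + real (Suc n + Suc i) / 2 = r + real (n + i) / 2 + 1" by (simp add: field_simps)
      then show ?thesis by (simp only: D_def deriv_pow_add)
    qed
    have e3: "F (Suc i) (act g z) * deriv_pow g 1 z * D i z
        = deriv_pow g (r + real (Suc n + Suc i) / 2) z * F (Suc i) (act g z)"
      unfolding e2[symmetric] by (simp only: mult_ac)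
    show ?thesis
      by (rule DERIV_cong[OF DERIV_mult[OF 1 2]]) (simp only: e3)
  qed
  have "(R has_field_derivative (\<Sum>i\<le>n. (of_nat (n choose i) * c ^ (n - i) / P i) *
     (of_real (2 * r + n + i) * c * deriv_pow g (r + real (Suc n + i) / 2) z * F i (act g z)
      + deriv_pow g (r + real (Suc n + Suc i) / 2) z * F (Suc i) (act g z)))) (at z)"
    unfolding R_def by (intro DERIV_sum DERIV_cmult term_deriv)
  also have "(\<Sum>i\<le>n. (of_nat (n choose i) * c ^ (n - i) / P i) *
     (of_real (2 * r + n + i) * c * deriv_pow g (r + real (Suc n + i) / 2) z * F i (act g z)
      + deriv_pow g (r + real (Suc n + Suc i) / 2) z * F (Suc i) (act g z)))
    = (\<Sum>i\<le>n. of_nat (n choose i) * (2 * r + n + i) * T i + of_nat (n choose i) * (2 * r + i) * T (Suc i))"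
  proof (intro sum.cong refl)
    fix i assume "i \<in> {..n}"
    then have i: "Suc n - i = Suc (n - i)" by auto
    show "(of_nat (n choose i) * c ^ (n - i) / P i) *
     (of_real (2 * r + n + i) * c * deriv_pow g (r + real (Suc n + i) / 2) z * F i (act g z)
      + deriv_pow g (r + real (Suc n + Suc i) / 2) z * F (Suc i) (act g z))
      = of_nat (n choose i) * (2 * r + n + i) * T i + of_nat (n choose i) * (2 * r + i) * T (Suc i)"
    proof -
      have ac: "(N * C / p) * (a * c * x * F1 + y * F2) = N * a * (c * C * x * F1 / p) + N * q * (C * y * F2 / (p * q))"
        if "p \<noteq> 0" "q \<noteq> 0" for N C p a x F1 y F2 q :: complex
        using that by (simp add: field_simps)
      show ?thesis
        unfolding T_def PS i diff_Suc_Suc power_Suc of_real_mult of_real_of_nat_eq by (rule ac) (use P[of i] rn[of i] in simp_all)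
    qed
  qed
  also have "\<dots> = (\<Sum>i\<le>n. of_nat (n choose i) * (2 * r + n + i) * T i)
      + (\<Sum>i\<le>n. of_nat (n choose i) * (2 * r + i) * T (Suc i))"
    by (rule sum.distrib)
  \<comment> \<open>The added summand vanishes because \<open>n choose Suc n = 0\<close>; after a
    shift of the index both sums contain \<open>T (Suc i)\<close>.\<close>
  also have "(\<Sum>i\<le>n. of_nat (n choose i) * (2 * r + n + i) * T i)
      = (\<Sum>i\<le>Suc n. of_nat (n choose i) * (2 * r + n + i) * T i)"
    by simp
  also have "\<dots> = (2 * r + n) * T 0 + (\<Sum>i\<le>n. of_nat (n choose Suc i) * (2 * r + n + Suc i) * T (Suc i))"
    by (subst sum.atMost_Suc_shift) simp
  also have "(2 * r + n) * T 0 + (\<Sum>i\<le>n. of_nat (n choose Suc i) * (2 * r + n + Suc i) * T (Suc i))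
      + (\<Sum>i\<le>n. of_nat (n choose i) * (2 * r + i) * T (Suc i))
      = (2 * r + n) * T 0 + (\<Sum>i\<le>n. (2 * r + n) * of_nat (Suc n choose Suc i) * T (Suc i))"
  proof -
    \<comment> \<open>Pascal's rule with weights: by (i + 1) C(n, i + 1) = (n - i) C(n, i) the terms
      beyond the common factor 2 r + n cancel. That factor is the quotient of consecutive Pochhammer
      symbols, absorbed on the left of the claim.\<close>
    have "of_nat (n choose Suc i) * (2 * r + n + Suc i) * T (Suc i)
        + of_nat (n choose i) * (2 * r + i) * T (Suc i)
        = (2 * r + n) * of_nat (Suc n choose Suc i) * T (Suc i)" if "i \<le> n" for i
    proof -
      have "(Suc i) * (n choose Suc i) = (n - i) * (n choose i)"
        using binomial_absorb_comp[of n i] binomial_absorption[of i n] by simp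
      then have "complex_of_nat (Suc i * (n choose Suc i)) = of_nat ((n - i) * (n choose i))" by simp
      then have *: "of_nat (Suc i) * complex_of_nat (n choose Suc i) = (of_nat n - of_nat i) * of_nat (n choose i)"
        using that by (simp only: of_nat_mult of_nat_diff)
      have "of_nat (n choose Suc i) * (2 * r + n + Suc i) + of_nat (n choose i) * (2 * r + i)
        = (of_nat (n choose Suc i) + of_nat (n choose i)) * (2 * r + n)
          + (of_nat (Suc i) * complex_of_nat (n choose Suc i) - (of_nat n - of_nat i) * of_nat (n choose i))"
        by (simp add: algebra_simps)
      also have "\<dots> = (2 * r + n) * of_nat (Suc n choose Suc i)"
        unfolding * by (simp add: algebra_simps)
      finally show ?thesis by (simp only: distrib_right[symmetric] of_real_add[symmetric])
    qed
    then have "(\<Sum>i\<le>n. of_nat (n choose Suc i) * (2 * r + n + Suc i) * T (Suc i))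
        + (\<Sum>i\<le>n. of_nat (n choose i) * (2 * r + i) * T (Suc i))
      = (\<Sum>i\<le>n. (2 * r + n) * of_nat (Suc n choose Suc i) * T (Suc i))"
      unfolding sum.distrib[symmetric] by (intro sum.cong refl) auto
    then show ?thesis by (simp only: add.assoc)
  qed
  also have "\<dots> = (2 * r + n) * (\<Sum>i\<le>Suc n. of_nat (Suc n choose i) * T i)"
    by (subst sum.atMost_Suc_shift) (simp add: distrib_left sum_distrib_left mult_ac)
  finally have RD: "(R has_field_derivative (2 * r + n) * (\<Sum>i\<le>Suc n. of_nat (Suc n choose i) * T i)) (at z)" .
  have "(L has_field_derivative P n * ((2 * r + n) * (\<Sum>i\<le>Suc n. of_nat (Suc n choose i) * T i))) (at z)"
    by (rule has_field_derivative_transform_within_open[OF DERIV_cmult[OF RD] open_ball Suc.prems])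
      (simp add: IH del: mem_ball_0)
  then have "deriv L z = P (Suc n) * (\<Sum>i\<le>Suc n. of_nat (Suc n choose i) * T i)"
    unfolding PS by (simp add: DERIV_imp_deriv mult.assoc)
  then have "deriv L z / P (Suc n) = (\<Sum>i\<le>Suc n. of_nat (Suc n choose i) * T i)"
    using P by simp
  then show ?case
    unfolding L_def T_def F_def P_def c_def by (simp only: funpow.simps o_def mult.assoc times_divide_eq_right)
qed

section \<open>Equivariance of \<open>Gamma\<close>\<close>

text \<open>Splits the product of the subdiagonal blocks at block \<open>l + n\<close>. A product of
  length 0 is the whole identity matrix and not a block projection, so the summation index is
  confined to its block explicitly.\<close>

lemma block_prod_trans:
  assumes "b k = l" "b i = l + n + m"
  shows "(\<Sum>j | b j = l + n. block_prod b Y (l + n) m $ i $ j * block_prod b Y l n $ j $ k)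
    = block_prod b Y l (n + m) $ i $ k"
  using assms(2)
proof (induction m arbitrary: i)
  case 0
  have "(\<Sum>j | b j = l + n. mat 1 $ i $ j * block_prod b Y l n $ j $ k)
    = (\<Sum>j\<in>{i}. mat 1 $ i $ j * block_prod b Y l n $ j $ k)"
    using 0 by (intro sum.mono_neutral_right) (auto simp: mat_def)
  then show ?case by (simp add: mat_def)
next
  case (Suc m)
  let ?B = "block b (l + n + m + 1) (l + n + m) Y"
  have "(\<Sum>j | b j = l + n. block_prod b Y (l + n) (Suc m) $ i $ j * block_prod b Y l n $ j $ k)
    = (\<Sum>j | b j = l + n. \<Sum>r\<in>UNIV. ?B $ i $ r * (block_prod b Y (l + n) m $ r $ j * block_prod b Y l n $ j $ k))"
    by (simp add: matrix_matrix_mult_def sum_distrib_right mult.assoc)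
  also have "\<dots> = (\<Sum>r\<in>UNIV. ?B $ i $ r * (\<Sum>j | b j = l + n. block_prod b Y (l + n) m $ r $ j * block_prod b Y l n $ j $ k))"
    by (subst sum.swap) (simp add: sum_distrib_left)
  also have "\<dots> = (\<Sum>r\<in>UNIV. ?B $ i $ r * block_prod b Y l (n + m) $ r $ k)"
  proof (intro sum.cong refl)
    fix r
    show "?B $ i $ r * (\<Sum>j | b j = l + n. block_prod b Y (l + n) m $ r $ j * block_prod b Y l n $ j $ k)
        = ?B $ i $ r * block_prod b Y l (n + m) $ r $ k"
    \<comment> \<open>Outside this block the induction hypothesis is silent, but the new left factor
      has no entry there.\<close>
    proof (cases "b r = l + n + m")
      case True
      then show ?thesis using Suc.IH[of r] by simp
    next
      case False
      then show ?thesis by (simp add: block_def)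
    qed
  qed
  also have "\<dots> = block_prod b Y l (n + Suc m) $ i $ k"
    by (simp add: matrix_matrix_mult_def add.assoc)
  finally show ?case .
qed

text \<open>The multiplier under which the group acts on the direct sum of the weighted Bergman
  spaces.\<close>

definition diagonal_mult :: "('n \<Rightarrow> nat) \<Rightarrow> real \<Rightarrow> mob \<Rightarrow> complex \<Rightarrow> complex^'n^'n" where
  "diagonal_mult b \<eta> g z = (\<chi> i k. if i = k then deriv_pow g (\<eta> + real (b i)) z else 0)"

lemma diagonal_mult_vec: "(diagonal_mult b \<eta> g z *v x) $ i = deriv_pow g (\<eta> + real (b i)) z * x $ i"
  by (simp add: diagonal_mult_def matrix_vector_mult_def if_distrib if_distribR cong: if_cong)

text \<open>The action of the inverse element, which keeps inverses out of the calculations with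
  derivatives.\<close>

definition pullback :: "(mob \<Rightarrow> complex \<Rightarrow> complex^'n^'n) \<Rightarrow> mob \<Rightarrow> (complex \<Rightarrow> complex^'n) \<Rightarrow> complex \<Rightarrow> complex^'n" where
  "pullback J g f = (\<lambda>z. if z \<in> disc then J g z *v f (act g z) else 0)"

lemma section_action_eq: "section_action J g = pullback J (inv\<^bsub>mob_cover\<^esub> g)"
  by (simp add: section_action_def pullback_def fun_eq_iff)

lemma pullback_diagonal_hol:
  assumes g: "g \<in> carrier mob_cover" and f: "f \<in> hol_sections"
  shows "pullback (diagonal_mult b \<eta>) g f \<in> hol_sections"
proof (rule hol_sectionsI)
  fix i
  have "((\<lambda>z. f z $ i) \<circ> act g) holomorphic_on disc"
    by (rule holomorphic_on_compose_gen[OF act_automorphism(1)[OF g] hol_sectionsD(1)[OF f]])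
      (use act_in_disc[OF g] in blast)
  then have "(\<lambda>z. deriv_pow g (\<eta> + real (b i)) z * f (act g z) $ i) holomorphic_on disc"
    by (intro holomorphic_intros deriv_pow_holomorphic[OF g]) (simp add: o_def)
  then show "(\<lambda>z. pullback (diagonal_mult b \<eta>) g f z $ i) holomorphic_on disc"
    by (rule holomorphic_transform) (simp add: pullback_def diagonal_mult_vec)
qed (simp add: pullback_def)

text \<open>Both sides become sums over a component \<open>k\<close> of \<open>f\<close> and the
  number \<open>j\<close> of derivatives that fall on it: the left one by
  \<open>higher_deriv_act\<close>, the right one by merging two block products. The remaining
  coefficients agree because C(n, j) / n! = 1 / ((n - j)! j!).\<close>

theorem Gamma_equivariant:
  assumes \<eta>: "\<eta> > 0" and g: "g \<in> carrier mob_cover" and f: "f \<in> hol_sections"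
  shows "Gamma b \<eta> Y (pullback (diagonal_mult b \<eta>) g f) = pullback (elementary_mult b \<eta> Y) g (Gamma b \<eta> Y f)"
proof
  fix z
  show "Gamma b \<eta> Y (pullback (diagonal_mult b \<eta>) g f) z = pullback (elementary_mult b \<eta> Y) g (Gamma b \<eta> Y f) z"
  proof (cases "z \<in> disc")
    case z: True
    define a where "a = act g z"
    have a: "a \<in> disc" unfolding a_def by (rule act_in_disc[OF g z])
    define F where "F k i = (deriv ^^ i) (\<lambda>u. f u $ k) a" for k i
    define P where "P k i = complex_of_real (pochhammer (2 * (\<eta> + real (b k))) i)" for k i
    have P2: "complex_of_real (pochhammer (2 * \<eta> + 2 * real (b k)) i) = P k i" for k i
      by (simp add: P_def distrib_left)
    define B where "B i k = block_prod b Y (b k) (b i - b k) $ i $ k" for i k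
    define c where "c = - c_of g"
    have lhs: "Gamma b \<eta> Y (pullback (diagonal_mult b \<eta>) g f) z $ i
      = (\<Sum>k | b k \<le> b i. \<Sum>j\<le>b i - b k. 1 / fact (b i - b k) * B i k *
          (of_nat ((b i - b k) choose j) * c ^ (b i - b k - j)
           * deriv_pow g (\<eta> + real (b k) + real (b i - b k + j) / 2) z * F k j / P k j))" for i
    proof -
      have 1: "(deriv ^^ n) (\<lambda>u. pullback (diagonal_mult b \<eta>) g f u $ k) z
        = (deriv ^^ n) (\<lambda>u. deriv_pow g (\<eta> + real (b k)) u * f (act g u) $ k) z" for k n
      proof (rule higher_deriv_transform_within_open[OF _ _ open_ball z])
        show h: "(\<lambda>u. pullback (diagonal_mult b \<eta>) g f u $ k) holomorphic_on disc"
          by (rule hol_sectionsD(1)[OF pullback_diagonal_hol[OF g f]])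
        show eq: "pullback (diagonal_mult b \<eta>) g f u $ k = deriv_pow g (\<eta> + real (b k)) u * f (act g u) $ k"
          if "u \<in> disc" for u using that by (simp add: pullback_def diagonal_mult_vec)
        show "(\<lambda>u. deriv_pow g (\<eta> + real (b k)) u * f (act g u) $ k) holomorphic_on disc"
          using h by (rule holomorphic_transform) (rule eq)
      qed
      have "(1 / P k n) * (deriv ^^ n) (\<lambda>u. pullback (diagonal_mult b \<eta>) g f u $ k) z
        = (\<Sum>j\<le>n. of_nat (n choose j) * c ^ (n - j)
           * deriv_pow g (\<eta> + real (b k) + real (n + j) / 2) z * F k j / P k j)" for k n
        using higher_deriv_act[OF _ hol_sectionsD(1)[OF f, of k] g z, of "\<eta> + real (b k)" n] \<eta>
        by (simp add: 1 P_def F_def c_def a_def)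
      note 0 = this
      have 2: "1 / fact (b i - b k) * (1 / P k (b i - b k)) * B i k *
          (deriv ^^ (b i - b k)) (\<lambda>u. pullback (diagonal_mult b \<eta>) g f u $ k) z
        = 1 / fact (b i - b k) * B i k * (\<Sum>j\<le>b i - b k. of_nat ((b i - b k) choose j) * c ^ (b i - b k - j)
           * deriv_pow g (\<eta> + real (b k) + real (b i - b k + j) / 2) z * F k j / P k j)" for k
        unfolding 0[of k "b i - b k", symmetric] by (simp only: mult_ac)
      show ?thesis
        unfolding Gamma_def if_P[OF z] vec_lambda_beta P2 B_def[symmetric] 2
        by (simp add: sum_distrib_left)
    qed
    have rhs: "pullback (elementary_mult b \<eta> Y) g (Gamma b \<eta> Y f) z $ i
      = (\<Sum>k | b k \<le> b i. \<Sum>j\<le>b i - b k.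
          1 / fact (b i - b k - j) * c ^ (b i - b k - j) * deriv_pow g (\<eta> + real (b i + (b k + j)) / 2) z
          * (1 / fact j * (1 / P k j)) * F k j * B i k)" for i
    proof -
      define E where "E l = 1 / fact (b i - b l) * c ^ (b i - b l) * deriv_pow g (\<eta> + real (b i + b l) / 2) z" for l
      have "pullback (elementary_mult b \<eta> Y) g (Gamma b \<eta> Y f) z $ i
        = (\<Sum>l\<in>UNIV. (if b l \<le> b i then E l * B i l else 0) *
            (\<Sum>k | b k \<le> b l. 1 / fact (b l - b k) * (1 / P k (b l - b k)) * B l k * F k (b l - b k)))"
        using z a by (simp add: pullback_def matrix_vector_mult_def elementary_mult_def Gamma_def P2
            B_def E_def F_def c_def a_def[symmetric] cong: if_cong)
      also have "\<dots> = (\<Sum>l | b l \<le> b i. \<Sum>k | b k \<le> b l. E l * B i l *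
            (1 / fact (b l - b k) * (1 / P k (b l - b k)) * B l k * F k (b l - b k)))"
        by (rule sum.mono_neutral_cong_right) (auto simp: sum_distrib_left mult.assoc)
      also have "\<dots> = (\<Sum>(l, k) | b l \<le> b i \<and> b k \<le> b l. E l * B i l *
            (1 / fact (b l - b k) * (1 / P k (b l - b k)) * B l k * F k (b l - b k)))"
        by (subst sum.Sigma) (auto intro!: sum.cong)
      \<comment> \<open>The intermediate index \<open>l\<close> is sorted by
        \<open>j = b l - b k\<close>, the order of the derivative contributed by
        \<open>Gamma\<close>.\<close>
      also have "\<dots> = (\<Sum>(k, j, l) | b k \<le> b i \<and> j \<le> b i - b k \<and> b l = b k + j. E l * B i l *
            (1 / fact j * (1 / P k j) * B l k * F k j))"
        by (rule sum.reindex_bij_witness[of _ "\<lambda>(k, j, l). (l, k)" "\<lambda>(l, k). (k, b l - b k, l)"]) auto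
      also have "\<dots> = (\<Sum>k | b k \<le> b i. \<Sum>j\<le>b i - b k. \<Sum>l | b l = b k + j. E l * B i l *
            (1 / fact j * (1 / P k j) * B l k * F k j))"
      proof -
        have "{(k, j, l). b k \<le> b i \<and> j \<le> b i - b k \<and> b l = b k + j}
          = (SIGMA k:{k. b k \<le> b i}. SIGMA j:{..b i - b k}. {l. b l = b k + j})" by auto
        then show ?thesis by (simp add: sum.Sigma)
      qed
      also have "\<dots> = (\<Sum>k | b k \<le> b i. \<Sum>j\<le>b i - b k.
          1 / fact (b i - b k - j) * c ^ (b i - b k - j) * deriv_pow g (\<eta> + real (b i + (b k + j)) / 2) z
          * (1 / fact j * (1 / P k j)) * F k j * B i k)"
      proof (intro sum.cong refl)
        fix k j assume kj: "k \<in> {k. b k \<le> b i}" "j \<in> {..b i - b k}"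
        define e where "e = 1 / fact (b i - b k - j) * c ^ (b i - b k - j) * deriv_pow g (\<eta> + real (b i + (b k + j)) / 2) z
          * (1 / fact j * (1 / P k j)) * F k j"
        \<comment> \<open>Apart from the two block products all factors depend on \<open>l\<close>
          only through its block number, which is fixed.\<close>
        have "(\<Sum>l | b l = b k + j. E l * B i l * (1 / fact j * (1 / P k j) * B l k * F k j))
          = (\<Sum>l | b l = b k + j. e * (block_prod b Y (b k + j) (b i - b k - j) $ i $ l * block_prod b Y (b k) j $ l $ k))"
          by (intro sum.cong refl) (auto simp: E_def e_def B_def)
        also have "\<dots> = e * B i k"
          using block_prod_trans[of b k "b k" i j "b i - b k - j" Y] kj
          by (simp add: sum_distrib_left[symmetric] B_def)
        finally show "(\<Sum>l | b l = b k + j. E l * B i l * (1 / fact j * (1 / P k j) * B l k * F k j))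
          = 1 / fact (b i - b k - j) * c ^ (b i - b k - j) * deriv_pow g (\<eta> + real (b i + (b k + j)) / 2) z
          * (1 / fact j * (1 / P k j)) * F k j * B i k" by (simp add: e_def)
      qed
      finally show ?thesis .
    qed
    have "Gamma b \<eta> Y (pullback (diagonal_mult b \<eta>) g f) z $ i = pullback (elementary_mult b \<eta> Y) g (Gamma b \<eta> Y f) z $ i" for i
      unfolding lhs rhs
    proof (intro sum.cong refl)
      fix k j assume "k \<in> {k. b k \<le> b i}" "j \<in> {..b i - b k}"
      then have kj: "b k \<le> b i" "j \<le> b i - b k" by auto
      have e: "\<eta> + real (b k) + real (b i - b k + j) / 2 = \<eta> + real (b i + (b k + j)) / 2"
        using kj by (simp add: field_simps)
      have ac: "x * B' * (y * C * D * F' / P') = p * C * D * (q * (1 / P')) * F' * B'" if "x * y = p * q"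
        for x y p q B' C D F' P' :: complex
      proof -
        have "x * B' * (y * C * D * F' / P') = (x * y) * (B' * C * D * F' / P')"
          by (simp only: times_divide_eq_right mult_ac)
        then show ?thesis unfolding that by (simp add: mult_ac)
      qed
      have "1 / fact (b i - b k) * complex_of_nat ((b i - b k) choose j) = 1 / fact (b i - b k - j) * (1 / fact j)"
        using kj by (simp add: binomial_fact)
      then show "1 / fact (b i - b k) * B i k *
          (of_nat ((b i - b k) choose j) * c ^ (b i - b k - j)
           * deriv_pow g (\<eta> + real (b k) + real (b i - b k + j) / 2) z * F k j / P k j)
        = 1 / fact (b i - b k - j) * c ^ (b i - b k - j) * deriv_pow g (\<eta> + real (b i + (b k + j)) / 2) z
          * (1 / fact j * (1 / P k j)) * F k j * B i k"
        unfolding e by (rule ac)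
    qed
    then show ?thesis by (simp add: vec_eq_iff)
  qed (simp add: Gamma_def pullback_def)
qed

section \<open>Block matrices\<close>

lemma block_diagonal_mult:
  assumes "block_diagonal b A" "block_diagonal b B" shows "block_diagonal b (A ** B)"
  unfolding block_diagonal_def matrix_matrix_mult_def
proof (intro allI impI)
  fix i k assume "(\<chi> i j. \<Sum>k\<in>UNIV. A $ i $ k * B $ k $ j) $ i $ k \<noteq> 0"
  then obtain l where "A $ i $ l * B $ l $ k \<noteq> 0"
    by (metis (mono_tags, lifting) sum.neutral vec_lambda_beta)
  then show "b i = b k" using assms unfolding block_diagonal_def by (metis mult_eq_0_iff)
qed

text \<open>Being block diagonal means commuting with the diagonal matrix of block numbers, and
  commutation passes to the inverse.\<close>

lemma block_diagonal_matrix_inv: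
  fixes A :: "complex^'n^'n"
  assumes A: "block_diagonal b A" "invertible A" shows "block_diagonal b (matrix_inv A)"
proof -
  define \<Delta> :: "complex^'n^'n" where "\<Delta> = (\<chi> i k. if i = k then of_nat (b i) else 0)"
  have L: "(M ** \<Delta>) $ i $ k = M $ i $ k * of_nat (b k)" and R: "(\<Delta> ** M) $ i $ k = of_nat (b i) * M $ i $ k"
    for M :: "complex^'n^'n" and i k
    by (simp_all add: matrix_matrix_mult_def \<Delta>_def if_distrib if_distribR cong: if_cong)
  have "A ** \<Delta> = \<Delta> ** A"
    using A(1) unfolding block_diagonal_def vec_eq_iff L R by (metis mult.commute mult_zero_right)
  then have "matrix_inv A ** (A ** \<Delta>) ** matrix_inv A = matrix_inv A ** (\<Delta> ** A) ** matrix_inv A"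
    by simp
  moreover have "matrix_inv A ** (A ** \<Delta>) ** matrix_inv A = \<Delta> ** matrix_inv A"
    by (simp add: matrix_mul_assoc matrix_inv_left'[OF A(2)])
  moreover have "matrix_inv A ** (\<Delta> ** A) ** matrix_inv A = matrix_inv A ** \<Delta>"
    by (simp add: matrix_mul_assoc[symmetric] matrix_inv_right'[OF A(2)])
  ultimately have "\<Delta> ** matrix_inv A = matrix_inv A ** \<Delta>" by simp
  then have "of_nat (b i) * matrix_inv A $ i $ k = matrix_inv A $ i $ k * of_nat (b k)" for i k
    using L R by metis
  then have "(of_nat (b i) - of_nat (b k)) * matrix_inv A $ i $ k = 0" for i k
    by (simp add: left_diff_distrib mult.commute)
  then show ?thesis unfolding block_diagonal_def by auto
qed

text \<open>
  Gram-Schmidt for the form given by the matrix; the vectors stay inside the blocks, because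
  vectors supported in different blocks are already orthogonal.
\<close>

lemma block_diagonal_orthonormal_basis:
  fixes B :: "complex^'n^'n"
  assumes B: "pos_def B" "block_diagonal b B" and S: "finite S"
  shows "\<exists>q. \<forall>i\<in>S. (\<forall>k. q i $ k \<noteq> 0 \<longrightarrow> k \<in> S \<and> b k = b i) \<and>
    (\<forall>j\<in>S. cdot (B *v q i) (q j) = (if i = j then 1 else 0))"
  using S
proof (induction S rule: finite_induct)
  case (insert s S)
  define \<beta> where "\<beta> x y = cdot (B *v x) y" for x y
  have add: "\<beta> (x + y) z = \<beta> x z + \<beta> y z" and scale: "\<beta> (c *s x) z = c * \<beta> x z" for x y z c
    by (simp_all add: \<beta>_def matrix_vector_right_distrib cdot_add_left vector_scalar_commute cdot_scale_left)
  have sym: "\<beta> y x = cnj (\<beta> x y)" for x y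
  proof -
    have "madj B = B" using B(1) by (simp add: pos_def_def)
    then show ?thesis unfolding \<beta>_def cdot_matrix_left[of B y x] by (simp only: cdot_commute[of y])
  qed
  have scale_right: "\<beta> x (c *s y) = cnj c * \<beta> x y" for x y c
    by (metis complex_cnj_mult scale sym)
  have diff: "\<beta> (x - y) z = \<beta> x z - \<beta> y z" for x y z
    using add[of "x - y" y z] by simp
  have sum: "\<beta> (\<Sum>j\<in>I. h j) z = (\<Sum>j\<in>I. \<beta> (h j) z)" if "finite I" for I :: "'n set" and h z
    using that by (induction I rule: finite_induct) (simp_all add: add, simp add: \<beta>_def cdot_zero_left)
  obtain q where q: "\<And>i k. i \<in> S \<Longrightarrow> q i $ k \<noteq> 0 \<Longrightarrow> k \<in> S \<and> b k = b i"
    "\<And>i j. i \<in> S \<Longrightarrow> j \<in> S \<Longrightarrow> \<beta> (q i) (q j) = (if i = j then 1 else 0)"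
    using insert.IH unfolding \<beta>_def by blast
  define e :: "complex^'n" where "e = axis s 1"
  \<comment> \<open>The remainder of the new unit vector after its components along the earlier
    vectors are removed.\<close>
  define p where "p = e - (\<Sum>j\<in>S. \<beta> e (q j) *s q j)"
  have p_nth: "p $ k = (if k = s then 1 else 0) - (\<Sum>j\<in>S. \<beta> e (q j) * q j $ k)" for k
    by (simp add: p_def e_def axis_def)
  have ortho: "\<beta> p (q k) = 0" if k: "k \<in> S" for k
  proof -
    have "\<beta> p (q k) = \<beta> e (q k) - (\<Sum>j\<in>S. \<beta> e (q j) * \<beta> (q j) (q k))"
      unfolding p_def diff sum[OF insert.hyps(1)] scale ..
    also have "(\<Sum>j\<in>S. \<beta> e (q j) * \<beta> (q j) (q k)) = (\<Sum>j\<in>{k}. \<beta> e (q j) * \<beta> (q j) (q k))"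
      using k insert.hyps(1) q(2) by (intro sum.mono_neutral_right) auto
    also have "\<dots> = \<beta> e (q k)" using q(2)[OF k k] by simp
    finally show ?thesis by simp
  qed
  \<comment> \<open>The earlier vectors are supported in \<open>S\<close>, so they do not touch
    coordinate \<open>s\<close>; this shows \<open>p \<noteq> 0\<close>.\<close>
  have ps: "p $ s = 1"
  proof -
    have "q j $ s = 0" if "j \<in> S" for j using q(1)[OF that, of s] insert.hyps(2) by blast
    then show ?thesis by (simp add: p_nth)
  qed
  then have "p \<noteq> 0" by auto
  then have pos: "Re (\<beta> p p) > 0" using B(1) by (simp add: pos_def_def \<beta>_def)
  define c where "c = complex_of_real (1 / sqrt (Re (\<beta> p p)))"
  have real: "\<beta> p p = of_real (Re (\<beta> p p))" using sym[of p p] by (simp add: complex_eq_iff)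
  have c1: "c * cnj c * \<beta> p p = 1"
  proof -
    have "c * cnj c = of_real (1 / Re (\<beta> p p))"
      using pos by (simp add: c_def of_real_mult[symmetric] del: of_real_mult of_real_divide)
    then show ?thesis using pos by (subst real) (simp del: of_real_divide add: of_real_mult[symmetric])
  qed
  \<comment> \<open>A component along \<open>q j\<close> can be nonzero only if \<open>B\<close>
    links the support of \<open>q j\<close> to \<open>s\<close>, which forces the same
    block.\<close>
  have supp: "k \<in> insert s S \<and> b k = b s" if k: "p $ k \<noteq> 0" for k
  proof (cases "k = s")
    case False
    then have "(\<Sum>j\<in>S. \<beta> e (q j) * q j $ k) \<noteq> 0" using k by (simp add: p_nth)
    then obtain j where j: "j \<in> S" "\<beta> e (q j) \<noteq> 0" "q j $ k \<noteq> 0"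
      by (metis (mono_tags, lifting) mult_eq_0_iff sum.neutral)
    from j(2) obtain i where "(B *v e) $ i * cnj (q j $ i) \<noteq> 0"
      unfolding \<beta>_def cdot_def by (metis (mono_tags, lifting) sum.neutral)
    then have "B $ i $ s \<noteq> 0" "q j $ i \<noteq> 0" by (auto simp: e_def matrix_vector_axis)
    then have "b j = b s" using B(2) q(1)[OF j(1)] unfolding block_diagonal_def by metis
    then show ?thesis using q(1)[OF j(1,3)] by simp
  qed simp
  define q' where "q' = q(s := c *s p)"
  have "\<beta> (c *s p) (c *s p) = 1" using c1 unfolding scale scale_right by (simp only: mult_ac)
  moreover have "\<beta> (c *s p) (q j) = 0" "\<beta> (q j) (c *s p) = 0" if "j \<in> S" for j
    using ortho[OF that] sym[of p "q j"] unfolding scale scale_right by simp_all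
  ultimately have "\<beta> (q' i) (q' j) = (if i = j then 1 else 0)"
    if "i \<in> insert s S" "j \<in> insert s S" for i j
    using that insert.hyps(2) q(2) unfolding q'_def by auto
  moreover have "k \<in> insert s S \<and> b k = b i" if "i \<in> insert s S" "q' i $ k \<noteq> 0" for i k
    using that insert.hyps(2) q(1) supp by (auto simp: q'_def split: if_splits)
  ultimately show ?case unfolding \<beta>_def by blast
qed simp

text \<open>If the columns of \<open>Q\<close> are orthonormal for \<open>B\<close>, then
  \<open>madj Q ** B\<close> is the inverse of \<open>Q\<close>, hence B Q Q* B = B and
  \<open>N = B ** Q\<close> works without a matrix square root.\<close>

lemma pos_def_block_factorization:
  fixes B :: "complex^'n^'n"
  assumes B: "pos_def B" "block_diagonal b B"
  obtains N where "block_diagonal b N" "invertible N" "N ** madj N = B"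
proof -
  obtain q where q: "\<And>i k. q i $ k \<noteq> 0 \<Longrightarrow> b k = b i"
    "\<And>i j. cdot (B *v q i) (q j) = (if i = j then 1 else 0)"
    using block_diagonal_orthonormal_basis[OF B, of UNIV] by auto
  define Q where "Q = (\<chi> i k. q k $ i)"
  have Qa: "Q *v axis k 1 = q k" for k
    by (simp add: vec_eq_iff matrix_vector_axis Q_def)
  have one: "madj Q ** (B ** Q) = mat 1"
  proof -
    have "(madj Q ** (B ** Q)) $ i $ j = mat 1 $ i $ j" for i j
    proof -
      have "(madj Q ** (B ** Q)) $ i $ j = cdot ((madj Q ** (B ** Q)) *v axis j 1) (axis i 1)"
        by (simp add: cdot_axis_right matrix_vector_axis)
      also have "\<dots> = cdot (B *v q j) (q i)"
        by (simp add: matrix_vector_mul_assoc[symmetric] cdot_matrix_left madj_madj Qa)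
      finally show ?thesis by (simp add: q(2) mat_def)
    qed
    then show ?thesis by (simp add: vec_eq_iff)
  qed
  have "(madj Q ** B) ** Q = mat 1"
    using one by (simp only: matrix_mul_assoc)
  then have "Q ** (madj Q ** B) = mat 1"
    by (rule matrix_left_right_inverse[THEN iffD1])
  then have "B ** (Q ** (madj Q ** B)) = B" by simp
  moreover have "madj B = B" using B(1) by (simp add: pos_def_def)
  ultimately have "(B ** Q) ** madj (B ** Q) = B"
    by (simp add: madj_mult matrix_mul_assoc)
  moreover have "block_diagonal b (B ** Q)"
    by (rule block_diagonal_mult[OF B(2)]) (auto simp: block_diagonal_def Q_def dest: q(1))
  ultimately show ?thesis using that invertible_I(2)[OF one] by blast
qed

section \<open>Shift-invariant spaces\<close>

text \<open>Leibniz' rule: of the derivatives of the identity only the first is nonzero at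
  0.\<close>

lemma higher_deriv_times_id_0:
  assumes f: "f holomorphic_on disc"
  shows "(deriv ^^ Suc n) (\<lambda>z. z * f z) 0 = of_nat (Suc n) * (deriv ^^ n) f 0"
proof -
  have "(deriv ^^ Suc n) (\<lambda>z. z * f z) 0
    = (\<Sum>i = 0..Suc n. of_nat (Suc n choose i) * (deriv ^^ i) (\<lambda>z. z) 0 * (deriv ^^ (Suc n - i)) f 0)"
    by (rule higher_deriv_mult[OF _ f open_ball]) (auto intro!: holomorphic_intros)
  also have "\<dots> = (\<Sum>i\<in>{1}. of_nat (Suc n choose i) * (deriv ^^ i) (\<lambda>z. z) 0 * (deriv ^^ (Suc n - i)) f 0)"
    by (rule sum.mono_neutral_right) (auto simp del: funpow.simps)
  finally show ?thesis by simp
qed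

lemma higher_deriv_times_power_0:
  assumes f: "f holomorphic_on disc" and a: "a \<le> n"
  shows "(deriv ^^ a) (\<lambda>z. z ^ n * f z) 0 = (if a = n then fact n * f 0 else 0)"
  using a
proof (induction n arbitrary: a)
  case (Suc n)
  show ?case
  proof (cases a)
    case (Suc a')
    have "(\<lambda>z. z ^ n * f z) holomorphic_on disc" using f by (intro holomorphic_intros)
    then have "(deriv ^^ Suc a') (\<lambda>z. z * (z ^ n * f z)) 0
        = of_nat (Suc a') * (deriv ^^ a') (\<lambda>z. z ^ n * f z) 0"
      by (rule higher_deriv_times_id_0)
    then show ?thesis
      using Suc.IH[of a'] Suc.prems Suc by (simp add: mult.assoc)
  qed simp
qed simp

context rkhs
begin

lemma eval_surj:
  assumes "z \<in> disc" "invertible (K z z)" obtains f where "f \<in> H" "f z = y"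
proof
  show "ksec z (matrix_inv (K z z) *v y) \<in> H" by (rule ksec_mem[OF assms(1)])
  show "ksec z (matrix_inv (K z z) *v y) z = y"
    using assms by (simp add: ksec_def matrix_vector_mul_assoc matrix_inv_right')
qed

lemma shift_power:
  assumes "shift_invariant H" "f \<in> H" shows "(\<lambda>z. z ^ n *s f z) \<in> H"
proof (induction n)
  case 0
  then show ?case using assms(2) by simp
next
  case (Suc n)
  then have "(\<lambda>z. z *s (z ^ n *s f z)) \<in> H" by (rule assms(1)[unfolded shift_invariant_def, THEN bspec])
  then show ?case by simp
qed

text \<open>A derivative of order m + 1 is removed by subtracting z^(m + 1) f with a suitable value
  \<open>f 0\<close>; lower jets are not affected. At such sections a differential operator sees
  only its terms of order 0, up to order \<open>m\<close>.\<close>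

lemma jets:
  assumes sh: "shift_invariant H" and inv: "invertible (K 0 0)"
  shows "\<exists>h\<in>H. h 0 = y \<and> (\<forall>a k. 1 \<le> a \<longrightarrow> a \<le> m \<longrightarrow> (deriv ^^ a) (\<lambda>z. h z $ k) 0 = 0)"
proof (induction m)
  case 0
  have "0 \<in> disc" by simp
  then obtain f where "f \<in> H" "f 0 = y" using eval_surj[OF _ inv] by metis
  then show ?case by (intro bexI[of _ f]) auto
next
  case (Suc m)
  then obtain h where h: "h \<in> H" "h 0 = y" "\<And>a k. 1 \<le> a \<Longrightarrow> a \<le> m \<Longrightarrow> (deriv ^^ a) (\<lambda>z. h z $ k) 0 = 0"
    by blast
  \<comment> \<open>The Taylor coefficient to be cancelled.\<close>
  define v where "v = (\<chi> k. (deriv ^^ Suc m) (\<lambda>z. h z $ k) 0 / fact (Suc m))"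
  have "0 \<in> disc" by simp
  then obtain f where f: "f \<in> H" "f 0 = v" using eval_surj[OF _ inv] by metis
  define g where "g = h - (\<lambda>z. z ^ Suc m *s f z)"
  have g: "g \<in> H" unfolding g_def by (intro diff_mem h(1) shift_power[OF sh f(1)])
  have "(deriv ^^ a) (\<lambda>z. g z $ k) 0
      = (deriv ^^ a) (\<lambda>z. h z $ k) 0 - (if a = Suc m then fact (Suc m) * v $ k else 0)"
    if "a \<le> Suc m" for a k
  proof -
    have hk: "(\<lambda>z. h z $ k) holomorphic_on disc" and fk: "(\<lambda>z. f z $ k) holomorphic_on disc"
      using hol_sectionsD(1) hol h(1) f(1) by blast+
    have "(deriv ^^ a) (\<lambda>z. h z $ k - z ^ Suc m * f z $ k) 0
        = (deriv ^^ a) (\<lambda>z. h z $ k) 0 - (deriv ^^ a) (\<lambda>z. z ^ Suc m * f z $ k) 0"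
      using fk by (intro higher_deriv_diff[OF hk _ open_ball]) (auto intro!: holomorphic_intros)
    also have "(deriv ^^ a) (\<lambda>z. z ^ Suc m * f z $ k) 0 = (if a = Suc m then fact (Suc m) * f 0 $ k else 0)"
      by (rule higher_deriv_times_power_0[OF fk that])
    finally show ?thesis unfolding f(2) by (simp add: g_def del: funpow.simps)
  qed
  then have "(deriv ^^ a) (\<lambda>z. g z $ k) 0 = 0" if "1 \<le> a" "a \<le> Suc m" for a k
    using that h(3)[of a k] by (cases "a = Suc m") (auto simp: v_def simp del: funpow.simps fact_Suc)
  moreover have "g 0 = y" using h(2) by (simp add: g_def)
  ultimately show ?case using g by blast
qed

lemma bounded_functional_dop:
  assumes "locally_bounded" "w \<in> disc" shows "bounded_functional (\<lambda>f. dop b A f w $ i)"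
proof -
  have "bounded_functional (\<lambda>f. \<Sum>k | b k \<le> b i. A $ i $ k * (deriv ^^ (b i - b k)) (\<lambda>u. f u $ k) w)"
    by (intro bounded_functional_sum bounded_functional_cmult bounded_functional_deriv assms)
  then show ?thesis using assms(2) by (simp add: dop_def)
qed

text \<open>Images of kernel sections are again kernel sections, with \<open>x\<close> replaced by
  \<open>madj (F w) *v x\<close>, so the new kernel is explicit and the Riesz theorem is not called
  upon.\<close>

lemma multiplier_image:
  fixes F :: "complex \<Rightarrow> complex^'n^'n"
  assumes F: "\<And>i k. (\<lambda>z. F z $ i $ k) holomorphic_on disc" "\<And>z. z \<in> disc \<Longrightarrow> invertible (F z)"
    and ip': "\<And>f g. f \<in> H \<Longrightarrow> g \<in> H \<Longrightarrow> ip' (\<lambda>z. F z *v f z) (\<lambda>z. F z *v g z) = ip f g"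
  shows "rkhs ((\<lambda>f z. F z *v f z) ` H) ip' (\<lambda>z w. F z ** K z w ** madj (F w))"
proof
  define T where "T = (\<lambda>f z. F z *v f z)"
  have inj: "inj_on T H"
  proof (rule inj_onI)
    fix f g assume fg: "f \<in> H" "g \<in> H" "T f = T g"
    have "f z = g z" for z
    proof (cases "z \<in> disc")
      case True
      have "F z *v f z = F z *v g z" using fg(3) unfolding T_def by meson
      then have "matrix_inv (F z) *v (F z *v f z) = matrix_inv (F z) *v (F z *v g z)" by simp
      then show ?thesis by (simp add: matrix_vector_mul_assoc matrix_inv_left'[OF F(2)[OF True]])
    qed (use hol_sectionsD(2) hol fg in metis)
    then show "f = g" by blast
  qed
  have hs: "T f \<in> hol_sections" if "f \<in> H" for f
  proof (rule hol_sectionsI)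
    show "(\<lambda>z. T f z $ i) holomorphic_on disc" for i
      unfolding T_def matrix_vector_mult_def
      using F(1) hol_sectionsD(1)[OF hol[OF that]] by (auto intro!: holomorphic_intros)
    show "T f z = 0" if "z \<notin> disc" for z
      using hol_sectionsD(2)[OF hol[OF \<open>f \<in> H\<close>] that] by (simp add: T_def)
  qed
  have "hilbert_space (\<lambda>c f z. c *s f z) (T ` H) ip'"
    by (intro hilbert_space_image inj)
      (auto simp: T_def ip' fun_eq_iff matrix_vector_right_distrib vector_scalar_commute)
  then show "hilbert_sections ((\<lambda>f z. F z *v f z) ` H) ip'"
    using hs unfolding hilbert_sections_def T_def by auto
  have sec: "(\<lambda>z. if z \<in> disc then (F z ** K z w ** madj (F w)) *v x else 0)
      = T (ksec w (madj (F w) *v x))" for w x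
    by (auto simp: T_def ksec_def fun_eq_iff matrix_vector_mul_assoc matrix_mul_assoc)
  show "reproducing_kernel ((\<lambda>f z. F z *v f z) ` H) ip' (\<lambda>z w. F z ** K z w ** madj (F w))"
    unfolding reproducing_kernel_def sec
    using ksec_mem ip' ip_ksec by (auto simp: T_def cdot_matrix_left)
qed

lemma locally_boundedI:
  assumes "\<And>i. continuous_on disc (\<lambda>z. K z z $ i $ i)" shows "locally_bounded"
  unfolding locally_bounded_def
proof (intro allI impI)
  fix r :: real assume r: "r < 1"
  have "\<exists>C. \<forall>z. cmod z \<le> r \<longrightarrow> Re (K z z $ i $ i) \<le> C" for i
  proof -
    have sub: "cball 0 r \<subseteq> disc" using r by auto
    have "compact ((\<lambda>z. K z z $ i $ i) ` cball 0 r)"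
      by (intro compact_continuous_image continuous_on_subset[OF assms sub] compact_cball)
    then have "bounded ((\<lambda>z. K z z $ i $ i) ` cball 0 r)" by (rule compact_imp_bounded)
    then obtain C where C: "\<forall>x\<in>(\<lambda>z. K z z $ i $ i) ` cball 0 r. norm x \<le> C"
      unfolding bounded_iff by (elim exE)
    have "Re (K z z $ i $ i) \<le> C" if "cmod z \<le> r" for z
    proof -
      have "cmod (K z z $ i $ i) \<le> C" using C that by simp
      then show ?thesis using complex_Re_le_cmod order_trans by blast
    qed
    then show ?thesis by blast
  qed
  then obtain C where C: "\<And>i z. cmod z \<le> r \<Longrightarrow> Re (K z z $ i $ i) \<le> C i" by metis
  have "Re (K z z $ i $ i) \<le> Max (range C)" if "cmod z \<le> r" for z i
    using C[OF that, of i] by (rule order_trans) (intro Max_ge, auto)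
  then show "\<exists>C. \<forall>z i. cmod z \<le> r \<longrightarrow> Re (K z z $ i $ i) \<le> C" by blast
qed

end

section \<open>Weighted Bergman spaces\<close>

definition power_kernel :: "('n \<Rightarrow> real) \<Rightarrow> complex \<Rightarrow> complex \<Rightarrow> complex^'n^'n" where
  "power_kernel r z w = (\<chi> i k. if i = k then (1 - z * cnj w) powr of_real (- 2 * r i) else 0)"

lemma power_kernel_vec: "(power_kernel r z w *v x) $ i = (1 - z * cnj w) powr of_real (- 2 * r i) * x $ i"
  by (simp add: power_kernel_def matrix_vector_mult_def if_distrib if_distribR cong: if_cong)

text \<open>
  A space with kernel \<open>power_kernel r\<close> contains the weighted Bergman spaces, as the spaces of
  sections that have only one component.
\<close>

lemma is_bergman_component:
  fixes H :: "(complex \<Rightarrow> complex^'n) set" and i :: 'n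
  assumes "rkhs H ip K" and K: "\<And>z w. z \<in> disc \<Longrightarrow> w \<in> disc \<Longrightarrow> K z w = power_kernel r z w"
  shows "\<exists>p. is_bergman (r i) (fst p) (snd p)"
proof -
  interpret rkhs H ip K by fact
  define emb :: "(complex \<Rightarrow> complex) \<Rightarrow> complex \<Rightarrow> complex^'n"
    where "emb f z = (\<chi> k. if k = i then f z else 0)" for f z
  have emb_add: "emb (f + g) = emb f + emb g" and emb_diff: "emb (f - g) = emb f - emb g"
    and emb_scale: "emb (\<lambda>z. c * f z) = (\<lambda>z. c *s emb f z)" and emb_0: "emb 0 = 0"
    for f g c
    by (auto simp: emb_def fun_eq_iff vec_eq_iff)
  have emb_nth: "emb f z $ i = f z" for f z by (simp add: emb_def)
  have emb_nz: "emb f \<noteq> 0" if "f \<noteq> 0" for f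
  proof
    assume "emb f = 0"
    then have "f z = 0" for z using emb_nth[of f z] by simp
    then show False using that by auto
  qed
  define A where "A = {f. emb f \<in> H}"
  define p where "p f g = ip (emb f) (emb g)" for f g
  have "hilbert_space (\<lambda>c f z. c * f z) A p"
    unfolding hilbert_space_def
  proof (intro conjI ballI allI impI)
    show "0 \<in> A" using zero_mem by (simp add: A_def emb_0)
    fix f g h assume "f \<in> A" "g \<in> A" "h \<in> A"
    then have m: "emb f \<in> H" "emb g \<in> H" "emb h \<in> H" by (auto simp: A_def)
    show "f + g \<in> A" using m by (simp add: A_def emb_add add_mem)
    show "(\<lambda>z. c * f z) \<in> A" for c using scl_mem[OF m(1)] by (simp add: A_def emb_scale)
    show "p (f + g) h = p f h + p g h" using m by (simp add: p_def emb_add ip_add_left)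
    show "p (\<lambda>z. c * f z) g = c * p f g" for c
      using ip_scl_left[OF m(1,2)] by (simp add: p_def emb_scale)
    show "p g f = cnj (p f g)" unfolding p_def by (rule ip_commute[OF m(1,2)])
    show "0 < Re (p f f)" if "f \<noteq> 0" using ip_pos[OF m(1) emb_nz[OF that]] by (simp add: p_def)
  next
    fix X :: "nat \<Rightarrow> complex \<Rightarrow> complex"
    assume X: "(\<forall>n. X n \<in> A) \<and> (\<forall>e>0. \<exists>M. \<forall>m\<ge>M. \<forall>n\<ge>M. Re (p (X m - X n) (X m - X n)) < e)"
    then have XH: "emb (X n) \<in> H" for n by (simp add: A_def)
    obtain f where f: "f \<in> H" "(\<lambda>n. Re (ip (emb (X n) - f) (emb (X n) - f))) \<longlonglongrightarrow> 0"
      using complete[of "\<lambda>n. emb (X n)"] X XH unfolding p_def emb_diff by blast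
    \<comment> \<open>The limit keeps a single component: in any other one
      \<open>emb (X n) - f\<close> equals \<open>- f\<close>, and evaluation is bounded by the norm,
      which tends to 0.\<close>
    have f0: "f z $ k = 0" if z: "z \<in> disc" and k: "k \<noteq> i" for z k
    proof -
      have "(cmod (f z $ k))\<^sup>2 \<le> Re (K z z $ k $ k) * Re (ip (emb (X n) - f) (emb (X n) - f))" for n
        using norm_eval_le[OF diff_mem[OF XH f(1)] z, of n k] k by (simp add: emb_def)
      then have "(cmod (f z $ k))\<^sup>2 \<le> Re (K z z $ k $ k) * 0"
        by (intro LIMSEQ_le_const[OF tendsto_mult[OF tendsto_const f(2)]]) auto
      then show ?thesis by simp
    qed
    have fe: "f = emb (\<lambda>z. f z $ i)"
    proof
      show "f z = emb (\<lambda>z. f z $ i) z" for z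
        using f0[of z] hol_sectionsD(2)[OF hol[OF f(1)], of z]
        by (cases "z \<in> disc") (auto simp: emb_def vec_eq_iff simp del: mem_ball_0)
    qed
    show "\<exists>f\<in>A. (\<lambda>n. Re (p (X n - f) (X n - f))) \<longlonglongrightarrow> 0"
      using f unfolding p_def emb_diff A_def by (intro bexI[of _ "\<lambda>z. f z $ i"]) (auto simp flip: fe)
  qed
  moreover have "A \<subseteq> hol_functions"
  proof
    fix f assume "f \<in> A"
    then have "(\<lambda>z. emb f z $ i) \<in> hol_functions" using hol unfolding A_def hol_sections_def by blast
    then show "f \<in> hol_functions" by (simp add: emb_nth)
  qed
  moreover have "(\<lambda>z. if z \<in> disc then (1 - z * cnj w) powr of_real (- 2 * r i) else 0) \<in> A \<and>
      (\<forall>f\<in>A. p f (\<lambda>z. if z \<in> disc then (1 - z * cnj w) powr of_real (- 2 * r i) else 0) = f w)"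
    if w: "w \<in> disc" for w
  proof -
    have "emb (\<lambda>z. if z \<in> disc then (1 - z * cnj w) powr of_real (- 2 * r i) else 0) = ksec w (axis i 1)"
    proof
      fix z
      show "emb (\<lambda>z. if z \<in> disc then (1 - z * cnj w) powr of_real (- 2 * r i) else 0) z = ksec w (axis i 1) z"
      proof (cases "z \<in> disc")
        case True
        then show ?thesis unfolding emb_def ksec_def if_P[OF True] K[OF True w]
          by (simp only: vec_eq_iff power_kernel_vec vec_lambda_beta) (simp add: axis_def)
      next
        case False
        then show ?thesis unfolding emb_def ksec_def by (auto simp: vec_eq_iff)
      qed
    qed
    then show ?thesis
      using ksec_mem[OF w] ip_ksec[OF w] unfolding A_def p_def
      by (simp add: cdot_axis_right emb_nth)
  qed
  ultimately have "is_bergman (r i) A p" by (simp add: is_bergman_def Let_def)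
  then show ?thesis by (intro exI[of _ "(A, p)"]) simp
qed

text \<open>\<open>bergman\<close> is a choice, so its properties are available only for parameters
  at which some Bergman space exists; hence the assumption \<open>ex\<close>.\<close>

lemma rkhs_sum_bergman:
  fixes b :: "'n::finite \<Rightarrow> nat"
  assumes ex: "\<And>i. \<exists>p. is_bergman (\<eta> + real (b i)) (fst p) (snd p)"
  shows "rkhs (sum_bergman b \<eta>) (sum_bergman_ip b \<eta>) (power_kernel (\<lambda>i. \<eta> + real (b i)))"
proof -
  define A where "A i = fst (bergman (\<eta> + real (b i)))" for i
  define p where "p i = snd (bergman (\<eta> + real (b i)))" for i
  define k where "k i w = (\<lambda>z. if z \<in> disc then (1 - z * cnj w) powr of_real (- 2 * (\<eta> + real (b i))) else 0)"
    for i and w :: complex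
  have "is_bergman (\<eta> + real (b i)) (A i) (p i)" for i
    unfolding A_def p_def bergman_def by (rule someI_ex[OF ex])
  then have hs: "hilbert_space (\<lambda>c f z. c * f z) (A i) (p i)" and sub: "A i \<subseteq> hol_functions"
    and kA: "w \<in> disc \<Longrightarrow> k i w \<in> A i" and pk: "w \<in> disc \<Longrightarrow> f \<in> A i \<Longrightarrow> p i f (k i w) = f w" for i w f
    unfolding is_bergman_def Let_def k_def by blast+
  have vs: "vector_space (\<lambda>c f z. c * (f z :: complex))"
    by unfold_locales (auto simp: fun_eq_iff algebra_simps)
  interpret B: hilbert "\<lambda>c f z. c * f z" "A i" "p i" for i
    using vs hs[of i] by (simp add: hilbert_def hilbert_axioms_def)
  define S where "S = sum_bergman b \<eta>"
  define q where "q = sum_bergman_ip b \<eta>"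
  have S: "f \<in> S \<longleftrightarrow> (\<forall>i. (\<lambda>z. f z $ i) \<in> A i)" for f :: "complex \<Rightarrow> complex^'n"
    by (simp add: S_def sum_bergman_def A_def)
  have q: "q f g = (\<Sum>i\<in>UNIV. p i (\<lambda>z. f z $ i) (\<lambda>z. g z $ i))" for f g :: "complex \<Rightarrow> complex^'n"
    by (simp add: q_def sum_bergman_ip_def p_def)
  have nth_add: "(\<lambda>z. (f + g) z $ i) = (\<lambda>z. f z $ i) + (\<lambda>z. g z $ i)"
    and nth_diff: "(\<lambda>z. (f - g) z $ i) = (\<lambda>z. f z $ i) - (\<lambda>z. g z $ i)"
    and nth_scale: "(\<lambda>z. (c *s f z) $ i) = (\<lambda>z. c * f z $ i)"
    and nth_0: "(\<lambda>z. (0::complex \<Rightarrow> complex^'n) z $ i) = 0"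
    for f g :: "complex \<Rightarrow> complex^'n" and c i by (auto simp: fun_eq_iff)
  have "hilbert_space (\<lambda>c f z. c *s f z) S q"
    unfolding hilbert_space_def
  proof (intro conjI ballI allI impI)
    show "0 \<in> S" unfolding S nth_0 using B.zero_mem by blast
    fix f g h assume "f \<in> S" "g \<in> S" "h \<in> S"
    then have m: "(\<lambda>z. f z $ i) \<in> A i" "(\<lambda>z. g z $ i) \<in> A i" "(\<lambda>z. h z $ i) \<in> A i" for i
      by (auto simp: S)
    show "f + g \<in> S" unfolding S nth_add using B.add_mem[OF m(1,2)] by blast
    show "(\<lambda>z. c *s f z) \<in> S" for c unfolding S nth_scale using B.scl_mem[OF m(1)] by blast
    show "q (f + g) h = q f h + q g h"
      unfolding q nth_add B.ip_add_left[OF m(1,2,3)] by (rule sum.distrib)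
    show "q (\<lambda>z. c *s f z) g = c * q f g" for c
      unfolding q nth_scale B.ip_scl_left[OF m(1,2)] by (simp only: sum_distrib_left)
    show "q g f = cnj (q f g)"
      unfolding q B.ip_commute[OF m(1,2)] by (simp only: cnj_sum)
    show "0 < Re (q f f)" if nz: "f \<noteq> 0"
    proof -
      have "f = 0" if "\<forall>z. f z = 0" using that by (simp add: fun_eq_iff)
      then obtain z where "f z \<noteq> 0" using nz by blast
      then have "\<exists>i. f z $ i \<noteq> 0" by (simp add: vec_eq_iff)
      then obtain i where "f z $ i \<noteq> 0" ..
      then have "(\<lambda>z. f z $ i) \<noteq> 0" by (auto simp: fun_eq_iff)
      then show ?thesis
        unfolding q Re_sum using B.ip_pos[OF m(1)] B.ip_self_nonneg[OF m(1)]
        by (intro sum_pos2[of UNIV i]) auto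
    qed
  next
    fix X :: "nat \<Rightarrow> complex \<Rightarrow> complex^'n"
    assume X: "(\<forall>n. X n \<in> S) \<and> (\<forall>e>0. \<exists>M. \<forall>m\<ge>M. \<forall>n\<ge>M. Re (q (X m - X n) (X m - X n)) < e)"
    have m: "(\<lambda>z. X n z $ i) \<in> A i" for n i using X by (auto simp: S)
    \<comment> \<open>Each component is dominated by the total, so a Cauchy sequence is Cauchy in
      every component; the finitely many limits are then assembled.\<close>
    have le: "Re (p i ((\<lambda>z. X m z $ i) - (\<lambda>z. X n z $ i)) ((\<lambda>z. X m z $ i) - (\<lambda>z. X n z $ i)))
        \<le> Re (q (X m - X n) (X m - X n))" for m n i
      unfolding q nth_diff Re_sum
      by (rule member_le_sum) (auto intro: B.ip_self_nonneg B.diff_mem m)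
    have "\<exists>f\<in>A i. (\<lambda>n. Re (p i ((\<lambda>z. X n z $ i) - f) ((\<lambda>z. X n z $ i) - f))) \<longlonglongrightarrow> 0" for i
    proof (rule B.complete[OF m])
      fix e :: real assume "e > 0"
      then obtain M where "\<forall>m\<ge>M. \<forall>n\<ge>M. Re (q (X m - X n) (X m - X n)) < e" using X by meson
      then show "\<exists>M. \<forall>m\<ge>M. \<forall>n\<ge>M.
          Re (p i ((\<lambda>z. X m z $ i) - (\<lambda>z. X n z $ i)) ((\<lambda>z. X m z $ i) - (\<lambda>z. X n z $ i))) < e"
        using le by (meson le_less_trans)
    qed
    then have "\<forall>i. \<exists>F. F \<in> A i \<and> (\<lambda>n. Re (p i ((\<lambda>z. X n z $ i) - F) ((\<lambda>z. X n z $ i) - F))) \<longlonglongrightarrow> 0"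
      unfolding Bex_def by (rule allI)
    from choice[OF this] obtain F where "\<forall>i. F i \<in> A i \<and> (\<lambda>n. Re (p i ((\<lambda>z. X n z $ i) - F i) ((\<lambda>z. X n z $ i) - F i))) \<longlonglongrightarrow> 0" ..
    then have F: "F i \<in> A i" "(\<lambda>n. Re (p i ((\<lambda>z. X n z $ i) - F i) ((\<lambda>z. X n z $ i) - F i))) \<longlonglongrightarrow> 0" for i
      by simp_all
    define f where "f z = (\<chi> i. F i z)" for z
    have fi: "(\<lambda>z. f z $ i) = F i" for i by (simp add: f_def fun_eq_iff)
    have "(\<lambda>n. Re (q (X n - f) (X n - f))) \<longlonglongrightarrow> (\<Sum>i\<in>(UNIV::'n set). 0)"
      unfolding q nth_diff fi Re_sum by (intro tendsto_sum F(2))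
    then show "\<exists>f\<in>S. (\<lambda>n. Re (q (X n - f) (X n - f))) \<longlonglongrightarrow> 0"
      using F(1) by (intro bexI[of _ f]) (auto simp: S fi)
  qed
  moreover have "S \<subseteq> hol_sections"
  proof
    fix f assume "f \<in> S"
    then have "(\<lambda>z. f z $ i) \<in> A i" for i by (simp add: S)
    then show "f \<in> hol_sections" using sub unfolding hol_sections_def by blast
  qed
  moreover have "reproducing_kernel S q (power_kernel (\<lambda>i. \<eta> + real (b i)))"
    unfolding reproducing_kernel_def
  proof (intro ballI allI conjI)
    fix w x assume w: "w \<in> disc"
    let ?k = "\<lambda>z. if z \<in> disc then power_kernel (\<lambda>i. \<eta> + real (b i)) z w *v x else 0"
    have kn: "(\<lambda>z. ?k z $ i) = (\<lambda>z. x $ i * k i w z)" for i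
      by (auto simp: fun_eq_iff k_def power_kernel_vec simp del: of_real_mult of_real_minus of_real_add)
    show "?k \<in> S" unfolding S kn using B.scl_mem[OF kA[OF w]] by blast
    fix f assume "f \<in> S"
    then have m: "(\<lambda>z. f z $ i) \<in> A i" for i by (auto simp: S)
    show "q f ?k = cdot (f w) x"
      unfolding q kn B.ip_scl_right[OF m kA[OF w]] pk[OF w m] by (simp add: cdot_def mult.commute)
  qed
  ultimately show ?thesis
    unfolding S_def q_def rkhs_def hilbert_sections_def by blast
qed

section \<open>The kernel of an elementary bundle\<close>

lemma continuous_on_norm_power: "continuous_on disc (\<lambda>z. complex_of_real ((1 - (cmod z)\<^sup>2) powr s))"
proof -
  have "1 - (cmod z)\<^sup>2 \<noteq> 0" if "z \<in> disc" for z
    using that by (auto simp: abs_square_eq_1)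
  then show ?thesis by (intro continuous_intros) auto
qed

lemma rkhs_power_kernel_locally_bounded:
  assumes "rkhs H ip K" "\<And>z w. z \<in> disc \<Longrightarrow> w \<in> disc \<Longrightarrow> K z w = power_kernel r z w"
  shows "rkhs.locally_bounded K"
proof -
  interpret rkhs H ip K by fact
  show ?thesis
  proof (rule locally_boundedI)
    fix i
    have "of_real ((1 - (cmod z)\<^sup>2) powr (- 2 * r i)) = K z z $ i $ i" if z: "z \<in> disc" for z
    proof -
      have pos: "1 - (cmod z)\<^sup>2 > 0" using z by (simp add: abs_square_less_1)
      have "1 - z * cnj z = of_real (1 - (cmod z)\<^sup>2)"
        by (simp only: of_real_diff complex_norm_square of_real_1)
      then show ?thesis
        using pos unfolding assms(2)[OF z z] power_kernel_def by (simp add: powr_of_real[symmetric])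
    qed
    then show "continuous_on disc (\<lambda>z. K z z $ i $ i)"
      by (rule continuous_on_eq[OF continuous_on_norm_power])
  qed
qed

lemma continuous_on_elementary_mult:
  "continuous_on disc (\<lambda>z. elementary_mult b \<eta> Y (0, z) z $ i $ k)"
proof -
  have c: "continuous_on disc (\<lambda>z. c_of (0, z))"
  proof (rule continuous_on_compose2[OF continuous_on_c_of])
    show "continuous_on disc (\<lambda>z. (0, z))" by (intro continuous_intros)
    show "(\<lambda>z. (0, z)) ` disc \<subseteq> carrier mob_cover" by (auto simp: carrier_mob_cover)
  qed
  have d: "continuous_on disc (\<lambda>z. deriv_pow (0, z) s z)" for s
    by (rule continuous_on_eq[OF continuous_on_norm_power[of "- s"]]) (simp add: deriv_pow_to_zero)
  show ?thesis
    unfolding elementary_mult_def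
    by (cases "b k \<le> b i") (auto intro!: continuous_intros c d)
qed

text \<open>Moving \<open>z\<close> to 0 by \<open>(0, z)\<close> writes \<open>K z z\<close> as a
  product of \<open>K 0 0\<close> with multipliers that are continuous in \<open>z\<close>.\<close>

lemma elementary_locally_bounded:
  assumes "rkhs H ip K" "unitary_action (elementary_mult b \<eta> Y) H ip"
  shows "rkhs.locally_bounded K"
proof -
  interpret rkhs H ip K by fact
  show ?thesis
  proof (rule locally_boundedI)
    fix i
    let ?J = "\<lambda>z. elementary_mult b \<eta> Y (0, z) z"
    have "continuous_on disc (\<lambda>z. (?J z ** K 0 0 ** madj (?J z)) $ i $ i)"
      unfolding matrix_matrix_mult_def madj_def
      by (simp, intro continuous_intros continuous_on_elementary_mult)
    note c = this
    have J: "?J z ** K 0 0 ** madj (?J z) = K z z" if "z \<in> disc" for z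
      using kernel_invariant[OF assms(2) translation_mem[of z 0] that that] that by (simp add: act_to_zero)
    show "continuous_on disc (\<lambda>z. K z z $ i $ i)"
      by (rule continuous_on_eq[OF c]) (simp only: J)
  qed
qed

lemma power_kernel_deriv_0:
  assumes "w \<in> disc"
  shows "deriv (\<lambda>u. a * (1 - u * cnj w) powr of_real (- 2 * s)) 0 = a * (2 * s) * cnj w"
proof -
  have "((\<lambda>u. a * (1 - u * cnj w) powr of_real (- 2 * s)) has_field_derivative a * (2 * s) * cnj w) (at 0)"
    by (auto intro!: derivative_eq_intros)
  then show ?thesis by (rule DERIV_imp_deriv)
qed

text \<open>
  If the parameter were not positive, then on the lowest block the derivative at 0 would vanish on
  the whole space, which is impossible by shift invariance.
\<close>

lemma elementary_parameter_pos:
  fixes b :: "'n::finite \<Rightarrow> nat" and i :: "'n::finite"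
  assumes "rkhs H ip K" and J: "unitary_action (elementary_mult b \<eta> Y) H ip"
    and inv: "invertible (K 0 0)" and sh: "shift_invariant H" and i: "b i = 0"
  shows "\<eta> > 0"
proof -
  interpret rkhs H ip K by fact
  have lb: "locally_bounded" by (rule elementary_locally_bounded[OF assms(1) J])
  \<comment> \<open>No block lies before block 0, so this row of the multiplier is diagonal and the
    diagonal kernel entry transforms by scalars.\<close>
  have Ji: "elementary_mult b \<eta> Y g z $ i $ k = (if i = k then deriv_pow g \<eta> z else 0)" for g z k
    using i by (auto simp: elementary_mult_def mat_def)
  have "K z w $ i $ i = deriv_pow g (\<eta> + real 0) z * K (act g z) (act g w) $ i $ i * cnj (deriv_pow g (\<eta> + real 0) w)"
    if "g \<in> carrier mob_cover" "z \<in> disc" "w \<in> disc" for g z w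
    using kernel_invariant[OF J that]
    by (simp add: matrix_matrix_mult_def madj_def Ji if_distrib if_distribR cong: if_cong)
  then have Kii: "K z w $ i $ i = K 0 0 $ i $ i * (1 - z * cnj w) powr of_real (- 2 * \<eta>)"
    if "z \<in> disc" "w \<in> disc" for z w
    using quasi_invariant_kernel[OF kernel_holomorphic kernel_antiholomorphic _ that, of i i \<eta> 0 0] by simp
  define a where "a = K 0 0 $ i $ i"
  obtain e where e: "e \<in> H" "\<And>f. f \<in> H \<Longrightarrow> deriv (\<lambda>z. f z $ i) 0 = ip f e"
    using Riesz[OF bounded_functional_deriv[OF lb, of 0 1 i]] by auto
  have ez: "e z $ i = cnj a * (2 * \<eta>) * z" if z: "z \<in> disc" for z
  proof -
    have "e z $ i = cnj (ip (ksec z (axis i 1)) e)"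
      using ip_ksec[OF z e(1), of "axis i 1"] ip_commute[OF ksec_mem[OF z] e(1)]
      by (simp add: cdot_axis_right)
    also have "ip (ksec z (axis i 1)) e = deriv (\<lambda>u. ksec z (axis i 1) u $ i) 0"
      using e(2)[OF ksec_mem[OF z]] by simp
    also have "\<dots> = deriv (\<lambda>u. a * (1 - u * cnj z) powr of_real (- 2 * \<eta>)) 0"
    proof (rule deriv_cong_ev)
      have "eventually (\<lambda>u. u \<in> disc) (nhds (0::complex))" by (intro eventually_nhds_in_open) auto
      then show "\<forall>\<^sub>F u in nhds 0. ksec z (axis i 1) u $ i = a * (1 - u * cnj z) powr of_real (- 2 * \<eta>)"
      proof eventually_elim
        case (elim u)
        show ?case
          unfolding ksec_def if_P[OF elim] matrix_vector_axis a_def by (rule Kii[OF elim z])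
      qed
    qed simp
    also have "\<dots> = a * (2 * \<eta>) * cnj z" by (rule power_kernel_deriv_0[OF z])
    finally show ?thesis by simp
  qed
  \<comment> \<open>The functional is evaluated at its own representing vector, which ties the sign
    of \<open>\<eta>\<close> to a squared norm.\<close>
  have "ip e e = deriv (\<lambda>z. e z $ i) 0" using e by simp
  also have "\<dots> = deriv (\<lambda>z. cnj a * (2 * \<eta>) * z) 0"
  proof (rule deriv_cong_ev)
    have "eventually (\<lambda>u. u \<in> disc) (nhds (0::complex))" by (intro eventually_nhds_in_open) auto
    then show "\<forall>\<^sub>F u in nhds 0. e u $ i = cnj a * (2 * \<eta>) * u"
      by eventually_elim (use ez in simp)
  qed simp
  also have "\<dots> = cnj a * (2 * \<eta>)"
    by simp
  finally have ipe: "ip e e = cnj a * (2 * \<eta>)" .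
  have "e \<noteq> 0"
  proof
    assume e0: "e = 0"
    have "0 \<in> disc" by simp
    then obtain f where f: "f \<in> H" "f 0 = axis i 1" using eval_surj[OF _ inv] by metis
    \<comment> \<open>Component \<open>i\<close> of this section has derivative
      \<open>f 0 $ i = 1\<close> at 0, so the functional is not zero.\<close>
    have "(\<lambda>z. z *s f z) \<in> H" using sh f(1) unfolding shift_invariant_def by (rule bspec)
    then have "deriv (\<lambda>z. (z *s f z) $ i) 0 = 0"
      using e(2) ip_zero_left ip_commute zero_mem unfolding e0 by (metis complex_cnj_zero)
    moreover have "deriv (\<lambda>z. z * f z $ i) 0 = f 0 $ i"
      using higher_deriv_times_id_0[OF hol_sectionsD(1)[OF hol[OF f(1)]], of 0 i] by simp
    ultimately show False using f(2) by simp
  qed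
  then have "0 < Re (cnj a * (2 * \<eta>))" using ip_pos[OF e(1)] ipe by simp
  moreover have "0 \<le> Re a"
    using kernel_nonneg[of 0 "axis i 1"] by (simp add: a_def cdot_axis_right matrix_vector_axis)
  ultimately show ?thesis by (simp add: zero_less_mult_iff)
qed

section \<open>Comparison of the given kernel with the constructed one\<close>

lemma dop_block_diagonal:
  assumes N: "block_diagonal b N" and f: "f \<in> hol_sections"
  shows "dop b N f = (\<lambda>z. N *v f z)"
proof
  fix z
  have l: "lower b N" using N by (auto simp: lower_def block_diagonal_def)
  show "dop b N f z = N *v f z"
  proof (cases "z \<in> disc")
    case True
    have "N $ i $ k * (deriv ^^ (b i - b k)) (\<lambda>u. f u $ k) z = N $ i $ k * f z $ k" for i k
      using N unfolding block_diagonal_def by (cases "N $ i $ k = 0") auto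
    then show ?thesis
      unfolding vec_eq_iff dop_nth[OF l True] matrix_vector_mult_def vec_lambda_beta
      by (intro allI sum.cong refl)
  next
    case False
    then show ?thesis using hol_sectionsD(2)[OF f False] by (simp add: dop_def)
  qed
qed

lemma diagonal_mult_conj:
  "(diagonal_mult b \<eta> g z ** M ** madj (diagonal_mult b \<eta> g w)) $ i $ k
    = deriv_pow g (\<eta> + real (b i)) z * M $ i $ k * cnj (deriv_pow g (\<eta> + real (b k)) w)"
  by (simp add: matrix_matrix_mult_def madj_def diagonal_mult_def if_distrib if_distribR cong: if_cong)

text \<open>\<open>power_kernel\<close> is scalar on each block, so it can be moved past
  \<open>N\<close>.\<close>

lemma power_kernel_conj:
  assumes N: "block_diagonal b N" and B: "N ** madj N = B"
  shows "(N ** power_kernel (\<lambda>i. \<eta> + real (b i)) z w ** madj N) $ i $ k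
    = B $ i $ k * (1 - z * cnj w) powr of_real (- 2 * (\<eta> + real (b i)))"
proof -
  define \<kappa> where "\<kappa> n = (1 - z * cnj w) powr of_real (- 2 * (\<eta> + real n))" for n :: nat
  have "(N ** power_kernel (\<lambda>i. \<eta> + real (b i)) z w) $ i $ l = N $ i $ l * \<kappa> (b l)" for l
    unfolding matrix_matrix_mult_def power_kernel_def \<kappa>_def
    by (simp add: if_distrib if_distribR cong: if_cong del: of_real_mult of_real_minus of_real_add)
  then have "(N ** power_kernel (\<lambda>i. \<eta> + real (b i)) z w ** madj N) $ i $ k
    = (\<Sum>l\<in>UNIV. N $ i $ l * \<kappa> (b l) * cnj (N $ k $ l))"
    by (simp add: matrix_matrix_mult_def[of "N ** power_kernel (\<lambda>i. \<eta> + real (b i)) z w"] madj_def)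
  also have "\<dots> = (\<Sum>l\<in>UNIV. N $ i $ l * cnj (N $ k $ l)) * \<kappa> (b i)"
    unfolding sum_distrib_right
  proof (intro sum.cong refl)
    fix l
    show "N $ i $ l * \<kappa> (b l) * cnj (N $ k $ l) = N $ i $ l * cnj (N $ k $ l) * \<kappa> (b i)"
      using N unfolding block_diagonal_def by (cases "N $ i $ l = 0") (auto simp: mult_ac)
  qed
  also have "(\<Sum>l\<in>UNIV. N $ i $ l * cnj (N $ k $ l)) = B $ i $ k"
    by (simp add: B[symmetric] matrix_matrix_mult_def madj_def)
  finally show ?thesis by (simp only: \<kappa>_def)
qed

theorem elementary_kernel:
  fixes b :: "'n::finite \<Rightarrow> nat"
  assumes R: "rkhs H ip K" and J: "unitary_action (elementary_mult b \<eta> Y) H ip"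
    and inv: "invertible (K 0 0)" and sh: "shift_invariant H" and gr: "grading m b"
  shows "\<eta> > 0 \<and> (\<exists>N. block_diagonal b N \<and> invertible N \<and>
    (\<forall>z\<in>disc. \<forall>w\<in>disc. kernel_N b \<eta> Y N z w = K z w))"
proof -
  interpret R: rkhs H ip K by (rule R)
  interpret G: group mob_cover by (rule group_mob_cover)
  have d0: "(0::complex) \<in> disc" by simp
  obtain i0 where "b i0 = 0" using gr unfolding grading_def by (metis atMost_iff le0 rangeE)
  then have \<eta>: "\<eta> > 0" by (rule elementary_parameter_pos[OF R J inv sh])
  have lb: "R.locally_bounded" by (rule elementary_locally_bounded[OF R J])
  define C where "C = gamma_matrix b \<eta> Y"
  have lC: "lower b C" unfolding C_def by (rule lower_gamma_matrix)
  \<comment> \<open>\<open>C\<close> is the identity within blocks, so its inverse is lower too, and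
    \<open>dop b D\<close> inverts \<open>Gamma\<close> on all holomorphic sections.\<close>
  obtain D where lD: "lower b D" and CD: "C ** D = mat 1" and DC: "D ** C = mat 1"
    and dD: "\<And>i k. b i = b k \<Longrightarrow> D $ i $ k = (if i = k then 1 else 0)"
    using lower_unitriangular_inverse[OF lC] gamma_matrix_diag unfolding C_def by metis
  define T where "T = dop b D"
  have T: "T f \<in> hol_sections" if "f \<in> hol_sections" for f
    unfolding T_def by (rule dop_hol_sections[OF that])
  have CT: "dop b C (T f) = f" and TC: "T (dop b C f) = f" if "f \<in> hol_sections" for f
    unfolding T_def
    by (simp_all add: dop_dop[OF lC lD that] dop_dop[OF lD lC that] CD DC dop_mat_1[OF that])
  have hol: "f \<in> hol_sections" if "f \<in> H" for f by (rule R.hol[OF that])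
  define ip1 where "ip1 f g = ip (dop b C f) (dop b C g)" for f g
  have "\<exists>K1. rkhs (T ` H) ip1 K1"
  proof (rule R.rkhs_image)
    show "inj_on T H" by (rule inj_on_inverseI[of _ "dop b C"]) (rule CT[OF hol])
    show "T (f + g) = T f + T g" if "f \<in> H" "g \<in> H" for f g
      unfolding T_def by (rule dop_add[OF hol[OF that(1)] hol[OF that(2)]])
    show "T (\<lambda>z. c *s f z) = (\<lambda>z. c *s T f z)" if "f \<in> H" for c f
      unfolding T_def by (rule dop_cmult[OF hol[OF that]])
    show "ip1 (T f) (T g) = ip f g" if "f \<in> H" "g \<in> H" for f g
      unfolding ip1_def CT[OF hol[OF that(1)]] CT[OF hol[OF that(2)]] ..
    show "T f \<in> hol_sections" if "f \<in> H" for f by (rule T[OF hol[OF that]])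
    show "R.bounded_functional (\<lambda>f. T f w $ i)" if "w \<in> disc" for w i
      unfolding T_def by (rule R.bounded_functional_dop[OF lb that])
  qed
  then obtain K1 where "rkhs (T ` H) ip1 K1" by blast
  then interpret R1: rkhs "T ` H" ip1 K1 .
  have J1: "unitary_action (diagonal_mult b \<eta>) (T ` H) ip1"
    unfolding unitary_action_def
  proof (intro ballI conjI)
    fix g assume g: "g \<in> carrier mob_cover"
    then have gi: "inv\<^bsub>mob_cover\<^esub> g \<in> carrier mob_cover" by simp
    let ?U = "section_action (diagonal_mult b \<eta>) g"
    let ?V = "section_action (elementary_mult b \<eta> Y) g"
    have V: "?V ` H = H" "\<And>f h. f \<in> H \<Longrightarrow> h \<in> H \<Longrightarrow> ip (?V f) (?V h) = ip f h"
      using J g unfolding unitary_action_def by blast+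
    \<comment> \<open>Equivariance of \<open>Gamma\<close> at the section \<open>T f\<close>, with
      \<open>T\<close> then applied to both sides.\<close>
    have UT: "?U (T f) = T (?V f)" if f: "f \<in> H" for f
    proof -
      have "dop b C (?U (T f)) = ?V (dop b C (T f))"
        unfolding section_action_eq C_def Gamma_eq_dop[symmetric]
        by (rule Gamma_equivariant[OF \<eta> gi T[OF hol[OF f]]])
      then have "T (dop b C (?U (T f))) = T (?V f)" by (simp only: CT[OF hol[OF f]])
      moreover have "?U (T f) \<in> hol_sections"
        unfolding section_action_eq by (rule pullback_diagonal_hol[OF gi T[OF hol[OF f]]])
      ultimately show ?thesis by (simp only: TC)
    qed
    have "?U ` T ` H = T ` ?V ` H" unfolding image_image by (rule image_cong[OF refl UT])
    then show "?U ` T ` H = T ` H" by (simp only: V(1))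
    fix f h assume "f \<in> T ` H" "h \<in> T ` H"
    then obtain f' h' where f': "f' \<in> H" "f = T f'" and h': "h' \<in> H" "h = T h'" by blast
    have "?V f' \<in> H" "?V h' \<in> H" using V(1) f'(1) h'(1) by blast+
    then show "ip1 (?U f) (?U h) = ip1 f h"
      unfolding f'(2) h'(2) UT[OF f'(1)] UT[OF h'(1)] ip1_def
      using V(2) f'(1) h'(1) by (simp only: CT[OF hol])
  qed
  define B where "B = K1 0 0"
  have K1: "K1 z w $ i $ k =
      (if b i = b k then B $ i $ k * (1 - z * cnj w) powr of_real (- 2 * (\<eta> + real (b i))) else 0)"
    if zw: "z \<in> disc" "w \<in> disc" for z w i k
    unfolding B_def
  proof (rule quasi_invariant_kernel[OF R1.kernel_holomorphic R1.kernel_antiholomorphic _ zw])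
    fix g and z w :: complex assume a: "g \<in> carrier mob_cover" "z \<in> disc" "w \<in> disc"
    show "K1 z w $ i $ k = deriv_pow g (\<eta> + real (b i)) z * K1 (act g z) (act g w) $ i $ k
        * cnj (deriv_pow g (\<eta> + real (b k)) w)"
      unfolding diagonal_mult_conj[symmetric] R1.kernel_invariant[OF J1 a, symmetric] ..
  qed
  have bB: "block_diagonal b B"
    unfolding block_diagonal_def
  proof (intro allI impI)
    fix i k assume "B $ i $ k \<noteq> 0"
    then show "b i = b k" using K1[OF d0 d0, of i k] unfolding B_def by (meson)
  qed
  have "pos_def B"
    unfolding pos_def_def
  proof (intro conjI allI impI)
    show "madj B = B" unfolding B_def by (rule R1.kernel_adjoint[OF d0 d0])
    fix x :: "complex^'n" assume x: "x \<noteq> 0"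
    obtain h where h: "h \<in> H" "h 0 = x"
      "\<And>a k. 1 \<le> a \<Longrightarrow> a \<le> Max (range b) \<Longrightarrow> (deriv ^^ a) (\<lambda>z. h z $ k) 0 = 0"
      using R.jets[OF sh inv, of x "Max (range b)"] by blast
    have "T h 0 $ i = x $ i" for i
    proof -
      have "T h 0 $ i = (\<Sum>k\<in>UNIV. D $ i $ k * (deriv ^^ (b i - b k)) (\<lambda>u. h u $ k) 0)"
        unfolding T_def by (rule dop_nth[OF lD d0])
      also have "\<dots> = (\<Sum>k\<in>{i}. D $ i $ k * (deriv ^^ (b i - b k)) (\<lambda>u. h u $ k) 0)"
      proof (rule sum.mono_neutral_right)
        show "\<forall>k\<in>UNIV - {i}. D $ i $ k * (deriv ^^ (b i - b k)) (\<lambda>u. h u $ k) 0 = 0"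
        proof
          fix k assume k: "k \<in> UNIV - {i}"
          consider "b k < b i" | "b i = b k" | "b i < b k" by linarith
          then show "D $ i $ k * (deriv ^^ (b i - b k)) (\<lambda>u. h u $ k) 0 = 0"
          proof cases
            case 1
            have "b i \<le> Max (range b)" by simp
            then have "(deriv ^^ (b i - b k)) (\<lambda>u. h u $ k) 0 = 0"
              using 1 by (intro h(3)) linarith+
            then show ?thesis by simp
          next
            case 2
            then show ?thesis using dD[of i k] k by auto
          next
            case 3
            then have "D $ i $ k = 0" using lD unfolding lower_def by (metis leD)
            then show ?thesis by simp
          qed
        qed
      qed auto
      also have "\<dots> = x $ i" using dD[of i i] h(2) by simp
      finally show ?thesis .
    qed
    then have "T h 0 = x" by (simp add: vec_eq_iff)
    then have "cdot (T h 0) x \<noteq> 0" using cdot_self_nonzero[OF x] by auto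
    then show "0 < Re (cdot (B *v x) x)"
      unfolding B_def using h(1) by (intro R1.kernel_pos[OF d0]) blast
  qed
  then obtain N where bN: "block_diagonal b N" and iN: "invertible N" and NN: "N ** madj N = B"
    using pos_def_block_factorization[OF _ bB] by blast
  define M where "M = matrix_inv N"
  have MN: "M ** N = mat 1" and NM: "N ** M = mat 1"
    unfolding M_def by (rule matrix_inv_left'[OF iN] matrix_inv_right'[OF iN])+
  have bM: "block_diagonal b M" unfolding M_def by (rule block_diagonal_matrix_inv[OF bN iN])
  define r where "r i = \<eta> + real (b i)" for i
  \<comment> \<open>Dividing by \<open>N\<close> normalizes the kernel to
    \<open>power_kernel\<close>. Nothing relates this space yet to \<open>sum_bergman\<close>, whose
    summands are obtained by choice.\<close>
  define H2 where "H2 = (\<lambda>f z. M *v f z) ` T ` H"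
  define ip2 where "ip2 f g = ip1 (\<lambda>z. N *v f z) (\<lambda>z. N *v g z)" for f g
  have R2: "rkhs H2 ip2 (\<lambda>z w. M ** K1 z w ** madj M)"
    unfolding H2_def
  proof (rule R1.multiplier_image[of "\<lambda>_. M"])
    show "invertible M" by (rule invertible_I(1)[OF MN])
    show "ip2 (\<lambda>z. M *v f z) (\<lambda>z. M *v g z) = ip1 f g" for f g
      unfolding ip2_def by (simp add: matrix_vector_mul_assoc NM)
  qed (rule holomorphic_on_const)
  have K2: "M ** K1 z w ** madj M = power_kernel r z w" if zw: "z \<in> disc" "w \<in> disc" for z w
  proof -
    have "K1 z w $ i $ k = (N ** power_kernel r z w ** madj N) $ i $ k" for i k
      unfolding r_def power_kernel_conj[OF bN NN] K1[OF zw]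
      using bB unfolding block_diagonal_def by auto
    then have "K1 z w = N ** power_kernel r z w ** madj N" by (simp add: vec_eq_iff)
    then have "M ** K1 z w ** madj M = (M ** N) ** power_kernel r z w ** madj (M ** N)"
      by (simp only: madj_mult matrix_mul_assoc)
    then show ?thesis by (simp add: MN madj_mat_1)
  qed
  interpret R2: rkhs H2 ip2 "\<lambda>z w. M ** K1 z w ** madj M" by (rule R2)
  define S where "S = sum_bergman b \<eta>"
  define q where "q = sum_bergman_ip b \<eta>"
  \<comment> \<open>The components of \<open>H2\<close> are witnesses for the choices in
    \<open>bergman\<close>.\<close>
  have R3: "rkhs S q (power_kernel r)"
    unfolding S_def q_def r_def
    by (rule rkhs_sum_bergman) (use is_bergman_component[OF R2 K2] in \<open>simp add: r_def\<close>)
  interpret R3: rkhs S q "power_kernel r" by (rule R3)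
  have lb3: "R3.locally_bounded" by (rule rkhs_power_kernel_locally_bounded[OF R3]) simp
  define G where "G = Gamma_N b \<eta> Y N"
  have lN: "lower b N" and lM: "lower b M" using bN bM by (auto simp: lower_def block_diagonal_def)
  have G: "G f = dop b (C ** N) f" if "f \<in> hol_sections" for f
    unfolding G_def Gamma_N_def Gamma_eq_dop C_def[symmetric] dop_block_diagonal[OF bN that, symmetric]
    by (rule dop_dop[OF lC lN that])
  have hol3: "f \<in> hol_sections" if "f \<in> S" for f by (rule R3.hol[OF that])
  have injG: "inj_on G S"
  proof (rule inj_on_inverseI[of _ "dop b (M ** D)"])
    fix f assume f: "f \<in> S"
    have "(M ** D) ** (C ** N) = M ** (D ** C) ** N" by (simp only: matrix_mul_assoc)
    then have "(M ** D) ** (C ** N) = mat 1" by (simp add: DC MN)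
    then show "dop b (M ** D) (G f) = f"
      using dop_dop[OF lower_mult[OF lM lD] lower_mult[OF lC lN] hol3[OF f]]
      by (simp add: G[OF hol3[OF f]] dop_mat_1[OF hol3[OF f]])
  qed
  have ipG: "image_ip b \<eta> Y N (G f) (G g) = q f g" if "f \<in> S" "g \<in> S" for f g
    using inv_into_f_f[OF injG] that unfolding image_ip_def G_def S_def q_def by simp
  \<comment> \<open>Existence of some kernel is what gives \<open>kernel_N\<close> its defining
    property.\<close>
  have "\<exists>K'. rkhs (G ` S) (image_ip b \<eta> Y N) K'"
  proof (rule R3.rkhs_image[OF injG])
    show "G (f + g) = G f + G g" if "f \<in> S" "g \<in> S" for f g
      using dop_add[OF hol3[OF that(1)] hol3[OF that(2)]] that R3.add_mem
      by (simp add: G[OF hol3])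
    show "G (\<lambda>z. c *s f z) = (\<lambda>z. c *s G f z)" if "f \<in> S" for c f
      using dop_cmult[OF hol3[OF that]] G[OF hol3[OF that]] G[OF hol3[OF R3.scl_mem[OF that]]] by simp
    show "G f \<in> hol_sections" if "f \<in> S" for f
      unfolding G[OF hol3[OF that]] by (rule dop_hol_sections[OF hol3[OF that]])
    show "R3.bounded_functional (\<lambda>f. G f w $ i)" if "w \<in> disc" for w i
      using R3.bounded_functional_dop[OF lb3 that, of b "C ** N" i] G[OF hol3]
      unfolding R3.bounded_functional_def by (simp add: R3.add_mem R3.scl_mem)
  qed (rule ipG)
  then have "\<exists>K'. reproducing_kernel (Gamma_N b \<eta> Y N ` sum_bergman b \<eta>) (image_ip b \<eta> Y N) K'"
    unfolding G_def S_def using rkhs.reproducing by blast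
  then have KN: "reproducing_kernel (G ` S) (image_ip b \<eta> Y N) (kernel_N b \<eta> Y N)"
    unfolding kernel_N_def G_def S_def by (rule someI_ex)
  have GM: "G (\<lambda>z. M *v T f z) = f" if "f \<in> H" for f
    unfolding G_def Gamma_N_def Gamma_eq_dop C_def[symmetric]
    by (simp add: matrix_vector_mul_assoc NM CT[OF hol[OF that]])
  have GH2: "G ` H2 = H" unfolding H2_def image_image using GM by force
  have KH: "reproducing_kernel (G ` H2) ip K" unfolding GH2 by (rule R.reproducing)
  have ip2G: "ip (G f) (G g) = ip2 f g" for f g
    unfolding ip2_def ip1_def G_def Gamma_N_def Gamma_eq_dop C_def ..
  have ks: "R2.ksec u x = R3.ksec u x" if "u \<in> disc" for u x
    unfolding R2.ksec_def R3.ksec_def using K2[OF _ that] by (simp add: fun_eq_iff)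
  \<comment> \<open>\<open>H\<close> is the image of \<open>H2\<close> under \<open>G\<close>, and
    \<open>kernel_N\<close> belongs to the image of \<open>S\<close>. \<open>H2\<close> and
    \<open>S\<close> have the same kernel sections, so \<open>kernel_image\<close> gives the same
    formula for both kernels.\<close>
  have "kernel_N b \<eta> Y N z w = K z w" if zw: "z \<in> disc" "w \<in> disc" for z w
  proof -
    have "kernel_N b \<eta> Y N z w *v x = K z w *v x" for x
    proof -
      have "(\<lambda>u. if u \<in> disc then \<chi> i. cnj (cdot (G (R3.ksec u (axis i 1)) w) x) else 0)
        = (\<lambda>u. if u \<in> disc then \<chi> i. cnj (cdot (G (R2.ksec u (axis i 1)) w) x) else 0)"
        using ks by (intro ext if_cong) simp_all
      moreover have "kernel_N b \<eta> Y N z w *v x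
          = G (\<lambda>u. if u \<in> disc then \<chi> i. cnj (cdot (G (R3.ksec u (axis i 1)) w) x) else 0) z"
        by (rule R3.kernel_image[OF _ KN zw]) (rule ipG)
      moreover have "K z w *v x
          = G (\<lambda>u. if u \<in> disc then \<chi> i. cnj (cdot (G (R2.ksec u (axis i 1)) w) x) else 0) z"
        by (rule R2.kernel_image[OF _ KH zw]) (rule ip2G)
      ultimately show ?thesis by (simp only:)
    qed
    then show ?thesis by (simp add: matrix_eq)
  qed
  then show ?thesis using \<eta> bN iN by blast
qed

section \<open>Hermitian structures and transport to the given bundle\<close>

lemma pos_def_matrix_inv:
  assumes "pos_def A" "invertible A" shows "pos_def (matrix_inv A)"
  unfolding pos_def_def
proof (intro conjI allI impI)
  have A: "madj A = A" using assms(1) by (simp add: pos_def_def)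
  have "madj (matrix_inv A ** A) = mat 1" by (simp add: matrix_inv_left'[OF assms(2)] madj_mat_1)
  then have "A ** madj (matrix_inv A) = mat 1" by (simp add: madj_mult A)
  then show "madj (matrix_inv A) = matrix_inv A" using matrix_inv_eq by metis
  fix x :: "complex^'a" assume x: "x \<noteq> 0"
  define y where "y = matrix_inv A *v x"
  have Ay: "A *v y = x" by (simp add: y_def matrix_vector_mul_assoc matrix_inv_right'[OF assms(2)])
  then have "y \<noteq> 0" using x by auto
  then have "0 < Re (cdot (A *v y) y)" using assms(1) by (simp add: pos_def_def)
  then show "0 < Re (cdot (matrix_inv A *v x) x)"
    using cdot_commute[of x y] by (simp add: Ay y_def[symmetric])
qed

lemma matrix_inv_matrix_inv: "invertible (A::complex^'n^'n) \<Longrightarrow> matrix_inv (matrix_inv A) = A"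
  by (rule matrix_inv_eq[OF matrix_inv_left'])

text \<open>For inverse kernel values the invariance condition is \<open>kernel_invariant\<close> on
  the diagonal.\<close>

lemma invariant_hermitian_kernel:
  assumes R: "rkhs H ip K" and J: "unitary_action J H ip"
    and inv: "\<And>z. z \<in> disc \<Longrightarrow> invertible (K z z)"
  shows "invariant_hermitian J (\<lambda>z. matrix_inv (K z z))"
proof -
  interpret rkhs H ip K by (rule R)
  show ?thesis
    unfolding invariant_hermitian_def
  proof (intro conjI ballI)
    show "pos_def (matrix_inv (K z z))" if "z \<in> disc" for z
      by (intro pos_def_matrix_inv pos_def_kernel inv that)
    fix g z assume g: "g \<in> carrier mob_cover" and z: "z \<in> disc"
    show "J g z ** matrix_inv (matrix_inv (K (act g z) (act g z))) ** madj (J g z)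
        = matrix_inv (matrix_inv (K z z))"
      unfolding matrix_inv_matrix_inv[OF inv[OF act_in_disc[OF g z]]] matrix_inv_matrix_inv[OF inv[OF z]]
      by (rule kernel_invariant[OF J g z z, symmetric])
  qed
qed

text \<open>The cocycle identity for the product of the inverse of \<open>g\<close> with
  \<open>g\<close> exhibits an inverse matrix.\<close>

lemma homogeneous_bundle_invertible:
  assumes J: "homogeneous_bundle J" and g: "g \<in> carrier mob_cover" and z: "z \<in> disc"
  shows "invertible (J g z)"
proof -
  interpret G: group mob_cover by (rule group_mob_cover)
  have gi: "inv\<^bsub>mob_cover\<^esub> g \<in> carrier mob_cover" using g by simp
  have "J (inv\<^bsub>mob_cover\<^esub> g \<otimes>\<^bsub>mob_cover\<^esub> g) z = J g z ** J (inv\<^bsub>mob_cover\<^esub> g) (act g z)"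
    using J g gi z unfolding homogeneous_bundle_def by blast
  moreover have "J \<one>\<^bsub>mob_cover\<^esub> z = mat 1" using J z unfolding homogeneous_bundle_def by blast
  ultimately have "J g z ** J (inv\<^bsub>mob_cover\<^esub> g) (act g z) = mat 1" using g by simp
  then show ?thesis by (rule invertible_I(1))
qed

text \<open>Rotations fix 0, and \<open>c_of\<close> vanishes on them, so the elementary multiplier
  is diagonal there; entries linking different blocks pick up a phase.\<close>

lemma elementary_kernel_block_diagonal:
  assumes R: "rkhs H ip K" and J: "unitary_action (elementary_mult b \<eta> Y) H ip"
  shows "block_diagonal b (K 0 0)"
  unfolding block_diagonal_def
proof (intro allI impI)
  interpret rkhs H ip K by (rule R)
  fix i k assume nz: "K 0 0 $ i $ k \<noteq> 0"
  show "b i = b k"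
  proof (rule ccontr)
    assume ne: "b i \<noteq> b k"
    \<comment> \<open>The angle that makes the phase of this entry equal to -1.\<close>
    define t where "t = pi / (real (b i) - real (b k))"
    have "elementary_mult b \<eta> Y (t, 0) 0 = diagonal_mult b \<eta> (t, 0) 0"
      by (auto simp: elementary_mult_def diagonal_mult_def vec_eq_iff c_of_def mat_def)
    then have "K 0 0 $ i $ k = (diagonal_mult b \<eta> (t, 0) 0 ** K 0 0 ** madj (diagonal_mult b \<eta> (t, 0) 0)) $ i $ k"
      using kernel_invariant[OF J rotation_mem[of t], of 0 0] by (simp add: act_rotation)
    also have "\<dots> = cis (t * (\<eta> + real (b i))) * K 0 0 $ i $ k * cis (- (t * (\<eta> + real (b k))))"
      unfolding diagonal_mult_conj deriv_pow_rotation cis_cnj ..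
    also have "\<dots> = (cis (t * (\<eta> + real (b i))) * cis (- (t * (\<eta> + real (b k))))) * K 0 0 $ i $ k"
      by (simp only: mult_ac)
    also have "cis (t * (\<eta> + real (b i))) * cis (- (t * (\<eta> + real (b k)))) = cis pi"
    proof -
      have "t * (\<eta> + real (b i)) + - (t * (\<eta> + real (b k))) = t * (real (b i) - real (b k))"
        by (simp add: algebra_simps)
      also have "\<dots> = pi" using ne by (simp add: t_def)
      finally show ?thesis by (simp only: cis_mult)
    qed
    finally show False using nz by simp
  qed
qed

text \<open>What remains is transport by \<open>F\<close>: unitarity, shift invariance and
  invertibility of the kernel have to reach the elementary model, where
  \<open>elementary_kernel\<close> applies, and the Hermitian structures have to be matched on the
  way back.\<close>

theorem theorem3p1:
  fixes J :: "mob \<Rightarrow> complex \<Rightarrow> complex^'n^'n"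
    and H :: "(complex \<Rightarrow> complex^'n) set"
    and ip :: "(complex \<Rightarrow> complex^'n) \<Rightarrow> (complex \<Rightarrow> complex^'n) \<Rightarrow> complex"
    and K :: "complex \<Rightarrow> complex \<Rightarrow> complex^'n^'n"
  assumes "elementary_bundle J"
    and "bundle_kernel J H ip K"
    and "shift_invariant H"
  shows "\<exists>m b \<eta> Y N F h h'.
    \<eta> > 0 \<and> grading m b \<and> subdiagonal b Y \<and> block_diagonal b N \<and> invertible N \<and>
    bundle_iso J (elementary_mult b \<eta> Y) F \<and>
    (\<forall>z\<in>disc. \<forall>w\<in>disc. kernel_N b \<eta> Y N z w = F z ** K z w ** madj (F w)) \<and>
    invariant_hermitian J h \<and> h 0 = matrix_inv (K 0 0) \<and>
    elementary_hermitian b \<eta> Y (herm_N b \<eta> Y N) h' \<and>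
    (\<forall>z\<in>disc. h z = madj (F z) ** h' z ** F z)"
proof -
  obtain m b \<eta> Y F where hom: "homogeneous_bundle J" and gr: "grading m b" and sub: "subdiagonal b Y"
    and iso: "bundle_iso J (elementary_mult b \<eta> Y) F"
    using assms(1) unfolding elementary_bundle_def by blast
  have holF: "(\<lambda>z. F z $ i $ k) holomorphic_on disc" for i k
    using iso unfolding bundle_iso_def by blast
  have invF: "invertible (F z)" if "z \<in> disc" for z
    using iso that unfolding bundle_iso_def by blast
  have FJ: "F z ** J g z = elementary_mult b \<eta> Y g z ** F (act g z)"
    if "g \<in> carrier mob_cover" "z \<in> disc" for g z
    using iso that unfolding bundle_iso_def by blast
  have R: "rkhs H ip K" and UJ: "unitary_action J H ip" and inv0: "invertible (K 0 0)"
    using assms(2) unfolding bundle_kernel_def rkhs_def by blast+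
  interpret R: rkhs H ip K by (rule R)
  interpret G: group mob_cover by (rule group_mob_cover)
  have d0: "(0::complex) \<in> disc" by simp
  define \<Phi> where "\<Phi> = (\<lambda>f z. F z *v f z :: complex^'n)"
  define ip1 where "ip1 f g = ip (\<lambda>z. matrix_inv (F z) *v f z) (\<lambda>z. matrix_inv (F z) *v g z)" for f g
  define K1 where "K1 z w = F z ** K z w ** madj (F w)" for z w
  have \<Phi>_inv: "(\<lambda>z. matrix_inv (F z) *v \<Phi> f z) = f" if "f \<in> H" for f
  proof
    show "matrix_inv (F z) *v \<Phi> f z = f z" for z
      using hol_sectionsD(2)[OF R.hol[OF that], of z] matrix_inv_left'[OF invF, of z]
      by (cases "z \<in> disc") (auto simp: \<Phi>_def matrix_vector_mul_assoc simp del: mem_ball_0)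
  qed
  have ip1: "ip1 (\<Phi> f) (\<Phi> g) = ip f g" if "f \<in> H" "g \<in> H" for f g
    unfolding ip1_def \<Phi>_inv[OF that(1)] \<Phi>_inv[OF that(2)] ..
  have R1: "rkhs (\<Phi> ` H) ip1 K1"
    unfolding K1_def \<Phi>_def
    by (rule R.multiplier_image[OF holF invF]) (use ip1 in \<open>simp_all add: \<Phi>_def\<close>)
  have U1: "unitary_action (elementary_mult b \<eta> Y) (\<Phi> ` H) ip1"
    unfolding unitary_action_def
  proof (intro ballI conjI)
    fix g assume g: "g \<in> carrier mob_cover"
    then have gi: "inv\<^bsub>mob_cover\<^esub> g \<in> carrier mob_cover" by simp
    let ?U = "section_action J g"
    let ?V = "section_action (elementary_mult b \<eta> Y) g"
    have U: "?U ` H = H" "\<And>f h. f \<in> H \<Longrightarrow> h \<in> H \<Longrightarrow> ip (?U f) (?U h) = ip f h"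
      using UJ g unfolding unitary_action_def by blast+
    \<comment> \<open>The intertwining relation of \<open>F\<close>, used at the inverse of
      \<open>g\<close>.\<close>
    have V\<Phi>: "?V (\<Phi> f) = \<Phi> (?U f)" for f
      using FJ[OF gi]
      by (auto simp: section_action_def \<Phi>_def fun_eq_iff matrix_vector_mul_assoc)
    have "?V ` \<Phi> ` H = \<Phi> ` ?U ` H" unfolding image_image V\<Phi> ..
    then show "?V ` \<Phi> ` H = \<Phi> ` H" by (simp only: U(1))
    fix f h assume "f \<in> \<Phi> ` H" "h \<in> \<Phi> ` H"
    then obtain f' h' where f': "f' \<in> H" "f = \<Phi> f'" and h': "h' \<in> H" "h = \<Phi> h'" by blast
    have "?U f' \<in> H" "?U h' \<in> H" using U(1) f'(1) h'(1) by blast+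
    then show "ip1 (?V f) (?V h) = ip1 f h"
      unfolding f'(2) h'(2) V\<Phi> using U(2) f'(1) h'(1) by (simp only: ip1)
  qed
  \<comment> \<open>Multiplication by \<open>z\<close> is scalar at each point and so commutes with
    \<open>F z\<close>.\<close>
  have "shift_invariant (\<Phi> ` H)"
    unfolding shift_invariant_def
  proof
    fix f assume "f \<in> \<Phi> ` H"
    then obtain f' where f': "f' \<in> H" "f = \<Phi> f'" by blast
    have "(\<lambda>z. z *s f' z) \<in> H" using assms(3) f'(1) unfolding shift_invariant_def by (rule bspec)
    moreover have "(\<lambda>z. z *s f z) = \<Phi> (\<lambda>z. z *s f' z)"
      by (simp add: f'(2) \<Phi>_def vector_scalar_commute)
    ultimately show "(\<lambda>z. z *s f z) \<in> \<Phi> ` H" by blast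
  qed
  \<comment> \<open>Invertibility is assumed at the origin only; the invertible multiplier of
    \<open>(0, z)\<close> spreads it along the diagonal.\<close>
  moreover have invK: "invertible (K z z)" if z: "z \<in> disc" for z
  proof -
    have z1: "cmod z < 1" using z by simp
    have "K z z = J (0, z) z ** K 0 0 ** madj (J (0, z) z)"
      using R.kernel_invariant[OF UJ translation_mem[OF z1, of 0] z z] by (simp add: act_to_zero)
    moreover have "invertible (J (0, z) z)"
      by (rule homogeneous_bundle_invertible[OF hom translation_mem[OF z1] z])
    ultimately show ?thesis using inv0 by (simp add: invertible_mult invertible_madj)
  qed
  have invK1: "invertible (K1 z z)" if "z \<in> disc" for z
    unfolding K1_def by (intro invertible_mult invertible_madj invF invK that)
  ultimately obtain N where \<eta>: "\<eta> > 0" and N: "block_diagonal b N" "invertible N"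
    and KN: "\<And>z w. z \<in> disc \<Longrightarrow> w \<in> disc \<Longrightarrow> kernel_N b \<eta> Y N z w = K1 z w"
    using elementary_kernel[OF R1 U1 _ _ gr] d0 by blast
  define h where "h z = matrix_inv (K z z)" for z
  define h' where "h' z = matrix_inv (K1 z z)" for z
  have ih: "invariant_hermitian J h"
    unfolding h_def by (rule invariant_hermitian_kernel[OF R UJ invK])
  have ih': "invariant_hermitian (elementary_mult b \<eta> Y) h'"
    unfolding h'_def by (rule invariant_hermitian_kernel[OF R1 U1 invK1])
  have "h' 0 = herm_N b \<eta> Y N" by (simp add: h'_def herm_N_def KN[OF d0 d0])
  moreover have "block_diagonal b (h' 0)"
    unfolding h'_def
    by (intro block_diagonal_matrix_inv elementary_kernel_block_diagonal[OF R1 U1] invK1 d0)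
  ultimately have eh: "elementary_hermitian b \<eta> Y (herm_N b \<eta> Y N) h'"
    unfolding elementary_hermitian_def using ih' by simp
  have hh': "h z = madj (F z) ** h' z ** F z" if z: "z \<in> disc" for z
  proof -
    \<comment> \<open>Conjugating \<open>K1 z z ** h' z = mat 1\<close> by \<open>F z\<close> and
      cancelling its left factor exhibits the inverse of \<open>K z z\<close>.\<close>
    have "matrix_inv (F z) ** (K1 z z ** h' z) ** F z = mat 1"
      by (simp add: h'_def matrix_inv_right'[OF invK1[OF z]] matrix_inv_left'[OF invF[OF z]])
    moreover have "matrix_inv (F z) ** (K1 z z ** h' z) ** F z
        = (matrix_inv (F z) ** F z) ** (K z z ** (madj (F z) ** h' z ** F z))"
      by (simp only: K1_def matrix_mul_assoc)
    ultimately have "K z z ** (madj (F z) ** h' z ** F z) = mat 1"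
      by (simp add: matrix_inv_left'[OF invF[OF z]])
    then show ?thesis unfolding h_def by (rule matrix_inv_eq)
  qed
  have "h 0 = matrix_inv (K 0 0)" by (simp add: h_def)
  then show ?thesis
    using \<eta> gr sub N iso KN ih eh hh' unfolding K1_def by blast
qed

end
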